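(* Let $K\subset\mathbb{R}^{d\times m}$, let $U\subset\mathbb{R}^{d\times m}$ be open, and let $1<p<\infty$ be such that $U$ can be $U$-reduced to $K$ in weak $L^p$. Then for any regular domain $\Omega\subset\mathbb{R}^m$, any $X_0\in U$, $b\in\mathbb{R}^d$, and any $\delta>0$, $\alpha\in(0,1)$ there exists a piecewise affine map $w\in W^{1,1}(\Omega,\mathbb{R}^d)\cap C^{\alpha}(\overline{\Omega},\mathbb{R}^d)$ with $w(x)=l_{X_0,b}(x):=X_0x+b$ on $\partial\Omega$ such that \[ \nabla w(x)\in K\quad\text{for a.e. }x\in\Omega,\qquad \|w-l_{X_0,b}\|_{C^{\alpha}(\overline{\Omega},\mathbb{R}^d)}<\delta, \] and there exists a constant $C>0$ such that for all $t>0$ \[ |\{x\in\Omega:\ |\nabla w(x)|>t\}|\le C\,t^{-p}. \] If moreover $U$ can be $U$-reduced to $K$ exactly in weak $L^p$, then for any regular domain $\Omega\subset\mathbb{R}^m$, any $X_0\in U$, $b\in\mathbb{R}^d$, and any $\delta>0$, $\alpha\in(0,1)$ there exist a piecewise affine map $w\in W^{1,1}(\Omega,\mathbb{R}^d)\cap C^{\alpha}(\overline{\Omega},\mathbb{R}^d)$ and constants $C,c>0$ such that $w=l_{X_0,b}$ on $\partial\Omega$, $\nabla w(x)\in K$ for a.e. $x\in\Omega$, $\|w-l_{X_0,b}\|_{C^{\alpha}(\overline{\Omega},\mathbb{R}^d)}<\delta$, $|\{x\in\Omega:\ |\nabla w(x)|>t\}|\le C\,t^{-p}$ for all $t>0$,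 and \[ |\{x\in\Omega:\ |\nabla w(x)|>t\}|\ge c\,t^{-p}\qquad\text{for all }t\in(1,\infty). \]
   Context: Throughout, $|X|$ denotes the Euclidean (Frobenius) norm of a matrix and $|E|$ the Lebesgue measure of a set $E$. Regular domain: a set $\Omega\subset\mathbb{R}^m$ that is open, bounded, connected (in particular nonempty) and whose boundary has zero $m$-dimensional Lebesgue measure. Piecewise affine map: $w\in W^{1,1}(\Omega,\mathbb{R}^d)$, $\Omega$ a regular domain, is piecewise affine if there is an at most countable decomposition $\Omega=\bigcup_i\Omega_i\cup\mathcal{N}$ into pairwise disjoint regular domains $\Omega_i\subset\Omega$ and a null set $\mathcal{N}$ such that $w$ agrees with an affine map $x\mapsto X_ix+b_i$ on each $\Omega_i$. $U$-reducibility: for $U,K\subset\mathbb{R}^{d\times m}$ and $1<p<\infty$, "$U$ can be $U$-reduced to $K$ in weak $L^p$" means that there is a constant $M=M(U,K,p)\ge1$ such that for all $X_0\in U$, $b\in\mathbb{R}^d$, $\varepsilon,\alpha\in(0,1)$, $q\in(1,\infty)$ and every regular domain $\Omega\subset\mathbb{R}^m$ there exists a piecewise affine map $w\in W^{1,1}(\Omega,\mathbb{R}^d)\cap C^\alpha(\overline{\Omega},\mathbb{R}^d)$ with $w(x)=X_0x+b$ on $\partial\Omega$ such that (i) $|\{x\in\Omega:|\nabla w(x)|>t\}|\le M^p(1+|X_0|^p)|\Omega|t^{-p}$ for all $t>0$; and, with $\Omega_{err}:=\{x\in\Omega:\nabla w(x)\notin K\}$, (ii) $\nabla w(x)\in U$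 for a.e. $x\in\Omega_{err}$; (iii) $\int_{\Omega_{err}}(1+|\nabla w|)^q\,dx<\varepsilon|\Omega|$. "$U$ can be $U$-reduced to $K$ exactly in weak $L^p$" means that in addition there is a constant $m_*=m_*(U,K,p)>0$ (independent of $\varepsilon$ and the other data) such that the maps $w$ in this definition can be chosen to satisfy also (iv) $|\{x\in\Omega:|\nabla w(x)|>t\}|\ge m_*^p|\Omega|t^{-p}$ for all $t>1$. *)

theory Defs
  imports "HOL-Analysis.Analysis"
begin

text \<open>
  A \<open>d \<times> m\<close> matrix is an element of \<^typ>\<open>real^'m^'d\<close>; the norm of this type
  is the Frobenius norm. Maps on a domain or on its closure are total functions on
  \<^typ>\<open>real^'m\<close>, and only their values on the set in question are ever used.
\<close>

definition regular_domain :: "(real^'m) set \<Rightarrow> bool" where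
  "regular_domain \<Omega> \<longleftrightarrow>
     open \<Omega> \<and> bounded \<Omega> \<and> connected \<Omega> \<and> \<Omega> \<noteq> {} \<and> frontier \<Omega> \<in> null_sets lebesgue"

definition affine_map :: "real^'m^'d \<Rightarrow> real^'d \<Rightarrow> real^'m \<Rightarrow> real^'d" where
  "affine_map X b x = X *v x + b"

definition partial_deriv :: "'m \<Rightarrow> (real^'m \<Rightarrow> real) \<Rightarrow> real^'m \<Rightarrow> real" where
  "partial_deriv j \<phi> x = frechet_derivative \<phi> (at x) (axis j 1)"

primrec C_class :: "nat \<Rightarrow> (real^'m \<Rightarrow> real) \<Rightarrow> bool" where
  "C_class 0 \<phi> \<longleftrightarrow> continuous_on UNIV \<phi>"
| "C_class (Suc k) \<phi> \<longleftrightarrow>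
     (\<forall>x. \<phi> differentiable (at x)) \<and> (\<forall>j. C_class k (partial_deriv j \<phi>))"

text \<open>The space of test functions \<open>C\<^sub>c\<^sup>\<infinity>(\<Omega>)\<close>, each extended by zero to the whole space.\<close>

definition test_function :: "(real^'m) set \<Rightarrow> (real^'m \<Rightarrow> real) \<Rightarrow> bool" where
  "test_function \<Omega> \<phi> \<longleftrightarrow>
     (\<forall>k. C_class k \<phi>) \<and> compact (closure {x. \<phi> x \<noteq> 0}) \<and> closure {x. \<phi> x \<noteq> 0} \<subseteq> \<Omega>"

text \<open>
  \<open>W11_gradient \<Omega> w G\<close> says that \<open>w \<in> W\<^sup>1\<^sup>,\<^sup>1(\<Omega>)\<close> and that \<open>G\<close> represents the weak
  gradient \<open>\<nabla>w\<close>. Such a \<open>G\<close> is determined by \<open>w\<close> up to a null subset of \<open>\<Omega>\<close>, so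
  assertions about \<open>\<nabla>w\<close> that ignore null sets do not depend on its choice.
\<close>

definition W11_gradient ::
    "(real^'m) set \<Rightarrow> (real^'m \<Rightarrow> real^'d) \<Rightarrow> (real^'m \<Rightarrow> real^'m^'d) \<Rightarrow> bool" where
  "W11_gradient \<Omega> w G \<longleftrightarrow>
     set_integrable lebesgue \<Omega> w \<and> set_integrable lebesgue \<Omega> G \<and>
     (\<forall>\<phi>. test_function \<Omega> \<phi> \<longrightarrow>
        (\<forall>i j. (LINT x:\<Omega>|lebesgue. w x $ i * partial_deriv j \<phi> x)
             = - (LINT x:\<Omega>|lebesgue. G x $ i $ j * \<phi> x)))"

definition W11 :: "(real^'m) set \<Rightarrow> (real^'m \<Rightarrow> real^'d) \<Rightarrow> bool" where
  "W11 \<Omega> w \<longleftrightarrow> (\<exists>G. W11_gradient \<Omega> w G)"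

text \<open>
  Since regular domains are nonempty, a countable set \<open>\<F>\<close> of disjoint pieces is the same
  as a countable family \<open>(\<Omega>\<^sub>i)\<close> of pairwise disjoint pieces.
\<close>

definition piecewise_affine :: "(real^'m) set \<Rightarrow> (real^'m \<Rightarrow> real^'d) \<Rightarrow> bool" where
  "piecewise_affine \<Omega> w \<longleftrightarrow> W11 \<Omega> w \<and>
     (\<exists>\<F> N. countable \<F> \<and> disjoint \<F> \<and> (\<forall>S\<in>\<F>. regular_domain S \<and> S \<subseteq> \<Omega>) \<and>
        N \<in> null_sets lebesgue \<and> \<Omega> = \<Union>\<F> \<union> N \<and>
        (\<forall>S\<in>\<F>. \<exists>X b. \<forall>x\<in>S. w x = affine_map X b x))"

definition holder_norm :: "real \<Rightarrow> (real^'m) set \<Rightarrow> (real^'m \<Rightarrow> real^'d) \<Rightarrow> ennreal" where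
  "holder_norm \<alpha> S f =
     (SUP x\<in>S. ennreal (norm (f x))) +
     (SUP (x, y)\<in>{(x, y). x \<in> S \<and> y \<in> S \<and> x \<noteq> y}.
        ennreal (norm (f x - f y) / norm (x - y) powr \<alpha>))"

definition holder_space :: "real \<Rightarrow> (real^'m) set \<Rightarrow> (real^'m \<Rightarrow> real^'d) set" where
  "holder_space \<alpha> S = {f. holder_norm \<alpha> S f < \<infinity>}"

definition super_level :: "(real^'m) set \<Rightarrow> (real^'m \<Rightarrow> real^'m^'d) \<Rightarrow> real \<Rightarrow> (real^'m) set" where
  "super_level \<Omega> G t = {x\<in>\<Omega>. norm (G x) > t}"

definition error_set ::
    "(real^'m^'d) set \<Rightarrow> (real^'m) set \<Rightarrow> (real^'m \<Rightarrow> real^'m^'d) \<Rightarrow> (real^'m) set" where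
  "error_set K \<Omega> G = {x\<in>\<Omega>. G x \<notin> K}"

text \<open>
  The requirements on a single map in the definition of reducibility. The integral over the
  error set is a nonnegative (possibly infinite) one, so that its smallness entails
  integrability.
\<close>

definition reducing_map ::
    "(real^'m^'d) set \<Rightarrow> (real^'m^'d) set \<Rightarrow> real \<Rightarrow> real \<Rightarrow> real^'m^'d \<Rightarrow> real^'d \<Rightarrow>
     real \<Rightarrow> real \<Rightarrow> real \<Rightarrow> (real^'m) set \<Rightarrow>
     (real^'m \<Rightarrow> real^'d) \<Rightarrow> (real^'m \<Rightarrow> real^'m^'d) \<Rightarrow> bool" where
  "reducing_map U K p M X\<^sub>0 b \<epsilon> \<alpha> q \<Omega> w G \<longleftrightarrow>
     piecewise_affine \<Omega> w \<and> W11_gradient \<Omega> w G \<and>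
     w \<in> holder_space \<alpha> (closure \<Omega>) \<and>
     (\<forall>x\<in>frontier \<Omega>. w x = affine_map X\<^sub>0 b x) \<and>
     (\<forall>t>0. measure lebesgue (super_level \<Omega> G t)
          \<le> M powr p * (1 + norm X\<^sub>0 powr p) * measure lebesgue \<Omega> * t powr (- p)) \<and>
     (AE x in lebesgue. x \<in> error_set K \<Omega> G \<longrightarrow> G x \<in> U) \<and>
     (\<integral>\<^sup>+x\<in>error_set K \<Omega> G. ennreal ((1 + norm (G x)) powr q) \<partial>lebesgue)
       < ennreal (\<epsilon> * measure lebesgue \<Omega>)"

text \<open>\<open>U\<close> can be \<open>U\<close>-reduced to \<open>K\<close> in weak \<open>L\<^sup>p\<close>.\<close>

definition reducible_weak_Lp :: "(real^'m^'d) set \<Rightarrow> (real^'m^'d) set \<Rightarrow> real \<Rightarrow> bool" where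
  "reducible_weak_Lp U K p \<longleftrightarrow>
     (\<exists>M\<ge>1. \<forall>X\<^sub>0\<in>U. \<forall>b. \<forall>\<epsilon>\<in>{0<..<1}. \<forall>\<alpha>\<in>{0<..<1}. \<forall>q>1. \<forall>\<Omega>. regular_domain \<Omega> \<longrightarrow>
        (\<exists>w G. reducing_map U K p M X\<^sub>0 b \<epsilon> \<alpha> q \<Omega> w G))"

text \<open>\<open>U\<close> can be \<open>U\<close>-reduced to \<open>K\<close> exactly in weak \<open>L\<^sup>p\<close>.\<close>

definition exactly_reducible_weak_Lp ::
    "(real^'m^'d) set \<Rightarrow> (real^'m^'d) set \<Rightarrow> real \<Rightarrow> bool" where
  "exactly_reducible_weak_Lp U K p \<longleftrightarrow>
     (\<exists>M\<ge>1. \<exists>m>0. \<forall>X\<^sub>0\<in>U. \<forall>b. \<forall>\<epsilon>\<in>{0<..<1}. \<forall>\<alpha>\<in>{0<..<1}. \<forall>q>1. \<forall>\<Omega>. regular_domain \<Omega> \<longrightarrow>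
        (\<exists>w G. reducing_map U K p M X\<^sub>0 b \<epsilon> \<alpha> q \<Omega> w G \<and>
           (\<forall>t>1. measure lebesgue (super_level \<Omega> G t)
                \<ge> m powr p * measure lebesgue \<Omega> * t powr (- p))))"

end

theory Submission
  imports Defs "HOL-Computational_Algebra.Polynomial"
begin

text \<open>
  The solution is the limit of an iteration that starts from the affine boundary datum. At each
  stage there is an open set \<open>V\<close>, not yet treated, on which the current map is locally affine with
  gradient in \<open>U\<close>. Vitali's theorem fills \<open>V\<close> up to a null set with small balls on which the
  map is affine, and on each ball the map is replaced by a scaled copy of a reducing map of the
  unit ball for the gradient at hand (a \<open>cell\<close>). Pieces on which the new gradient lies in \<open>K\<close>
  are never touched again; the remaining pieces, where the gradient lies in \<open>U\<close>, form the next \<open>V\<close>.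
  One such stage is \<open>reduction_step\<close>; it is carried out in \<open>reduction_step_exists\<close>.

  Three observations make the limit work.

  \<^item> Scaling a function by \<open>r\<close> in domain and range does not change the distribution of its gradient,
    but it multiplies its \<open>\<alpha>\<close>-Hoelder seminorm by \<open>r\<close> to the power \<open>1 - \<alpha>\<close>; and gluing functions
    that vanish outside disjoint balls costs only a factor \<open>2\<close>. So the corrections of a stage
    are as small in \<open>C\<^sup>\<alpha>\<close> as desired, although nothing is known about the Hoelder norm of the
    reducing maps except that it is finite.

  \<^item> Let the energy of a stage be the integral of \<open>(1 + |\<nabla>w|)\<^sup>p\<close> over \<open>V\<close>. The integral condition
    of reducibility, used with the exponent \<open>p\<close> and with \<open>\<epsilon> \<le> 1/2\<close>, at least halves the energy
    at each stage. The weak \<open>L\<^sup>p\<close> condition bounds the superlevel sets of the new gradient on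
    \<open>V\<close> by the energy, so a geometric series gives the weak \<open>L\<^sup>p\<close> bound for the limit. Since
    \<open>p > 1\<close>, a dyadic decomposition bounds the \<open>L\<^sup>1\<close> norm of the change of gradient in the same way, and the
    gradients converge in \<open>L\<^sup>1\<close>. The measure of \<open>V\<close> is at most the energy, so almost every
    point of the domain is eventually treated.

  \<^item> The lower bound comes from the first stage alone. Later stages change the gradient only on the
    set left untreated by the first one. By Chebyshev's inequality, the part of that set on which the
    first gradient exceeds \<open>t\<close> has at most \<open>\<epsilon> t\<^sup>-\<^sup>p\<close> times the measure of the domain.

  Two facts about weak gradients are needed. A map of class \<open>C\<^sup>\<alpha>\<close> and \<open>W\<^sup>1\<^sup>,\<^sup>1\<close> on a ball
  that vanishes on the sphere has a weak gradient on the whole space when both are extended by zero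
  (\<open>zero_extension_weak_pair\<close>); hence corrections can simply be summed, without boundary terms
  (\<open>weak_pair_series\<close>). Conversely, on a piece where the map is affine the given weak gradient
  is almost everywhere the matrix of the affine map (\<open>weak_gradient_of_affine_piece\<close>); this
  is the fundamental lemma of the calculus of variations and requires smooth cutoff functions.
\<close>

section \<open>Closure properties of smooth functions\<close>

definition smooth_fun :: "(real^'m \<Rightarrow> real) \<Rightarrow> bool" where
  "smooth_fun \<phi> \<longleftrightarrow> (\<forall>k. C_class k \<phi>)"

lemma partial_deriv_eq:
  "(\<phi> has_derivative D) (at x) \<Longrightarrow> partial_deriv j \<phi> x = D (axis j 1)"
  unfolding partial_deriv_def by (simp add: frechet_derivative_at[symmetric])

lemma smooth_fun_has_derivative:
  assumes "smooth_fun \<phi>"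
  shows "(\<phi> has_derivative frechet_derivative \<phi> (at x)) (at x)"
  using assms frechet_derivative_works unfolding smooth_fun_def by (metis C_class.simps(2))

lemma smooth_fun_partial_deriv: "smooth_fun \<phi> \<Longrightarrow> smooth_fun (partial_deriv j \<phi>)"
  unfolding smooth_fun_def by (metis C_class.simps(2))

lemma smooth_fun_continuous: "smooth_fun \<phi> \<Longrightarrow> continuous_on S \<phi>"
  unfolding smooth_fun_def by (metis C_class.simps(1) continuous_on_subset subset_UNIV)

lemma C_class_SucD: "C_class (Suc k) \<phi> \<Longrightarrow> C_class k \<phi>"
proof (induction k arbitrary: \<phi>)
  case 0
  then show ?case
    by (simp add: continuous_at_imp_continuous_on differentiable_imp_continuous_within)
qed simp

text \<open>
  The class \<open>C_class\<close> is defined through \<open>frechet_derivative\<close>. This rule and the next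
  replace it by an arbitrary family of derivatives, which can be computed by the usual rules.
\<close>

lemma C_class_SucI:
  assumes "\<And>x. (\<phi> has_derivative D x) (at x)" and "\<And>j. C_class k (\<lambda>x. D x (axis j 1))"
  shows "C_class (Suc k) \<phi>"
proof -
  have "partial_deriv j \<phi> = (\<lambda>x. D x (axis j 1))" for j
    using partial_deriv_eq[OF assms(1)] by blast
  then show ?thesis
    using assms by (auto simp: differentiable_def)
qed

lemma C_class_SucE:
  assumes "C_class (Suc k) \<phi>"
  obtains D where "\<And>x. (\<phi> has_derivative D x) (at x)" and "\<And>j. C_class k (\<lambda>x. D x (axis j 1))"
proof -
  have *: "(\<phi> has_derivative frechet_derivative \<phi> (at x)) (at x)" for x
    using assms frechet_derivative_works by auto
  have "C_class k (\<lambda>x. frechet_derivative \<phi> (at x) (axis j 1))" for j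
    using assms by (auto simp: partial_deriv_def[abs_def])
  with * show ?thesis by (rule that)
qed

lemma C_class_const: "C_class k (\<lambda>x. c)"
proof (induction k arbitrary: c)
  case (Suc k)
  then show ?case
    by (intro C_class_SucI[where D="\<lambda>_ _. 0"]) auto
qed simp

lemma C_class_add: "C_class k f \<Longrightarrow> C_class k g \<Longrightarrow> C_class k (\<lambda>x. f x + g x)"
proof (induction k arbitrary: f g)
  case 0
  then show ?case by (simp add: continuous_on_add)
next
  case (Suc k)
  obtain D where D: "\<And>x. (f has_derivative D x) (at x)" "\<And>j. C_class k (\<lambda>x. D x (axis j 1))"
    using C_class_SucE[OF Suc.prems(1)] by blast
  obtain E where E: "\<And>x. (g has_derivative E x) (at x)" "\<And>j. C_class k (\<lambda>x. E x (axis j 1))"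
    using C_class_SucE[OF Suc.prems(2)] by blast
  show ?case
    by (rule C_class_SucI[OF has_derivative_add[OF D(1) E(1)]]) (rule Suc.IH[OF D(2) E(2)])
qed

lemma C_class_mult: "C_class k f \<Longrightarrow> C_class k g \<Longrightarrow> C_class k (\<lambda>x. f x * g x)"
proof (induction k arbitrary: f g)
  case 0
  then show ?case by (simp add: continuous_on_mult)
next
  case (Suc k)
  obtain D where D: "\<And>x. (f has_derivative D x) (at x)" "\<And>j. C_class k (\<lambda>x. D x (axis j 1))"
    using C_class_SucE[OF Suc.prems(1)] by blast
  obtain E where E: "\<And>x. (g has_derivative E x) (at x)" "\<And>j. C_class k (\<lambda>x. E x (axis j 1))"
    using C_class_SucE[OF Suc.prems(2)] by blast
  show ?case
    by (rule C_class_SucI[OF has_derivative_mult[OF D(1) E(1)]])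
       (intro C_class_add Suc.IH D(2) E(2) C_class_SucD[OF Suc.prems(1)] C_class_SucD[OF Suc.prems(2)])
qed

lemma C_class_component: "C_class k (\<lambda>x::real^'m. x $ i)"
proof (cases k)
  case (Suc l)
  show ?thesis unfolding Suc
    by (rule C_class_SucI[where D="\<lambda>_ h. h $ i"])
       (auto intro!: C_class_const derivative_eq_intros bounded_linear_imp_has_derivative bounded_linear_vec_nth)
qed (simp add: continuous_on_component)

text \<open>
  Smoothness of a function \<open>D 0\<close> of one real variable is given by the sequence \<open>D\<close> of its
  derivatives; the statement is about all \<open>D n\<close> at once because the chain rule passes from \<open>D n\<close> to
  \<open>D (Suc n)\<close>.
\<close>

lemma C_class_comp_real:
  assumes "\<And>n t. (D n has_real_derivative D (Suc n) t) (at t)"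
  shows "C_class k f \<Longrightarrow> C_class k (\<lambda>x. D n (f x))"
proof (induction k arbitrary: n)
  case 0
  have "continuous_on UNIV (D n)"
    using assms by (meson DERIV_isCont continuous_at_imp_continuous_on)
  with 0 show ?case
    by (simp add: continuous_on_compose2)
next
  case (Suc k)
  obtain E where E: "\<And>x. (f has_derivative E x) (at x)" "\<And>j. C_class k (\<lambda>x. E x (axis j 1))"
    using C_class_SucE[OF Suc.prems(1)] by blast
  have "((\<lambda>x. D n (f x)) has_derivative (\<lambda>h. D (Suc n) (f x) * E x h)) (at x)" for x
    using has_derivative_compose[OF E(1) assms[unfolded has_field_derivative_def]] by blast
  then show ?case
    by (rule C_class_SucI) (intro C_class_mult E(2) Suc.IH C_class_SucD[OF Suc.prems])
qed

lemma C_class_sum: "(\<And>i. i \<in> I \<Longrightarrow> C_class k (f i)) \<Longrightarrow> C_class k (\<lambda>x. \<Sum>i\<in>I. f i x)"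
  by (induction I rule: infinite_finite_induct) (auto intro: C_class_const C_class_add)

lemma C_class_affine_comp:
  "C_class k \<phi> \<Longrightarrow> C_class k (\<lambda>x. \<phi> (a + r *\<^sub>R x))"
proof (induction k arbitrary: \<phi>)
  case 0
  then show ?case
    by (auto intro!: continuous_on_compose2[of UNIV \<phi>] continuous_intros)
next
  case (Suc k)
  obtain D where D: "\<And>x. (\<phi> has_derivative D x) (at x)" "\<And>j. C_class k (\<lambda>x. D x (axis j 1))"
    using C_class_SucE[OF Suc.prems(1)] by blast
  have aff: "((\<lambda>x. a + r *\<^sub>R x) has_derivative (\<lambda>h. r *\<^sub>R h)) (at x)" for x
    by (auto intro!: derivative_eq_intros)
  have lin: "D y (r *\<^sub>R h) = r * D y h" for y h
    using linear_scale[OF has_derivative_linear[OF D(1)]] by simp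
  have "((\<lambda>x. \<phi> (a + r *\<^sub>R x)) has_derivative (\<lambda>h. r * D (a + r *\<^sub>R x) h)) (at x)" for x
    using has_derivative_compose[OF aff D(1)] lin by simp
  then show ?case
    by (rule C_class_SucI) (intro C_class_mult C_class_const Suc.IH D(2))
qed

lemma partial_deriv_affine_comp:
  assumes "smooth_fun \<phi>"
  shows "partial_deriv j (\<lambda>x. \<phi> (a + r *\<^sub>R x)) x = r * partial_deriv j \<phi> (a + r *\<^sub>R x)"
proof -
  let ?D = "frechet_derivative \<phi> (at (a + r *\<^sub>R x))"
  note D = smooth_fun_has_derivative[OF assms]
  have aff: "((\<lambda>x. a + r *\<^sub>R x) has_derivative (\<lambda>h. r *\<^sub>R h)) (at x)" for x
    by (auto intro!: derivative_eq_intros)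
  have "partial_deriv j (\<lambda>x. \<phi> (a + r *\<^sub>R x)) x = ?D (r *\<^sub>R axis j 1)"
    by (rule partial_deriv_eq[OF has_derivative_compose[OF aff D]])
  then show ?thesis
    using linear_scale[OF has_derivative_linear[OF D], of "a + r *\<^sub>R x" r "axis j 1"] by (simp add: partial_deriv_def)
qed

lemma partial_deriv_mult:
  assumes "smooth_fun f" "smooth_fun g"
  shows "partial_deriv j (\<lambda>x. f x * g x) x = f x * partial_deriv j g x + partial_deriv j f x * g x"
  using partial_deriv_eq[OF has_derivative_mult[OF assms[THEN smooth_fun_has_derivative]]]
  by (simp add: partial_deriv_def)

section \<open>A smooth step function\<close>

text \<open>
  The step function is a normalised antiderivative of the bump that equals \<open>exp (-1 / (t (1 - t)))\<close> on
  \<open>(0, 1)\<close> and zero elsewhere. All derivatives of this bump have the form \<open>P(t) u(t)\<^sup>-\<^sup>k exp (-1/u(t))\<close> with a polynomial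
  \<open>P\<close> and \<open>u(t) = t (1 - t)\<close>, and this family is closed under differentiation. At \<open>0\<close> and
  \<open>1\<close> the derivative vanishes because the functions of the family are dominated there by a square.
\<close>

lemma flat_function_derivative_zero:
  fixes f :: "real \<Rightarrow> real"
  assumes "\<And>t. \<bar>f t\<bar> \<le> C * (t - s)\<^sup>2"
  shows "(f has_real_derivative 0) (at s)"
proof -
  have fs: "f s = 0" using assms[of s] by simp
  have lim: "((\<lambda>h. C * \<bar>h\<bar>) \<longlongrightarrow> 0) (at 0)"
    by (rule tendsto_eq_intros | simp)+
  have "((\<lambda>h. (f (s + h) - f s) / h) \<longlongrightarrow> 0) (at 0)"
  proof (rule Lim_null_comparison[OF _ lim])
    show "\<forall>\<^sub>F h in at 0. norm ((f (s + h) - f s) / h) \<le> C * \<bar>h\<bar>"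
      unfolding eventually_at_filter
    proof (intro always_eventually allI impI)
      fix h :: real assume "h \<noteq> 0"
      then show "norm ((f (s + h) - f s) / h) \<le> C * \<bar>h\<bar>"
        using assms[of "s + h"] fs by (simp add: divide_le_eq power2_eq_square algebra_simps abs_mult_self_eq)
    qed
  qed
  then show ?thesis by (simp add: DERIV_def)
qed

definition bump_poly :: "real poly" where "bump_poly = [:0, 1, -1:]"

definition bump_term :: "real poly \<Rightarrow> nat \<Rightarrow> real \<Rightarrow> real" where
  "bump_term P k t =
     (if 0 < t \<and> t < 1
      then poly P t * (1 / poly bump_poly t) ^ k * exp (- (1 / poly bump_poly t)) else 0)"

lemma bump_poly_pos: "0 < t \<Longrightarrow> t < 1 \<Longrightarrow> 0 < poly bump_poly t"
  by (simp add: bump_poly_def algebra_simps)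

text \<open>
  From the exponential series, \<open>v\<^sup>n exp (-v) \<le> n!\<close> for \<open>v \<ge> 0\<close>. With \<open>v = 1/u\<close> and \<open>n = k + 2\<close>
  this leaves a factor \<open>u\<^sup>2\<close>, and \<open>u\<close> is at most the distance to either end of \<open>[0, 1]\<close>.
\<close>

lemma bump_term_flat:
  assumes s: "s \<in> {0, 1}"
  shows "\<exists>C. \<forall>t. \<bar>bump_term P k t\<bar> \<le> C * (t - s)\<^sup>2"
proof -
  obtain B where B: "\<And>t. t \<in> {0..1} \<Longrightarrow> \<bar>poly P t\<bar> \<le> B"
    using continuous_on_compact_bound[of "{0..1::real}" "poly P", OF compact_Icc continuous_on_poly[OF continuous_on_id]]
    by (metis real_norm_def)
  have B0: "B \<ge> 0" using B[of 0] by simp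
  have "\<bar>bump_term P k t\<bar> \<le> B * fact (k + 2) * (t - s)\<^sup>2" for t
  proof (cases "0 < t \<and> t < 1")
    case True
    let ?u = "poly bump_poly t"
    have u: "?u > 0" using True bump_poly_pos by blast
    have "(1 / ?u) ^ (k + 2) / fact (k + 2) \<le> exp (1 / ?u)"
    proof -
      have s1: "(\<lambda>n. (1/?u) ^ n /\<^sub>R fact n) sums exp (1/?u)" by (rule exp_converges)
      show ?thesis
        using sum_le_suminf[OF sums_summable[OF s1], of "{k+2}"] sums_unique[OF s1] u
        by (simp add: field_simps)
    qed
    moreover have "(1 / ?u) ^ k \<le> E * (b * ?u\<^sup>2)"
      if "(1 / ?u) ^ (k + 2) / b \<le> E" "b > 0" for b E
    proof -
      have "(1 / ?u) ^ (k + 2) / b = (1 / ?u) ^ k / (b * ?u\<^sup>2)"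
        using u by (simp add: power_add field_simps power2_eq_square)
      then show ?thesis using that u by (simp add: pos_divide_le_eq mult.commute)
    qed
    ultimately have "(1 / ?u) ^ k \<le> exp (1 / ?u) * (fact (k + 2) * ?u\<^sup>2)"
      using fact_gt_zero by blast
    moreover have "x * exp (- e) \<le> c" if "x \<le> exp e * c" for x e c :: real
      using that by (simp add: exp_minus field_simps)
    ultimately have "(1 / ?u) ^ k * exp (- (1 / ?u)) \<le> fact (k + 2) * ?u\<^sup>2"
      by blast
    moreover have "?u\<^sup>2 \<le> (t - s)\<^sup>2"
    proof -
      have "?u \<le> \<bar>t - s\<bar>"
        using s True zero_le_square[of "t - 1"] by (auto simp: bump_poly_def algebra_simps mult_le_cancel_left1)
      then show ?thesis using u by (metis abs_le_square_iff abs_of_pos abs_abs)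
    qed
    ultimately have "(1 / ?u) ^ k * exp (- (1 / ?u)) \<le> fact (k + 2) * (t - s)\<^sup>2"
      by (meson fact_ge_zero mult_left_mono order_trans)
    moreover have "\<bar>bump_term P k t\<bar> = \<bar>poly P t\<bar> * ((1 / ?u) ^ k * exp (- (1 / ?u)))"
      using True u by (simp add: bump_term_def abs_mult)
    ultimately show ?thesis
      using B[of t] True B0 u by (auto simp: mult.assoc intro!: mult_mono)
  next
    case False
    then show ?thesis using B0 by (auto simp: bump_term_def)
  qed
  then show ?thesis by blast
qed

lemma bump_term_has_derivative:
  "\<exists>Q l. \<forall>t. (bump_term P k has_real_derivative bump_term Q l t) (at t)"
proof -
  let ?u = bump_poly and ?u' = "pderiv bump_poly"
  define Q where "Q = pderiv P * ?u\<^sup>2 - smult (real k) (P * ?u' * ?u) + P * ?u'"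
  have "(bump_term P k has_real_derivative bump_term Q (k + 2) t) (at t)" for t
  proof -
    consider "0 < t \<and> t < 1" | "t \<in> {0, 1}" | "t < 0 \<or> t > 1" by force
    then show ?thesis
    proof cases
      case 1
      let ?v = "poly ?u t"
      have v: "?v > 0" using 1 bump_poly_pos by blast
      have kk: "real k * (1 / ?v) ^ (k - 1) * X = real k * (1/?v)^k * ?v * X" for X
        using v by (cases k) (auto simp: field_simps)
      have "((\<lambda>t. poly P t * (1 / poly ?u t) ^ k * exp (- (1 / poly ?u t))) has_real_derivative
              bump_term Q (k + 2) t) (at t)"
        apply (rule derivative_eq_intros refl poly_DERIV | (use v in simp; fail))+
        using v 1
        apply (simp only: kk bump_term_def if_True simp_thms Q_def)
        apply (cases k; simp add: field_simps power_add power2_eq_square)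
        done
      then show ?thesis
        by (rule DERIV_cong_ev[OF refl _ refl, THEN iffD1, rotated])
           (use 1 eventually_nhds_in_open[of "{0<..<1}" t] in \<open>auto elim!: eventually_mono simp: bump_term_def\<close>)
    next
      case 2
      then have "bump_term Q (k + 2) t = 0" by (auto simp: bump_term_def)
      moreover obtain C where "\<And>x. \<bar>bump_term P k x\<bar> \<le> C * (x - t)\<^sup>2"
        using bump_term_flat[OF 2] by blast
      ultimately show ?thesis
        using flat_function_derivative_zero by metis
    next
      case 3
      have "((\<lambda>t. 0) has_real_derivative bump_term Q (k + 2) t) (at t)"
        using 3 by (auto simp: bump_term_def)
      then show ?thesis
        by (rule DERIV_cong_ev[OF refl _ refl, THEN iffD1, rotated])
           (use 3 eventually_nhds_in_open[of "{..<0} \<union> {1<..}" t, OF open_Un] in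
              \<open>auto elim!: eventually_mono simp: bump_term_def\<close>)
    qed
  qed
  then show ?thesis by blast
qed

lemma smooth_step_exists:
  obtains D :: "nat \<Rightarrow> real \<Rightarrow> real" and L
  where "\<And>n t. (D n has_real_derivative D (Suc n) t) (at t)"
    and "\<And>t. t \<le> 0 \<Longrightarrow> D 0 t = 0" "\<And>t. t \<ge> 1 \<Longrightarrow> D 0 t = 1"
    and "\<And>t. 0 \<le> D 0 t" "\<And>t. D 0 t \<le> 1"
    and "\<And>t. t \<le> 0 \<or> t \<ge> 1 \<Longrightarrow> D 1 t = 0" and "\<And>t. \<bar>D 1 t\<bar> \<le> L"
proof -
  define h where "h = bump_term 1 0"
  have iter: "\<exists>P k. (deriv ^^ n) h = bump_term P k" for n
  proof (induction n)
    case (Suc n)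
    then obtain P k where "(deriv ^^ n) h = bump_term P k" by blast
    moreover obtain Q l where "\<And>t. (bump_term P k has_real_derivative bump_term Q l t) (at t)"
      using bump_term_has_derivative by blast
    ultimately have "(deriv ^^ Suc n) h = bump_term Q l"
      by (metis DERIV_imp_deriv ext funpow.simps(2) o_apply)
    then show ?case by blast
  qed (auto simp: h_def)
  have dh: "((deriv ^^ n) h has_real_derivative (deriv ^^ Suc n) h t) (at t)" for n t
  proof -
    obtain P k where P: "(deriv ^^ n) h = bump_term P k" using iter by blast
    obtain Q l where "(bump_term P k has_real_derivative bump_term Q l t) (at t)"
      using bump_term_has_derivative by blast
    then show ?thesis
      by (metis P DERIV_imp_deriv funpow.simps(2) o_apply)
  qed
  have hc: "continuous_on UNIV h"
    using dh[of 0] by (auto intro!: continuous_at_imp_continuous_on DERIV_isCont)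
  have h0: "h t = 0" if "t \<le> 0 \<or> t \<ge> 1" for t using that by (auto simp: h_def bump_term_def)
  have hpos: "h t > 0" if "0 < t" "t < 1" for t using that by (auto simp: h_def bump_term_def)
  have hnn: "h t \<ge> 0" for t using h0 hpos by (metis linorder_not_le order.refl order_less_imp_le)
  obtain F where F: "\<And>t. (F has_real_derivative h t) (at t)"
  proof -
    have "\<exists>F. \<forall>t. -1 < t \<longrightarrow> t < 2 \<longrightarrow> (F has_real_derivative h t) (at t)"
    proof -
      obtain g where g: "\<And>x. x \<in> {-1..2} \<Longrightarrow> (g has_vector_derivative h x) (at x within {-1..2})"
        using antiderivative_continuous[of "-1" 2 h] continuous_on_subset[OF hc] by blast
      have "(g has_real_derivative h t) (at t)" if "-1 < t" "t < 2" for t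
        using g[of t] that at_within_interior[of t "{-1..2}"]
        by (simp add: has_real_derivative_iff_has_vector_derivative)
      then show ?thesis by blast
    qed
    then obtain g where g: "\<And>t. -1 < t \<Longrightarrow> t < 2 \<Longrightarrow> (g has_real_derivative h t) (at t)" by blast
    have g_const: "g t = g s" if "(-1 < t \<and> t \<le> s \<and> s \<le> 0) \<or> (1 \<le> t \<and> t \<le> s \<and> s < 2)" for s t
    proof (cases "t = s")
      case False
      show ?thesis
      proof (rule DERIV_isconst_end[of t s g, symmetric])
        show "t < s" using that False by auto
        show "continuous_on {t..s} g"
          using g[THEN DERIV_isCont] that by (auto intro!: continuous_at_imp_continuous_on)
        show "(g has_real_derivative 0) (at x)" if x: "t < x" "x < s" for x
          using g[of x] h0[of x] x \<open>_ \<or> _\<close> by auto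
      qed
    qed simp
    define F where "F t = (if t \<le> 0 then g 0 else if t \<ge> 1 then g 1 else g t)" for t
    have Fg: "F t = g t" if "-1 < t" "t < 2" for t
      using that g_const[of t 0] g_const[of 1 t] by (auto simp: F_def)
    have "(F has_real_derivative h t) (at t)" for t
    proof -
      consider "-1 < t \<and> t < 2" | "t < 0" | "t > 1" by linarith
      then show ?thesis
      proof cases
        case 1
        then show ?thesis
          using g[of t] eventually_nhds_in_open[of "{-1<..<2}" t]
          by (subst DERIV_cong_ev[OF refl _ refl, of F g]) (auto elim!: eventually_mono simp: Fg)
      next
        case 2
        then have "\<forall>\<^sub>F x in nhds t. F x = g 0"
          using eventually_nhds_in_open[of "{..<0}" t] by (auto elim!: eventually_mono simp: F_def)
        then show ?thesis
          using 2 h0[of t] by (subst DERIV_cong_ev[OF refl _ refl, of F "\<lambda>_. g 0"]) auto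
      next
        case 3
        then have "\<forall>\<^sub>F x in nhds t. F x = g 1"
          using eventually_nhds_in_open[of "{1<..}" t] by (auto elim!: eventually_mono simp: F_def)
        then show ?thesis
          using 3 h0[of t] by (subst DERIV_cong_ev[OF refl _ refl, of F "\<lambda>_. g 1"]) auto
      qed
    qed
    then show ?thesis using that by blast
  qed
  have mono: "F s \<le> F t" if "s \<le> t" for s t
    using DERIV_nonneg_imp_nondecreasing[OF that] F hnn by blast
  have lt: "F 0 < F 1"
    using DERIV_pos_imp_increasing_open[of 0 1 F] F hpos
    by (metis DERIV_isCont continuous_at_imp_continuous_on zero_less_one)
  have const: "F s = F t" if "s \<le> t" "t \<le> 0 \<or> s \<ge> 1" for s t
  proof (cases "s = t")
    case False
    then show ?thesis
      using that F h0 DERIV_isconst_end[of s t F]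
      by (smt (verit) DERIV_isCont continuous_at_imp_continuous_on)
  qed simp
  define c where "c = F 1 - F 0"
  have c: "c > 0" using lt c_def by simp
  define D where "D n t = (if n = 0 then (F t - F 0) / c else (deriv ^^ (n - 1)) h t / c)" for n t
  obtain L where L: "\<And>t. t \<in> {0..1} \<Longrightarrow> \<bar>h t\<bar> \<le> L"
    using continuous_on_compact_bound[of "{0..1::real}" h, OF compact_Icc continuous_on_subset[OF hc]]
    by (metis real_norm_def subset_UNIV)
  have L': "\<bar>h t\<bar> \<le> L" for t
  proof (cases "t \<in> {0..1}")
    case False
    then have "\<bar>h t\<bar> = 0" using h0[of t] by fastforce
    also have "0 \<le> L" using L[of 0] by simp
    finally show ?thesis .
  qed (use L in blast)
  show ?thesis
  proof (rule that[of D "L / c"])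
    show "(D n has_real_derivative D (Suc n) t) (at t)" for n t
    proof (cases n)
      case 0
      then show ?thesis using F[of t] c
        by (auto simp: D_def[abs_def] intro!: derivative_eq_intros)
    next
      case (Suc l)
      then show ?thesis using dh[of l t] c
        by (auto simp: D_def[abs_def] intro!: derivative_eq_intros)
    qed
    show "D 0 t = 0" if "t \<le> 0" for t using const[of t 0] that by (simp add: D_def)
    show "D 0 t = 1" if "t \<ge> 1" for t using const[of 1 t] that c by (simp add: D_def c_def)
    show "0 \<le> D 0 t" for t
      using mono[of 0 t] mono[of t 0] const[of t 0] c by (cases "t \<le> 0") (auto simp: D_def)
    show "D 0 t \<le> 1" for t
      using mono[of t 1] const[of 1 t] c by (cases "t \<le> 1") (auto simp: D_def c_def)
    show "D 1 t = 0" if "t \<le> 0 \<or> t \<ge> 1" for t using h0[OF that] by (simp add: D_def)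
    show "\<bar>D 1 t\<bar> \<le> L / c" for t using L'[of t] c by (simp add: D_def divide_right_mono)
  qed
qed

section \<open>Scaling of Lebesgue integrals\<close>

lemma
  fixes a :: "'a::euclidean_space" and r :: real
  assumes "r \<noteq> 0"
  shows lebesgue_affine_scalar:
      "lebesgue = density (distr lebesgue lebesgue (\<lambda>x. a + r *\<^sub>R x)) (\<lambda>_. ennreal (\<bar>r\<bar> ^ DIM('a)))"
    and lebesgue_measurable_affine_scalar: "(\<lambda>x. a + r *\<^sub>R x) \<in> lebesgue \<rightarrow>\<^sub>M lebesgue"
proof -
  have *: "(\<Sum>j\<in>Basis. (r * (x \<bullet> j)) *\<^sub>R j) = r *\<^sub>R x" for x :: 'a
    unfolding scaleR_scaleR[symmetric] scaleR_sum_right[symmetric] euclidean_representation ..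
  show "lebesgue = density (distr lebesgue lebesgue (\<lambda>x. a + r *\<^sub>R x)) (\<lambda>_. ennreal (\<bar>r\<bar> ^ DIM('a)))"
    by (rule lebesgue_affine_euclidean[of "\<lambda>_. r" a, OF assms, unfolded * prod_constant])
  show "(\<lambda>x. a + r *\<^sub>R x) \<in> lebesgue \<rightarrow>\<^sub>M lebesgue"
    using lebesgue_affine_measurable[of "\<lambda>_. r" a] assms by (simp add: *)
qed

lemma nn_integral_lebesgue_affine:
  fixes a :: "'a::euclidean_space"
  assumes [measurable]: "f \<in> borel_measurable lebesgue" and r: "r > 0"
  shows "(\<integral>\<^sup>+x. f x \<partial>lebesgue) = ennreal (r ^ DIM('a)) * (\<integral>\<^sup>+x. f (a + r *\<^sub>R x) \<partial>lebesgue)"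
proof -
  have [measurable]: "(\<lambda>x. a + r *\<^sub>R x) \<in> lebesgue \<rightarrow>\<^sub>M lebesgue"
    by (rule lebesgue_measurable_affine_scalar) (use r in simp)
  have "(\<integral>\<^sup>+x. f x \<partial>lebesgue) =
        (\<integral>\<^sup>+x. f x \<partial>density (distr lebesgue lebesgue (\<lambda>x. a + r *\<^sub>R x)) (\<lambda>_. ennreal (\<bar>r\<bar> ^ DIM('a))))"
    by (rule arg_cong[OF lebesgue_affine_scalar, where f="\<lambda>M. \<integral>\<^sup>+x. f x \<partial>M"]) (use r in simp)
  then show ?thesis
    using r by (simp add: nn_integral_density nn_integral_distr nn_integral_cmult)
qed

lemma integrable_lebesgue_affine:
  fixes f :: "'a::euclidean_space \<Rightarrow> 'b::euclidean_space"
  assumes f: "integrable lebesgue f" and r: "r > 0"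
  shows "integrable lebesgue (\<lambda>x. f (a + r *\<^sub>R x))"
proof (rule integrableI_bounded)
  have [measurable]: "(\<lambda>x. a + r *\<^sub>R x) \<in> lebesgue \<rightarrow>\<^sub>M lebesgue"
    by (rule lebesgue_measurable_affine_scalar) (use r in simp)
  have [measurable]: "f \<in> borel_measurable lebesgue" using f by auto
  show "(\<lambda>x. f (a + r *\<^sub>R x)) \<in> borel_measurable lebesgue" by measurable
  have "ennreal (r ^ DIM('a)) * (\<integral>\<^sup>+x. norm (f (a + r *\<^sub>R x)) \<partial>lebesgue) < \<infinity>"
    using nn_integral_lebesgue_affine[of "\<lambda>x. ennreal (norm (f x))" r a] f r
    by (simp add: integrable_iff_bounded)
  moreover have "ennreal (r ^ DIM('a)) \<noteq> 0" using r by (simp add: not_le)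
  ultimately show "(\<integral>\<^sup>+x. norm (f (a + r *\<^sub>R x)) \<partial>lebesgue) < \<infinity>"
    by (auto simp: ennreal_mult_less_top)
qed

lemma integral_lebesgue_affine:
  fixes f :: "'a::euclidean_space \<Rightarrow> real"
  assumes [measurable]: "f \<in> borel_measurable lebesgue" and r: "r > 0"
  shows "integral\<^sup>L lebesgue f = r ^ DIM('a) * (LINT x|lebesgue. f (a + r *\<^sub>R x))"
proof -
  have [measurable]: "(\<lambda>x. a + r *\<^sub>R x) \<in> lebesgue \<rightarrow>\<^sub>M lebesgue"
    by (rule lebesgue_measurable_affine_scalar) (use r in simp)
  have "integral\<^sup>L lebesgue f =
        integral\<^sup>L (density (distr lebesgue lebesgue (\<lambda>x. a + r *\<^sub>R x)) (\<lambda>_. ennreal (\<bar>r\<bar> ^ DIM('a)))) f"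
    by (rule arg_cong[OF lebesgue_affine_scalar, where f="\<lambda>M. integral\<^sup>L M f"]) (use r in simp)
  also have "\<dots> = r ^ DIM('a) * (LINT x|lebesgue. f (a + r *\<^sub>R x))"
    using r by (subst integral_density) (simp_all add: integral_distr)
  finally show ?thesis .
qed

section \<open>Test functions\<close>

lemma test_function_smooth: "test_function S \<phi> \<Longrightarrow> smooth_fun \<phi>"
  by (simp add: test_function_def smooth_fun_def)

lemma test_function_mono: "test_function S \<phi> \<Longrightarrow> S \<subseteq> T \<Longrightarrow> test_function T \<phi>"
  by (auto simp: test_function_def)

lemma test_function_zero: "test_function S \<phi> \<Longrightarrow> x \<notin> S \<Longrightarrow> \<phi> x = 0"
  using closure_subset[of "{x. \<phi> x \<noteq> 0}"] by (auto simp: test_function_def)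

lemma smooth_fun_mult: "smooth_fun f \<Longrightarrow> smooth_fun g \<Longrightarrow> smooth_fun (\<lambda>x. f x * g x)"
  by (simp add: smooth_fun_def C_class_mult)

lemma test_function_subsupport:
  assumes "test_function S \<phi>" "smooth_fun \<psi>" "{x. \<psi> x \<noteq> 0} \<subseteq> closure {x. \<phi> x \<noteq> 0}"
  shows "test_function S \<psi>"
proof -
  have "closure {x. \<psi> x \<noteq> 0} \<subseteq> closure {x. \<phi> x \<noteq> 0}"
    using assms(3) by (simp add: closure_minimal)
  moreover have "bounded (closure {x. \<phi> x \<noteq> 0})"
    using assms(1) compact_imp_bounded by (auto simp: test_function_def)
  ultimately show ?thesis
    using assms bounded_subset[of "closure {x. \<phi> x \<noteq> 0}" "{x. \<psi> x \<noteq> 0}"]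
    by (auto simp: test_function_def smooth_fun_def)
qed

lemma test_function_mult:
  assumes "smooth_fun f" "test_function S \<phi>"
  shows "test_function S (\<lambda>x. f x * \<phi> x)" "test_function S (\<lambda>x. \<phi> x * f x)"
proof -
  show "test_function S (\<lambda>x. f x * \<phi> x)"
    using closure_subset[of "{x. \<phi> x \<noteq> 0}"]
    by (intro test_function_subsupport[OF assms(2)] smooth_fun_mult assms(1) test_function_smooth[OF assms(2)]) auto
  then show "test_function S (\<lambda>x. \<phi> x * f x)" by (simp add: mult.commute)
qed

lemma partial_deriv_zero_off_support:
  assumes "x \<notin> closure {x. \<phi> x \<noteq> 0}"
  shows "partial_deriv j \<phi> x = 0"
proof -
  have "(\<phi> has_derivative (\<lambda>_. 0)) (at x)"
  proof (rule has_derivative_transform_within_open)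
    show "((\<lambda>_. 0) has_derivative (\<lambda>_. 0)) (at x)" by simp
    show "open (- closure {x. \<phi> x \<noteq> 0})" by auto
    show "\<And>y. y \<in> - closure {x. \<phi> x \<noteq> 0} \<Longrightarrow> 0 = \<phi> y"
      using closure_subset[of "{x. \<phi> x \<noteq> 0}"] by auto
  qed (use assms in auto)
  then show ?thesis using partial_deriv_eq by fastforce
qed

lemma test_function_partial_deriv:
  assumes "test_function S \<phi>"
  shows "test_function S (partial_deriv j \<phi>)"
  using partial_deriv_zero_off_support
  by (intro test_function_subsupport[OF assms] smooth_fun_partial_deriv test_function_smooth[OF assms]) fastforce

lemma test_function_partial_zero: "test_function S \<phi> \<Longrightarrow> x \<notin> S \<Longrightarrow> partial_deriv j \<phi> x = 0"
  using test_function_zero[OF test_function_partial_deriv] .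

lemma smooth_fun_measurable: "smooth_fun \<phi> \<Longrightarrow> \<phi> \<in> borel_measurable borel"
  by (simp add: borel_measurable_continuous_onI smooth_fun_continuous)

lemma test_function_measurable: "test_function S \<phi> \<Longrightarrow> \<phi> \<in> borel_measurable lebesgue"
  using smooth_fun_measurable[OF test_function_smooth] by (auto intro!: measurable_completion)

lemma test_function_bounded:
  assumes "test_function S \<phi>"
  obtains B where "B > 0" "\<And>x. \<bar>\<phi> x\<bar> \<le> B"
proof -
  have "compact (closure {x. \<phi> x \<noteq> 0})" using assms by (simp add: test_function_def)
  then obtain B where B: "0 \<le> B" "\<And>x. x \<in> closure {x. \<phi> x \<noteq> 0} \<Longrightarrow> norm (\<phi> x) \<le> B"
    using continuous_on_compact_bound smooth_fun_continuous test_function_smooth[OF assms] by blast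
  have "\<bar>\<phi> x\<bar> \<le> B + 1" for x
    using B closure_subset[of "{x. \<phi> x \<noteq> 0}"] by (cases "\<phi> x = 0") force+
  then show ?thesis using that[of "B + 1"] B by auto
qed

lemma test_function_support_bounded:
  assumes "test_function S \<phi>"
  obtains R where "R > 0" "\<And>x. x \<notin> cball 0 R \<Longrightarrow> \<phi> x = 0"
proof -
  have "bounded (closure {x. \<phi> x \<noteq> 0})" using assms compact_imp_bounded by (auto simp: test_function_def)
  then obtain R where R: "\<And>x. x \<in> closure {x. \<phi> x \<noteq> 0} \<Longrightarrow> norm x \<le> R" "R > 0"
    by (auto simp: bounded_pos)
  show ?thesis
    by (rule that[OF R(2)]) (use R(1) closure_subset[of "{x. \<phi> x \<noteq> 0}"] in force)
qed

lemma test_function_integrable: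
  assumes "test_function S \<phi>"
  shows "integrable lebesgue \<phi>"
proof -
  obtain B where B: "\<And>x. \<bar>\<phi> x\<bar> \<le> B" using test_function_bounded[OF assms] by blast
  obtain R where R: "\<And>x. x \<notin> cball 0 R \<Longrightarrow> \<phi> x = 0" using test_function_support_bounded[OF assms] by blast
  show ?thesis
    by (rule integrableI_bounded_set[of "cball 0 R" _ _ B])
       (use B R emeasure_lborel_cball_finite[of 0 R] in \<open>auto simp: test_function_measurable[OF assms]\<close>)
qed

lemma integrable_mult_bounded:
  fixes f \<phi> :: "'a \<Rightarrow> real"
  assumes "integrable M f" "\<phi> \<in> borel_measurable M" "\<And>x. \<bar>\<phi> x\<bar> \<le> B"
  shows "integrable M (\<lambda>x. f x * \<phi> x)"
proof (rule Bochner_Integration.integrable_bound)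
  show "integrable M (\<lambda>x. B * f x)" using assms(1) by simp
  show "(\<lambda>x. f x * \<phi> x) \<in> borel_measurable M" using assms by auto
  show "AE x in M. norm (f x * \<phi> x) \<le> norm (B * f x)"
  proof (rule AE_I2)
    fix x
    have "\<bar>f x\<bar> * \<bar>\<phi> x\<bar> \<le> \<bar>f x\<bar> * \<bar>B\<bar>"
      using assms(3)[of x] by (intro mult_left_mono) auto
    then show "norm (f x * \<phi> x) \<le> norm (B * f x)" by (simp add: abs_mult mult.commute)
  qed
qed

lemma integrable_mult_test_function:
  "integrable lebesgue f \<Longrightarrow> test_function S \<phi> \<Longrightarrow> integrable lebesgue (\<lambda>x. f x * \<phi> x)"
  by (rule test_function_bounded, assumption) (rule integrable_mult_bounded[OF _ test_function_measurable])

lemma partial_deriv_line: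
  assumes "smooth_fun \<psi>"
  shows "((\<lambda>t. \<psi> (x + t *\<^sub>R axis j 1)) has_real_derivative partial_deriv j \<psi> (x + t *\<^sub>R axis j 1)) (at t)"
proof -
  let ?D = "frechet_derivative \<psi> (at (x + t *\<^sub>R axis j 1))"
  note D = smooth_fun_has_derivative[OF assms]
  have "((\<lambda>t. x + t *\<^sub>R axis j 1) has_derivative (\<lambda>s. s *\<^sub>R axis j 1)) (at t)"
    by (auto intro!: derivative_eq_intros)
  from has_derivative_compose[OF this D]
  have "((\<lambda>t. \<psi> (x + t *\<^sub>R axis j 1)) has_derivative (\<lambda>s. ?D (s *\<^sub>R axis j 1))) (at t)" .
  moreover have "?D (s *\<^sub>R axis j 1) = partial_deriv j \<psi> (x + t *\<^sub>R axis j 1) * s" for s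
    using linear_scale[OF has_derivative_linear[OF D]] by (simp add: partial_deriv_def mult.commute)
  ultimately show ?thesis by (simp add: has_field_derivative_def)
qed

text \<open>
  Translation invariance makes the integrals of the difference quotients in direction \<open>j\<close> vanish. By the mean
  value theorem the quotients are bounded by the maximum of the derivative, and they live in a
  fixed ball, so dominated convergence applies.
\<close>

lemma integral_partial_deriv_zero:
  fixes \<psi> :: "real^'m \<Rightarrow> real"
  assumes "test_function UNIV \<psi>"
  shows "(LINT x|lebesgue. partial_deriv j \<psi> x) = 0"
proof -
  let ?e = "axis j 1 :: real^'m" and ?d = "partial_deriv j \<psi>"
  define q where "q n x = (\<psi> (x + (1 / real (Suc n)) *\<^sub>R ?e) - \<psi> x) / (1 / real (Suc n))" for n :: nat and x
  note sm = test_function_smooth[OF assms]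
  obtain B where B: "B > 0" "\<And>x. \<bar>?d x\<bar> \<le> B"
    using test_function_bounded[OF test_function_partial_deriv[OF assms]] by blast
  obtain R where R: "R > 0" "\<And>x. x \<notin> cball 0 R \<Longrightarrow> \<psi> x = 0"
    using test_function_support_bounded[OF assms] by blast
  have [measurable]: "\<psi> \<in> borel_measurable borel" by (rule smooth_fun_measurable[OF sm])
  have int: "integrable lborel \<psi>"
    using test_function_integrable[OF assms] integrable_completion[of \<psi> lborel] by simp
  have tr: "integrable lborel (\<lambda>x. \<psi> (x + c))" "(LINT x|lborel. \<psi> (x + c)) = (LINT x|lborel. \<psi> x)" for c
  proof -
    have "integrable (distr lborel borel ((+) c)) \<psi>" using int lborel_distr_plus by metis
    then show "integrable lborel (\<lambda>x. \<psi> (x + c))"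
      by (subst (asm) integrable_distr_eq) (auto simp: add.commute)
    have "(LINT x|lborel. \<psi> x) = integral\<^sup>L (distr lborel borel ((+) c)) \<psi>" by (simp add: lborel_distr_plus)
    then show "(LINT x|lborel. \<psi> (x + c)) = (LINT x|lborel. \<psi> x)"
      by (subst (asm) integral_distr) (auto simp: add.commute)
  qed
  have q0: "(LINT x|lborel. q n x) = 0" for n
    unfolding q_def by (simp add: tr int)
  have "(\<lambda>n. LINT x|lborel. q n x) \<longlonglongrightarrow> (LINT x|lborel. ?d x)"
  proof (rule integral_dominated_convergence[where w="\<lambda>x. B * indicator (cball 0 (R + 1)) x"])
    show "?d \<in> borel_measurable lborel"
      using smooth_fun_measurable[OF smooth_fun_partial_deriv[OF sm]] by simp
    show "q n \<in> borel_measurable lborel" for n unfolding q_def by measurable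
    show "integrable lborel (\<lambda>x::real^'m. B * indicator (cball 0 (R + 1)) x)"
      using emeasure_lborel_cball_finite[of "0::real^'m" "R + 1"] by simp
    show "AE x in lborel. (\<lambda>n. q n x) \<longlonglongrightarrow> ?d x"
    proof (rule AE_I2)
      fix x
      have "((\<lambda>h. (\<psi> (x + h *\<^sub>R ?e) - \<psi> x) / h) \<longlongrightarrow> ?d x) (at 0)"
        using partial_deriv_line[OF sm, of x j 0] by (simp add: DERIV_def)
      moreover have "filterlim (\<lambda>n. 1 / real (Suc n)) (at 0) sequentially"
        using LIMSEQ_inverse_real_of_nat by (auto simp: filterlim_at inverse_eq_divide simp del: of_nat_Suc)
      ultimately show "(\<lambda>n. q n x) \<longlonglongrightarrow> ?d x"
        unfolding q_def by (rule filterlim_compose)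
    qed
    show "AE x in lborel. norm (q n x) \<le> B * indicator (cball 0 (R + 1)) x" for n
    proof (rule AE_I2)
      fix x
      define h where "h = 1 / real (Suc n)"
      have h: "0 < h" "h \<le> 1" by (auto simp: h_def)
      have q_h: "q n x = (\<psi> (x + h *\<^sub>R ?e) - \<psi> x) / h" unfolding q_def h_def ..
      show "norm (q n x) \<le> B * indicator (cball 0 (R + 1)) x"
      proof (cases "x \<in> cball 0 (R + 1)")
        case True
        have "\<exists>t. 0 < t \<and> t < h \<and>
            \<psi> (x + h *\<^sub>R ?e) - \<psi> (x + 0 *\<^sub>R ?e) = (h - 0) * ?d (x + t *\<^sub>R ?e)"
          by (rule MVT2[OF h(1), where f="\<lambda>t. \<psi> (x + t *\<^sub>R ?e)"]) (rule partial_deriv_line[OF sm])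
        then obtain t where "\<psi> (x + h *\<^sub>R ?e) - \<psi> (x + 0 *\<^sub>R ?e) = (h - 0) * ?d (x + t *\<^sub>R ?e)"
          by blast
        then have "q n x = ?d (x + t *\<^sub>R ?e)" using h by (simp add: q_h)
        then show ?thesis using True B(2) by simp
      next
        case False
        have "norm (h *\<^sub>R ?e) \<le> 1" using h by (simp add: norm_axis_1)
        then have "x + h *\<^sub>R ?e \<notin> cball 0 R"
          using False norm_triangle_ineq4[of "x + h *\<^sub>R ?e" "h *\<^sub>R ?e"] by auto
        moreover have "x \<notin> cball 0 R" using False by auto
        ultimately have "\<psi> (x + h *\<^sub>R ?e) = 0" "\<psi> x = 0" using R(2) by blast+
        then show ?thesis using B(1) by (simp add: q_h)
      qed
    qed
  qed
  then have "(LINT x|lborel. ?d x) = 0"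
    using q0 LIMSEQ_const_iff[of 0] by auto
  then show ?thesis
    using integral_completion[of ?d lborel] smooth_fun_measurable[OF smooth_fun_partial_deriv[OF sm]] by simp
qed

lemma affine_map_component:
  "affine_map X b x $ i = (\<Sum>k\<in>UNIV. X $ i $ k * x $ k) + b $ i"
  by (simp add: affine_map_def matrix_vector_mult_def)

lemma affine_map_smooth: "smooth_fun (\<lambda>x. affine_map X b x $ i)"
  unfolding affine_map_component smooth_fun_def
  by (auto intro!: C_class_add C_class_sum C_class_mult C_class_const C_class_component)

lemma affine_map_partial_deriv: "partial_deriv j (\<lambda>x. affine_map X b x $ i) x = X $ i $ j"
proof -
  have "((\<lambda>x. (\<Sum>k\<in>UNIV. X $ i $ k * x $ k) + b $ i) has_derivative (\<lambda>h. \<Sum>k\<in>UNIV. X $ i $ k * h $ k)) (at x)"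
    by (auto intro!: derivative_eq_intros bounded_linear_imp_has_derivative bounded_linear_vec_nth)
  then have "partial_deriv j (\<lambda>x. affine_map X b x $ i) x = (\<Sum>k\<in>UNIV. X $ i $ k * axis j 1 $ k)"
    unfolding affine_map_component by (rule partial_deriv_eq)
  also have "\<dots> = (\<Sum>k\<in>UNIV. if k = j then X $ i $ k else 0)"
    by (rule sum.cong) (auto simp: axis_def)
  also have "\<dots> = X $ i $ j" by simp
  finally show ?thesis .
qed

lemma affine_map_integration_by_parts:
  assumes "test_function UNIV \<phi>"
  shows "integrable lebesgue (\<lambda>x. affine_map X b x $ i * partial_deriv j \<phi> x)"
    and "(LINT x|lebesgue. affine_map X b x $ i * partial_deriv j \<phi> x) = - (LINT x|lebesgue. X $ i $ j * \<phi> x)"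
proof -
  let ?l = "\<lambda>x. affine_map X b x $ i"
  have t: "test_function UNIV (\<lambda>x. ?l x * \<phi> x)"
    using test_function_mult(1)[OF affine_map_smooth assms] .
  have eq: "partial_deriv j (\<lambda>x. ?l x * \<phi> x) x = ?l x * partial_deriv j \<phi> x + X $ i $ j * \<phi> x" for x
    using partial_deriv_mult[OF affine_map_smooth test_function_smooth[OF assms]]
    by (simp add: affine_map_partial_deriv)
  show i1: "integrable lebesgue (\<lambda>x. ?l x * partial_deriv j \<phi> x)"
    using test_function_integrable[OF test_function_mult(1)[OF affine_map_smooth test_function_partial_deriv[OF assms]]] .
  have i2: "integrable lebesgue (\<lambda>x. X $ i $ j * \<phi> x)"
    using test_function_integrable[OF assms] by simp
  show "(LINT x|lebesgue. ?l x * partial_deriv j \<phi> x) = - (LINT x|lebesgue. X $ i $ j * \<phi> x)"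
    using integral_partial_deriv_zero[OF t, of j] unfolding eq by (simp add: Bochner_Integration.integral_add[OF i1 i2])
qed

section \<open>Cutoff functions of balls\<close>

text \<open>
  The cutoffs are \<open>\<eta>\<^sub>n(x) = D(n (\<rho>\<^sup>2 - |x - a|\<^sup>2) - 1)\<close> with a smooth step \<open>D\<close>. The gradient of \<open>\<eta>\<^sub>n\<close> is of
  size \<open>n\<close>, but it lives only where \<open>n (\<rho>\<^sup>2 - |x - a|\<^sup>2) < 2\<close>, a shell of width of order \<open>1/n\<close>.
\<close>

lemma ball_cutoff_exists:
  fixes a :: "real^'m"
  assumes "\<rho> > 0"
  obtains \<eta> :: "nat \<Rightarrow> real^'m \<Rightarrow> real" and C where
    "\<forall>n. test_function (ball a \<rho>) (\<eta> n)"
    "\<forall>n x. 0 \<le> \<eta> n x \<and> \<eta> n x \<le> 1"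
    "\<forall>x\<in>ball a \<rho>. (\<lambda>n. \<eta> n x) \<longlonglongrightarrow> 1"
    "\<forall>n j. \<forall>x\<in>ball a \<rho>. \<bar>partial_deriv j (\<eta> n) x\<bar> \<le> C * real n"
    "\<forall>n j x. real n * (\<rho>\<^sup>2 - (norm (x - a))\<^sup>2) \<ge> 2 \<longrightarrow> partial_deriv j (\<eta> n) x = 0"
proof -
  obtain D :: "nat \<Rightarrow> real \<Rightarrow> real" and L where
    D: "\<And>n t. (D n has_real_derivative D (Suc n) t) (at t)"
    and D0: "\<And>t. t \<le> 0 \<Longrightarrow> D 0 t = 0" "\<And>t. t \<ge> 1 \<Longrightarrow> D 0 t = 1"
    and D01: "\<And>t. 0 \<le> D 0 t" "\<And>t. D 0 t \<le> 1"
    and D1: "\<And>t. t \<le> 0 \<or> t \<ge> 1 \<Longrightarrow> D 1 t = 0" and L: "\<And>t. \<bar>D 1 t\<bar> \<le> L"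
    using smooth_step_exists by metis
  define Q where "Q n x = real n * (\<rho>\<^sup>2 - (norm (x - a))\<^sup>2) - 1" for n and x :: "real^'m"
  define \<eta> where "\<eta> n x = D 0 (Q n x)" for n x
  have Q_sum: "Q n x = real n * (\<rho>\<^sup>2 + (-1) * (\<Sum>i\<in>UNIV. (x $ i + - a $ i) * (x $ i + - a $ i))) + -1" for n x
    by (simp add: Q_def power2_norm_eq_inner inner_vec_def)
  have "C_class k (Q n)" for k n
    unfolding Q_sum[abs_def]
    by (intro C_class_add C_class_mult C_class_sum C_class_const C_class_component)
  then have sm: "smooth_fun (\<eta> n)" for n
    unfolding \<eta>_def[abs_def] smooth_fun_def using C_class_comp_real[of D, OF D] by blast
  have dQ: "(Q n has_derivative (\<lambda>h. - 2 * real n * ((x - a) \<bullet> h))) (at x)" for n x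
    unfolding Q_def[abs_def] power2_norm_eq_inner
    by (auto intro!: derivative_eq_intros simp: inner_commute algebra_simps)
  have deta: "partial_deriv j (\<eta> n) x = D 1 (Q n x) * (- 2 * real n * ((x - a) $ j))" for j n x
  proof -
    have "(\<eta> n has_derivative (\<lambda>h. D 1 (Q n x) * (- 2 * real n * ((x - a) \<bullet> h)))) (at x)"
      unfolding \<eta>_def[abs_def]
      using has_derivative_compose[OF dQ D[of 0, unfolded has_field_derivative_def]] by simp
    then show ?thesis using partial_deriv_eq by (fastforce simp: inner_axis)
  qed
  show ?thesis
  proof (rule that[of \<eta> "\<bar>L\<bar> * (2 * \<rho>)"]; intro allI ballI conjI impI)
    show "test_function (ball a \<rho>) (\<eta> n)" for n
    proof -
      have cont: "continuous_on UNIV (Q n)" unfolding Q_def[abs_def] by (intro continuous_intros)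
      have "0 \<le> Q n x" if "\<eta> n x \<noteq> 0" for x
        using D0(1)[of "Q n x"] that by (force simp: \<eta>_def)
      then have "{x. \<eta> n x \<noteq> 0} \<subseteq> {x. 0 \<le> Q n x}" by blast
      moreover have "closed {x. 0 \<le> Q n x}"
        using cont by (intro closed_Collect_le continuous_intros) auto
      ultimately have cl: "closure {x. \<eta> n x \<noteq> 0} \<subseteq> {x. 0 \<le> Q n x}"
        by (rule closure_minimal)
      have sub: "{x. 0 \<le> Q n x} \<subseteq> ball a \<rho>"
      proof
        fix x assume "x \<in> {x. 0 \<le> Q n x}"
        then have "real n * (\<rho>\<^sup>2 - (norm (x - a))\<^sup>2) > 0" by (simp add: Q_def)
        then have "(norm (x - a))\<^sup>2 < \<rho>\<^sup>2" by (simp add: zero_less_mult_iff)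
        then show "x \<in> ball a \<rho>"
          using assms by (simp add: dist_norm norm_minus_commute power_less_imp_less_base)
      qed
      have "compact (closure {x. \<eta> n x \<noteq> 0})"
        using bounded_subset[OF bounded_ball order_trans[OF closure_subset order_trans[OF cl sub]]] by simp
      then show ?thesis
        using sm cl sub by (auto simp: test_function_def smooth_fun_def)
    qed
    show "0 \<le> \<eta> n x" "\<eta> n x \<le> 1" for n x using D01 by (auto simp: \<eta>_def)
    show "(\<lambda>n. \<eta> n x) \<longlonglongrightarrow> 1" if "x \<in> ball a \<rho>" for x
    proof -
      have "(norm (x - a))\<^sup>2 < \<rho>\<^sup>2"
        using that by (intro power_strict_mono) (auto simp: dist_norm norm_minus_commute)
      then obtain N :: nat where N: "2 \<le> real N * (\<rho>\<^sup>2 - (norm (x - a))\<^sup>2)"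
        using ex_less_of_nat_mult[of "\<rho>\<^sup>2 - (norm (x - a))\<^sup>2" 2] by (auto intro: less_imp_le)
      have "\<eta> n x = 1" if "n \<ge> N" for n
      proof -
        have "real N * (\<rho>\<^sup>2 - (norm (x - a))\<^sup>2) \<le> real n * (\<rho>\<^sup>2 - (norm (x - a))\<^sup>2)"
          using that \<open>(norm (x - a))\<^sup>2 < \<rho>\<^sup>2\<close> by (intro mult_right_mono) auto
        then show ?thesis using N D0(2) by (simp add: \<eta>_def Q_def)
      qed
      then show ?thesis by (intro tendsto_eventually eventually_sequentiallyI)
    qed
    show "\<bar>partial_deriv j (\<eta> n) x\<bar> \<le> \<bar>L\<bar> * (2 * \<rho>) * real n" if "x \<in> ball a \<rho>" for n j x
    proof -
      have "\<bar>(x - a) $ j\<bar> \<le> \<rho>"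
        using that component_le_norm_cart[of "x - a" j] by (auto simp: dist_norm norm_minus_commute)
      moreover have "\<bar>D 1 (Q n x)\<bar> \<le> \<bar>L\<bar>" using L[of "Q n x"] by linarith
      ultimately have "\<bar>D 1 (Q n x)\<bar> * \<bar>(x - a) $ j\<bar> \<le> \<bar>L\<bar> * \<rho>" by (intro mult_mono) auto
      then have "\<bar>D 1 (Q n x)\<bar> * \<bar>(x - a) $ j\<bar> * (2 * real n) \<le> \<bar>L\<bar> * \<rho> * (2 * real n)"
        by (rule mult_right_mono) simp
      moreover have eq: "\<bar>s * (- 2 * real n * y)\<bar> = \<bar>s\<bar> * \<bar>y\<bar> * (2 * real n)" for s y :: real
        by (simp add: abs_mult)
      ultimately show ?thesis unfolding deta eq by (simp only: mult_ac)
    qed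
    show "partial_deriv j (\<eta> n) x = 0" if "real n * (\<rho>\<^sup>2 - (norm (x - a))\<^sup>2) \<ge> 2" for n j x
      using that D1[of "Q n x"] by (simp add: deta Q_def)
  qed
qed

section \<open>Filling an open set with balls\<close>

text \<open>
  The balls are indexed by \<^typ>\<open>nat\<close> so that countable sums become series; when there are only
  finitely many balls, the remaining indices get radius \<open>0\<close> and hence the empty ball.
\<close>

lemma Vitali_ball_filling:
  fixes V :: "('a::euclidean_space) set"
  assumes small: "\<And>x. x \<in> V \<Longrightarrow> \<exists>d>0. \<forall>r. 0 < r \<longrightarrow> r < d \<longrightarrow> P x r"
    and sub: "\<And>x r. P x r \<Longrightarrow> ball x r \<subseteq> V"
  obtains a :: "nat \<Rightarrow> 'a" and r :: "nat \<Rightarrow> real" where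
    "disjoint_family (\<lambda>k. ball (a k) (r k))"
    "\<And>k. r k \<ge> 0" "\<And>k. r k > 0 \<Longrightarrow> a k \<in> V \<and> P (a k) (r k)"
    "(\<Union>k. ball (a k) (r k)) \<subseteq> V" "V - (\<Union>k. ball (a k) (r k)) \<in> null_sets lebesgue"
proof -
  let ?K = "{(x, r). x \<in> V \<and> 0 < r \<and> P x r}"
  have "\<exists>i. i \<in> ?K \<and> x \<in> ball (fst i) (snd i) \<and> snd i < d" if x: "x \<in> V" and d: "0 < d" for x d
  proof -
    obtain e where e: "e > 0" "\<And>r. 0 < r \<Longrightarrow> r < e \<Longrightarrow> P x r" using small[OF x] by blast
    have "(x, min d e / 2) \<in> ?K" using e(1) d x by (auto intro!: e(2) simp: min_def)
    moreover have "x \<in> ball x (min d e / 2)" "min d e / 2 < d" using e(1) d by auto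
    ultimately show ?thesis by (intro exI[of _ "(x, min d e / 2)"]) auto
  qed
  from Vitali_covering_theorem_balls[of V ?K fst snd, OF this] obtain C where
    C: "countable C" "C \<subseteq> ?K" "pairwise (\<lambda>i j. disjnt (ball (fst i) (snd i)) (ball (fst j) (snd j))) C"
    "negligible (V - (\<Union>i\<in>C. ball (fst i) (snd i)))" by blast
  define J where "J = to_nat_on C ` C"
  define a where "a k = fst (from_nat_into C k)" for k
  define r where "r k = (if k \<in> J then snd (from_nat_into C k) else 0)" for k
  have J: "from_nat_into C k \<in> C" if "k \<in> J" for k
    using that C(1) by (auto simp: J_def)
  have inj: "k = l" if "k \<in> J" "l \<in> J" "from_nat_into C k = from_nat_into C l" for k l
    using that C(1) by (auto simp: J_def)
  have Un: "(\<Union>k. ball (a k) (r k)) = (\<Union>i\<in>C. ball (fst i) (snd i))"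
  proof
    show "(\<Union>k. ball (a k) (r k)) \<subseteq> (\<Union>i\<in>C. ball (fst i) (snd i))"
      using J by (fastforce simp: a_def r_def split: if_splits)
    show "(\<Union>i\<in>C. ball (fst i) (snd i)) \<subseteq> (\<Union>k. ball (a k) (r k))"
    proof
      fix x assume "x \<in> (\<Union>i\<in>C. ball (fst i) (snd i))"
      then obtain i where i: "i \<in> C" "x \<in> ball (fst i) (snd i)" by blast
      then have "x \<in> ball (a (to_nat_on C i)) (r (to_nat_on C i))"
        using C(1) by (auto simp: a_def r_def J_def)
      then show "x \<in> (\<Union>k. ball (a k) (r k))" by blast
    qed
  qed
  show ?thesis
  proof (rule that[of a r])
    show "disjoint_family (\<lambda>k. ball (a k) (r k))"
      unfolding disjoint_family_on_def
    proof (intro ballI impI)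
      fix k l :: nat assume kl: "k \<noteq> l"
      show "ball (a k) (r k) \<inter> ball (a l) (r l) = {}"
      proof (cases "k \<in> J \<and> l \<in> J")
        case True
        then have "disjnt (ball (a k) (r k)) (ball (a l) (r l))"
          using pairwiseD[OF C(3), of "from_nat_into C k" "from_nat_into C l"] J inj kl by (auto simp: a_def r_def)
        then show ?thesis by (simp add: disjnt_def)
      qed (auto simp: r_def)
    qed
    show "r k \<ge> 0" for k using J[of k] C(2) by (auto simp: r_def)
    show "a k \<in> V \<and> P (a k) (r k)" if "r k > 0" for k
      using that J[of k] C(2) by (auto simp: r_def a_def split: if_splits)
    show "(\<Union>k. ball (a k) (r k)) \<subseteq> V"
      using C(2) sub unfolding Un by force
    show "V - (\<Union>k. ball (a k) (r k)) \<in> null_sets lebesgue"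
      using C(4) unfolding Un by (simp add: negligible_iff_null_sets)
  qed
qed

section \<open>The weak gradient of an affine map\<close>

lemma cutoff_integral_limit:
  fixes f :: "real^'m \<Rightarrow> real"
  assumes f: "integrable lebesgue f"
    and \<eta>: "\<And>n. test_function (ball a \<rho>) (\<eta> n)" "\<And>n x. 0 \<le> \<eta> n x \<and> \<eta> n x \<le> 1"
    and lim: "\<And>x. x \<in> ball a \<rho> \<Longrightarrow> (\<lambda>n. \<eta> n x) \<longlonglongrightarrow> 1"
  shows "(\<lambda>n. LINT x|lebesgue. f x * \<eta> n x) \<longlonglongrightarrow> (LINT x:ball a \<rho>|lebesgue. f x)"
  unfolding set_lebesgue_integral_def
proof (rule integral_dominated_convergence[where w="\<lambda>x. norm (f x)"])
  have [measurable]: "f \<in> borel_measurable lebesgue" using f by auto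
  have [measurable]: "\<eta> n \<in> borel_measurable lebesgue" for n by (rule test_function_measurable[OF \<eta>(1)])
  show "(\<lambda>x. f x * \<eta> n x) \<in> borel_measurable lebesgue" for n by measurable
  show "(\<lambda>x. indicator (ball a \<rho>) x *\<^sub>R f x) \<in> borel_measurable lebesgue"
    by (intro borel_measurable_scaleR borel_measurable_indicator) auto
  show "AE x in lebesgue. (\<lambda>n. f x * \<eta> n x) \<longlonglongrightarrow> indicator (ball a \<rho>) x *\<^sub>R f x"
  proof (rule AE_I2)
    fix x
    show "(\<lambda>n. f x * \<eta> n x) \<longlonglongrightarrow> indicator (ball a \<rho>) x *\<^sub>R f x"
    proof (cases "x \<in> ball a \<rho>")
      case True
      then show ?thesis using tendsto_mult[OF tendsto_const[of "f x"] lim[OF True]] by simp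
    next
      case False
      then show ?thesis using test_function_zero[OF \<eta>(1) False] by simp
    qed
  qed
  show "AE x in lebesgue. norm (f x * \<eta> n x) \<le> norm (f x)" for n
    using \<eta>(2) by (auto simp: abs_mult intro!: mult_left_le AE_I2)
qed (use f in auto)

lemma integral_ball_zero_of_test_functions:
  fixes f :: "real^'m \<Rightarrow> real"
  assumes f: "integrable lebesgue f"
    and z: "\<And>\<phi>. test_function S \<phi> \<Longrightarrow> (LINT x|lebesgue. f x * \<phi> x) = 0"
    and sub: "ball a \<rho> \<subseteq> S"
  shows "(LINT x:ball a \<rho>|lebesgue. f x) = 0"
proof (cases "\<rho> > 0")
  case True
  obtain \<eta> :: "nat \<Rightarrow> real^'m \<Rightarrow> real" where \<eta>:
    "\<forall>n. test_function (ball a \<rho>) (\<eta> n)" "\<forall>n x. 0 \<le> \<eta> n x \<and> \<eta> n x \<le> 1"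
    "\<forall>x\<in>ball a \<rho>. (\<lambda>n. \<eta> n x) \<longlonglongrightarrow> 1"
    by (rule ball_cutoff_exists[OF True, of a]) blast
  have "(LINT x|lebesgue. f x * \<eta> n x) = 0" for n
    using z test_function_mono[OF _ sub] \<eta>(1) by blast
  then show ?thesis
    using cutoff_integral_limit[OF f, of a \<rho> \<eta>] \<eta> by (simp add: LIMSEQ_const_iff)
qed (simp add: set_lebesgue_integral_def ball_empty)

text \<open>
  Cutoff functions show that the integral of \<open>f\<close> vanishes over every ball inside \<open>S\<close>. Filling with balls extends
  this to open subsets, complements to relatively closed subsets, and inner regularity shows that
  the sets where \<open>f\<close> is positive or negative are null.
\<close>

lemma AE_zero_of_test_functions:
  fixes f :: "real^'m \<Rightarrow> real"
  assumes f: "integrable lebesgue f" and S: "open S"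
    and z: "\<And>\<phi>. test_function S \<phi> \<Longrightarrow> (LINT x|lebesgue. f x * \<phi> x) = 0"
  shows "AE x in lebesgue. x \<in> S \<longrightarrow> f x = 0"
proof -
  have fm[measurable]: "f \<in> borel_measurable lebesgue" using f by auto
  have Sm[measurable]: "S \<in> sets lebesgue" using S by simp
  have sint: "set_integrable lebesgue A f" if "A \<in> sets lebesgue" for A
    using that f integrable_mult_indicator unfolding set_integrable_def by blast
  have open0: "(LINT x:T|lebesgue. f x) = 0" if T: "open T" "T \<subseteq> S" for T
  proof -
    have small: "\<exists>d>0. \<forall>r. 0 < r \<longrightarrow> r < d \<longrightarrow> ball x r \<subseteq> T" if xT: "x \<in> T" for x
    proof -
      obtain d where "d > 0" "ball x d \<subseteq> T" by (rule openE[OF T(1) xT])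
      moreover have "ball x r \<subseteq> T" if "r < d" for r
        using subset_ball[of r d x] that \<open>ball x d \<subseteq> T\<close> by (meson less_imp_le order_trans)
      ultimately show ?thesis by blast
    qed
    obtain a :: "nat \<Rightarrow> real^'m" and r where ar: "disjoint_family (\<lambda>k. ball (a k) (r k))"
      "(\<Union>k. ball (a k) (r k)) \<subseteq> T" "T - (\<Union>k. ball (a k) (r k)) \<in> null_sets lebesgue"
      by (rule Vitali_ball_filling[of T "\<lambda>x r. ball x r \<subseteq> T", OF small]) auto
    let ?B = "\<Union>k. ball (a k) (r k)"
    have "(LINT x:T|lebesgue. f x) = (LINT x:?B|lebesgue. f x)"
    proof (rule set_integral_null_delta)
      show "T - ?B \<union> (?B - T) \<in> null_sets lebesgue" using ar(2,3) by (simp add: Diff_eq_empty_iff[THEN iffD2])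
    qed (use f T(1) in auto)
    also have "\<dots> = (\<Sum>k. LINT x:ball (a k) (r k)|lebesgue. f x)"
      using ar(1) sint[of ?B] by (intro lebesgue_integral_countable_add) (auto simp: disjoint_family_on_def)
    also have "\<dots> = (\<Sum>k. 0)"
    proof (rule suminf_cong)
      fix k
      have "ball (a k) (r k) \<subseteq> S" using ar(2) T(2) by blast
      then show "(LINT x:ball (a k) (r k)|lebesgue. f x) = 0"
        using integral_ball_zero_of_test_functions[OF f z] by blast
    qed
    finally show ?thesis by simp
  qed
  have closed0: "(LINT x:(S \<inter> C)|lebesgue. f x) = 0" if C: "closed C" for C
  proof -
    have "(LINT x:S|lebesgue. f x) = (LINT x:((S \<inter> C) \<union> (S - C))|lebesgue. f x)"
      by (rule arg_cong[where f="\<lambda>A. LINT x:A|lebesgue. f x"]) auto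
    also have "\<dots> = (LINT x:(S \<inter> C)|lebesgue. f x) + (LINT x:(S - C)|lebesgue. f x)"
      using C S by (intro set_integral_Un sint) auto
    finally show ?thesis using open0[of S] open0[OF open_Diff[OF S C]] S by auto
  qed
  have null: "A \<in> null_sets lebesgue"
    if A: "A \<in> sets lebesgue" "A \<subseteq> S" and s: "s = 1 \<or> s = (-1::real)" and pos: "\<And>x. x \<in> A \<Longrightarrow> s * f x > 0" for A s
  proof -
    have le: "emeasure lebesgue A \<le> ennreal e" if e: "e > 0" for e
    proof -
      obtain C where C: "closed C" "C \<subseteq> A" "A - C \<in> lmeasurable" "emeasure lebesgue (A - C) < ennreal e"
        using sets_lebesgue_inner_closed[OF A(1) e] by blast
      have "S \<inter> C = C" using C A by blast
      then have "(LINT x:C|lebesgue. f x) = 0" using closed0[OF C(1)] by simp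
      then have int0: "(LINT x|lebesgue. indicator C x * (s * f x)) = 0"
        by (simp add: set_lebesgue_integral_def mult.left_commute)
      have "integrable lebesgue (\<lambda>x. indicator C x * (s * f x))"
        using integrable_mult_indicator[of C lebesgue "\<lambda>x. s * f x"] f C(1) by simp
      then have "AE x in lebesgue. indicator C x * (s * f x) = 0"
        using int0 pos C(2)
        by (subst integral_nonneg_eq_0_iff_AE[symmetric]) (auto simp: indicator_def intro!: AE_I2 less_imp_le)
      then have "AE x in lebesgue. x \<notin> C"
        by (rule AE_mp) (use pos C(2) in \<open>fastforce intro!: AE_I2\<close>)
      then have "C \<in> null_sets lebesgue"
        using C(1) by (simp add: AE_iff_null_sets)
      then have "emeasure lebesgue A = emeasure lebesgue (A - C)"
        using A(1) by (simp add: emeasure_Diff_null_set)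
      then show ?thesis using C(4) by simp
    qed
    have "emeasure lebesgue A \<le> 0"
      by (rule ennreal_le_epsilon) (simp add: le)
    then have "emeasure lebesgue A = 0" by simp
    then show ?thesis using A(1) by auto
  qed
  have "{x\<in>S. f x > 0} \<in> null_sets lebesgue" "{x\<in>S. f x < 0} \<in> null_sets lebesgue"
  proof -
    have "{x\<in>space lebesgue. x \<in> S \<and> f x > 0} \<in> sets lebesgue" "{x\<in>space lebesgue. x \<in> S \<and> f x < 0} \<in> sets lebesgue"
      by measurable
    then show "{x\<in>S. f x > 0} \<in> null_sets lebesgue" "{x\<in>S. f x < 0} \<in> null_sets lebesgue"
      using null[of "{x\<in>S. f x > 0}" 1] null[of "{x\<in>S. f x < 0}" "-1"] by auto
  qed
  then have "{x\<in>S. f x > 0} \<union> {x\<in>S. f x < 0} \<in> null_sets lebesgue" by (rule null_sets.Un)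
  then show ?thesis
    by (rule AE_I') force
qed

text \<open>
  A test function of the piece \<open>S\<close> is also one of \<open>\<Omega>\<close>, and against it the affine map can be integrated by
  parts explicitly. So \<open>G - X\<close> annihilates all test functions of \<open>S\<close>.
\<close>

lemma weak_gradient_of_affine_piece:
  assumes w: "W11_gradient \<Omega> w G" and S: "open S" "bounded S" "S \<subseteq> \<Omega>"
    and aff: "\<And>x. x \<in> S \<Longrightarrow> w x = affine_map X b x"
  shows "AE x in lebesgue. x \<in> S \<longrightarrow> G x = X"
proof -
  have "AE x in lebesgue. x \<in> S \<longrightarrow> indicator S x * (G x $ i $ j - X $ i $ j) = 0" for i j
  proof (rule AE_zero_of_test_functions)
    have Sm: "S \<in> lmeasurable" using S by (simp add: lmeasurable_open)
    have "integrable lebesgue (\<lambda>x. indicator \<Omega> x *\<^sub>R G x)"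
      using w by (simp add: W11_gradient_def set_integrable_def)
    then have "integrable lebesgue (\<lambda>x. (indicator \<Omega> x *\<^sub>R G x) $ i $ j)"
      by (intro integrable_bounded_linear[OF bounded_linear_vec_nth])
    then have "integrable lebesgue (\<lambda>x. indicator S x *\<^sub>R ((indicator \<Omega> x *\<^sub>R G x) $ i $ j))"
      using Sm by (intro integrable_mult_indicator) auto
    moreover have "indicator S x *\<^sub>R ((indicator \<Omega> x *\<^sub>R G x) $ i $ j) = indicator S x * G x $ i $ j" for x
      using S(3) by (auto simp: indicator_def)
    ultimately have iG: "integrable lebesgue (\<lambda>x. indicator S x * G x $ i $ j)" by (simp only:)
    have iX: "integrable lebesgue (\<lambda>x. indicator S x * X $ i $ j)" using Sm by (simp add: lmeasurable_iff_integrable)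
    show "integrable lebesgue (\<lambda>x. indicator S x * (G x $ i $ j - X $ i $ j))"
      using Bochner_Integration.integrable_diff[OF iG iX] by (simp add: right_diff_distrib)
    show "open S" by fact
    show "(LINT x|lebesgue. indicator S x * (G x $ i $ j - X $ i $ j) * \<phi> x) = 0" if \<phi>: "test_function S \<phi>" for \<phi>
    proof -
      have \<phi>0: "\<phi> x = 0" "partial_deriv j \<phi> x = 0" if "x \<notin> S" for x
        using that test_function_zero[OF \<phi>] test_function_partial_zero[OF \<phi>] by auto
      have "(LINT x:\<Omega>|lebesgue. w x $ i * partial_deriv j \<phi> x) = - (LINT x:\<Omega>|lebesgue. G x $ i $ j * \<phi> x)"
        using w test_function_mono[OF \<phi> S(3)] by (simp add: W11_gradient_def)
      moreover have "(LINT x:\<Omega>|lebesgue. w x $ i * partial_deriv j \<phi> x)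
          = (LINT x|lebesgue. affine_map X b x $ i * partial_deriv j \<phi> x)"
        unfolding set_lebesgue_integral_def
      proof (rule Bochner_Integration.integral_cong[OF refl])
        show "indicator \<Omega> x *\<^sub>R (w x $ i * partial_deriv j \<phi> x) = affine_map X b x $ i * partial_deriv j \<phi> x" for x
          by (cases "x \<in> S") (use S(3) aff \<phi>0 in \<open>auto simp: indicator_def\<close>)
      qed
      moreover have "(LINT x:\<Omega>|lebesgue. G x $ i $ j * \<phi> x) = (LINT x|lebesgue. indicator S x * G x $ i $ j * \<phi> x)"
        unfolding set_lebesgue_integral_def
        by (rule Bochner_Integration.integral_cong) (use S(3) \<phi>0 in \<open>auto simp: indicator_def\<close>)
      moreover have "(LINT x|lebesgue. X $ i $ j * \<phi> x) = (LINT x|lebesgue. indicator S x * X $ i $ j * \<phi> x)"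
        by (rule Bochner_Integration.integral_cong) (use \<phi>0 in \<open>auto simp: indicator_def\<close>)
      ultimately have "(LINT x|lebesgue. indicator S x * G x $ i $ j * \<phi> x) = (LINT x|lebesgue. indicator S x * X $ i $ j * \<phi> x)"
        using affine_map_integration_by_parts(2)[OF test_function_mono[OF \<phi> subset_UNIV], of X b i j] by simp
      moreover have "(LINT x|lebesgue. indicator S x * G x $ i $ j * \<phi> x - indicator S x * X $ i $ j * \<phi> x)
         = (LINT x|lebesgue. indicator S x * G x $ i $ j * \<phi> x) - (LINT x|lebesgue. indicator S x * X $ i $ j * \<phi> x)"
        by (intro Bochner_Integration.integral_diff integrable_mult_test_function[OF _ \<phi>] iG iX)
      ultimately show ?thesis by (simp add: left_diff_distrib right_diff_distrib)
    qed
  qed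
  then have "AE x in lebesgue. \<forall>i\<in>UNIV. \<forall>j\<in>UNIV. x \<in> S \<longrightarrow> indicator S x * (G x $ i $ j - X $ i $ j) = 0"
    by (intro AE_finite_allI) auto
  then show ?thesis
    by (rule AE_mp) (auto simp: vec_eq_iff intro!: AE_I2)
qed

section \<open>Weak pairs\<close>

text \<open>
  The test functions range over the whole space, so no boundary condition is imposed on them. For a map supported in a bounded domain this says that it belongs to \<open>W\<^sup>1\<^sup>,\<^sup>1\<close>
  with zero boundary values, the condition that is stable under gluing, scaling and series.
\<close>

definition weak_pair :: "(real^'m \<Rightarrow> real^'d) \<Rightarrow> (real^'m \<Rightarrow> real^'m^'d) \<Rightarrow> bool" where
  "weak_pair u g \<longleftrightarrow> integrable lebesgue u \<and> integrable lebesgue g \<and>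
     (\<forall>\<phi> i j. test_function UNIV \<phi> \<longrightarrow>
        (LINT x|lebesgue. u x $ i * partial_deriv j \<phi> x) = - (LINT x|lebesgue. g x $ i $ j * \<phi> x))"

lemma weak_pairD:
  "weak_pair u g \<Longrightarrow> test_function UNIV \<phi> \<Longrightarrow>
    (LINT x|lebesgue. u x $ i * partial_deriv j \<phi> x) = - (LINT x|lebesgue. g x $ i $ j * \<phi> x)"
  by (simp add: weak_pair_def)

lemma integrable_component:
  fixes u :: "'a \<Rightarrow> real^'d"
  shows "integrable M u \<Longrightarrow> integrable M (\<lambda>x. u x $ i)"
  by (rule integrable_bounded_linear[OF bounded_linear_vec_nth])

lemma integrable_component2:
  fixes g :: "'a \<Rightarrow> real^'m^'d"
  shows "integrable M g \<Longrightarrow> integrable M (\<lambda>x. g x $ i $ j)"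
  by (rule integrable_bounded_linear[OF bounded_linear_vec_nth]) (rule integrable_bounded_linear[OF bounded_linear_vec_nth])

text \<open>
  Scaling domain and range by the same factor transports the gradient without changing its values.
\<close>

lemma weak_pair_scale:
  fixes u :: "real^'m \<Rightarrow> real^'d"
  assumes "weak_pair u g" "r > 0"
  shows "weak_pair (\<lambda>x. r *\<^sub>R u ((x - a) /\<^sub>R r)) (\<lambda>x. g ((x - a) /\<^sub>R r))"
proof -
  have u: "integrable lebesgue u" and g: "integrable lebesgue g" using assms by (auto simp: weak_pair_def)
  have tr: "(x - a) /\<^sub>R r = - (a /\<^sub>R r) + (1 / r) *\<^sub>R x" for x
    by (simp add: scaleR_diff_right inverse_eq_divide)
  have r': "1 / r > 0" using assms by simp
  have iu: "integrable lebesgue (\<lambda>x. u ((x - a) /\<^sub>R r))" and ig: "integrable lebesgue (\<lambda>x. g ((x - a) /\<^sub>R r))"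
    unfolding tr by (rule integrable_lebesgue_affine[OF u r'] integrable_lebesgue_affine[OF g r'])+
  show ?thesis unfolding weak_pair_def
  proof (intro conjI allI impI)
    show "integrable lebesgue (\<lambda>x. r *\<^sub>R u ((x - a) /\<^sub>R r))" using iu by simp
    show "integrable lebesgue (\<lambda>x. g ((x - a) /\<^sub>R r))" by fact
    fix \<phi> :: "real^'m \<Rightarrow> real" and i j assume \<phi>: "test_function UNIV \<phi>"
    let ?\<psi> = "\<lambda>y. \<phi> (a + r *\<^sub>R y)"
    have sm: "smooth_fun \<phi>" by (rule test_function_smooth[OF \<phi>])
    have inv: "(a + r *\<^sub>R y - a) /\<^sub>R r = y" for y using assms by simp
    have \<psi>: "test_function UNIV ?\<psi>"
    proof -
      obtain R where R: "\<And>x. x \<notin> cball 0 R \<Longrightarrow> \<phi> x = 0" using test_function_support_bounded[OF \<phi>] by blast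
      have "{y. ?\<psi> y \<noteq> 0} \<subseteq> (\<lambda>x. (x - a) /\<^sub>R r) ` cball 0 R"
      proof
        fix y assume "y \<in> {y. ?\<psi> y \<noteq> 0}"
        then have "a + r *\<^sub>R y \<in> cball 0 R" using R by blast
        then show "y \<in> (\<lambda>x. (x - a) /\<^sub>R r) ` cball 0 R" using inv by (metis image_eqI)
      qed
      moreover have "compact ((\<lambda>x. (x - a) /\<^sub>R r) ` cball 0 R)"
        by (intro compact_continuous_image continuous_intros compact_cball)
      ultimately have "bounded {y. ?\<psi> y \<noteq> 0}"
        using compact_imp_bounded bounded_subset by blast
      then show ?thesis
        using sm C_class_affine_comp[of _ \<phi> a r] by (auto simp: test_function_def smooth_fun_def)
    qed
    have [measurable]: "partial_deriv j \<phi> \<in> borel_measurable lebesgue" "\<phi> \<in> borel_measurable lebesgue"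
      using test_function_measurable[OF test_function_partial_deriv[OF \<phi>]] test_function_measurable[OF \<phi>] by auto
    have [measurable]: "(\<lambda>x. u ((x - a) /\<^sub>R r) $ i) \<in> borel_measurable lebesgue" "(\<lambda>x. g ((x - a) /\<^sub>R r) $ i $ j) \<in> borel_measurable lebesgue"
      using integrable_component[OF iu] integrable_component2[OF ig] by auto
    have "(LINT x|lebesgue. (r *\<^sub>R u ((x - a) /\<^sub>R r)) $ i * partial_deriv j \<phi> x)
        = (LINT x|lebesgue. r * (u ((x - a) /\<^sub>R r) $ i * partial_deriv j \<phi> x))" by (simp add: mult_ac)
    also have "\<dots> = r ^ DIM(real^'m) * (LINT y|lebesgue. r * (u y $ i * partial_deriv j \<phi> (a + r *\<^sub>R y)))"
      by (subst integral_lebesgue_affine[OF _ assms(2), where a=a]) (use inv in auto)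
    also have "(LINT y|lebesgue. r * (u y $ i * partial_deriv j \<phi> (a + r *\<^sub>R y))) = (LINT y|lebesgue. u y $ i * partial_deriv j ?\<psi> y)"
      by (simp add: partial_deriv_affine_comp[OF sm] mult.left_commute)
    also have "\<dots> = - (LINT y|lebesgue. g y $ i $ j * ?\<psi> y)"
      using assms(1) \<psi> by (simp add: weak_pair_def)
    also have "r ^ DIM(real^'m) * - (LINT y|lebesgue. g y $ i $ j * ?\<psi> y) = - (LINT x|lebesgue. g ((x - a) /\<^sub>R r) $ i $ j * \<phi> x)"
      by (subst (2) integral_lebesgue_affine[OF _ assms(2), where a=a]) (use inv in auto)
    finally show "(LINT x|lebesgue. (r *\<^sub>R u ((x - a) /\<^sub>R r)) $ i * partial_deriv j \<phi> x)
        = - (LINT x|lebesgue. g ((x - a) /\<^sub>R r) $ i $ j * \<phi> x)" .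
  qed
qed

lemma weak_pair_zero: "weak_pair (\<lambda>_. 0) (\<lambda>_. 0)"
  by (simp add: weak_pair_def)

lemma summable_norm_integral_of_nn_integral:
  fixes g :: "nat \<Rightarrow> 'a \<Rightarrow> 'b::{banach, second_countable_topology}"
  assumes g: "\<And>n. integrable M (g n)" and fin: "(\<Sum>n. \<integral>\<^sup>+x. norm (g n x) \<partial>M) < \<infinity>"
  shows "AE x in M. summable (\<lambda>n. norm (g n x))" "summable (\<lambda>n. LINT x|M. norm (g n x))"
proof -
  have [measurable]: "g n \<in> borel_measurable M" for n using g by auto
  have "(\<integral>\<^sup>+x. (\<Sum>n. ennreal (norm (g n x))) \<partial>M) \<noteq> \<infinity>"
    using fin by (subst nn_integral_suminf) auto
  then have "AE x in M. (\<Sum>n. ennreal (norm (g n x))) \<noteq> \<infinity>"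
    by (intro nn_integral_noteq_infinite) auto
  then show "AE x in M. summable (\<lambda>n. norm (g n x))"
    by (rule AE_mp) (auto intro!: AE_I2 summable_suminf_not_top)
  have "(\<integral>\<^sup>+x. norm (g n x) \<partial>M) = ennreal (LINT x|M. norm (g n x))" for n
    using g by (intro nn_integral_eq_integral) auto
  then show "summable (\<lambda>n. LINT x|M. norm (g n x))"
    using fin by (intro summable_suminf_not_top) auto
qed

text \<open>
  Both sides of the defining identity of a weak pair have the form \<open>\<integral> l(v) \<psi>\<close>, with \<open>l\<close> a coordinate functional and
  \<open>\<psi>\<close> bounded; so both are continuous under \<open>L\<^sup>1\<close>-convergent series.
\<close>

lemma sums_integral_times:
  fixes v :: "nat \<Rightarrow> 'a \<Rightarrow> 'b::{banach, second_countable_topology}" and \<psi> :: "'a \<Rightarrow> real"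
  assumes l: "bounded_linear l" and v: "\<And>n. integrable M (v n)"
    and fin: "(\<Sum>n. \<integral>\<^sup>+x. norm (v n x) \<partial>M) < \<infinity>"
    and \<psi>[measurable]: "\<psi> \<in> borel_measurable M" and B: "\<And>x. \<bar>\<psi> x\<bar> \<le> B" "B > 0"
  shows "(\<lambda>n. LINT x|M. l (v n x) * \<psi> x) sums (LINT x|M. l (\<Sum>n. v n x) * \<psi> x)"
proof -
  note sv = summable_norm_integral_of_nn_integral[OF v fin]
  obtain C where C: "C > 0" "\<And>y. norm (l y) \<le> norm y * C"
    using bounded_linear.pos_bounded[OF l] by blast
  have lin: "bounded_linear (\<lambda>y. l y * \<psi> x)" for x
    by (rule bounded_linear_compose[OF bounded_linear_mult_left l])
  have i: "integrable M (\<lambda>x. l (v n x) * \<psi> x)" for n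
    by (rule integrable_mult_bounded[OF integrable_bounded_linear[OF l v] \<psi> B(1)])
  have le: "norm (l (v n x) * \<psi> x) \<le> C * B * norm (v n x)" for n x
    using mult_mono[OF C(2)[of "v n x"] B(1)[of x]] C(1) B(2) by (simp add: abs_mult mult_ac)
  have s1: "AE x in M. summable (\<lambda>n. norm (l (v n x) * \<psi> x))"
    using sv(1)
  proof eventually_elim
    fix x assume "summable (\<lambda>n. norm (v n x))"
    then have "summable (\<lambda>n. C * B * norm (v n x))" by (rule summable_mult)
    then show "summable (\<lambda>n. norm (l (v n x) * \<psi> x))"
      by (rule summable_comparison_test'[of _ 0]) (use le in simp)
  qed
  have s2: "summable (\<lambda>n. LINT x|M. norm (l (v n x) * \<psi> x))"
  proof (rule summable_comparison_test'[OF summable_mult[OF sv(2), of "C * B"], of 0])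
    fix n :: nat
    have "(LINT x|M. norm (l (v n x) * \<psi> x)) \<le> (LINT x|M. C * B * norm (v n x))"
      by (intro integral_mono integrable_norm i integrable_mult_right v le)
    then show "norm (LINT x|M. norm (l (v n x) * \<psi> x)) \<le> C * B * (LINT x|M. norm (v n x))" by simp
  qed
  have "(LINT x|M. (\<Sum>n. l (v n x) * \<psi> x)) = (LINT x|M. l (\<Sum>n. v n x) * \<psi> x)"
  proof (rule integral_cong_AE)
    show "(\<lambda>x. \<Sum>n. l (v n x) * \<psi> x) \<in> borel_measurable M"
      by (rule borel_measurable_integrable[OF integrable_suminf[OF i s1 s2]])
    show "(\<lambda>x. l (\<Sum>n. v n x) * \<psi> x) \<in> borel_measurable M"
      by (intro borel_measurable_times \<psi> borel_measurable_integrable[OF integrable_bounded_linear[OF l integrable_suminf[OF v sv]]])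
    show "AE x in M. (\<Sum>n. l (v n x) * \<psi> x) = l (\<Sum>n. v n x) * \<psi> x"
      using sv(1) by eventually_elim (rule bounded_linear.suminf[OF lin summable_norm_cancel, symmetric])
  qed
  then show ?thesis using sums_integral[OF i s1 s2] by simp
qed

lemma weak_pair_series:
  fixes u :: "nat \<Rightarrow> real^'m \<Rightarrow> real^'d"
  assumes wp: "\<And>n. weak_pair (u n) (g n)"
    and fu: "(\<Sum>n. \<integral>\<^sup>+x. norm (u n x) \<partial>lebesgue) < \<infinity>"
    and fg: "(\<Sum>n. \<integral>\<^sup>+x. norm (g n x) \<partial>lebesgue) < \<infinity>"
  shows "weak_pair (\<lambda>x. \<Sum>n. u n x) (\<lambda>x. \<Sum>n. g n x)"
proof -
  have iu: "integrable lebesgue (u n)" and ig: "integrable lebesgue (g n)" for n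
    using wp by (auto simp: weak_pair_def)
  show ?thesis unfolding weak_pair_def
  proof (intro conjI allI impI)
    show "integrable lebesgue (\<lambda>x. \<Sum>n. u n x)"
      by (rule integrable_suminf[OF iu summable_norm_integral_of_nn_integral[OF iu fu]])
    show "integrable lebesgue (\<lambda>x. \<Sum>n. g n x)"
      by (rule integrable_suminf[OF ig summable_norm_integral_of_nn_integral[OF ig fg]])
    fix \<phi> :: "real^'m \<Rightarrow> real" and i j assume \<phi>: "test_function UNIV \<phi>"
    note d\<phi> = test_function_partial_deriv[OF \<phi>, of j]
    obtain B where B: "B > 0" "\<And>x. \<bar>\<phi> x\<bar> \<le> B" by (rule test_function_bounded[OF \<phi>]) blast
    obtain B' where B': "B' > 0" "\<And>x. \<bar>partial_deriv j \<phi> x\<bar> \<le> B'" by (rule test_function_bounded[OF d\<phi>]) blast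
    have "(\<lambda>n. LINT x|lebesgue. u n x $ i * partial_deriv j \<phi> x) sums (LINT x|lebesgue. (\<Sum>n. u n x) $ i * partial_deriv j \<phi> x)"
      by (rule sums_integral_times[OF bounded_linear_vec_nth iu fu test_function_measurable[OF d\<phi>] B'(2,1)])
    moreover have "(\<lambda>n. LINT x|lebesgue. g n x $ i $ j * \<phi> x) sums (LINT x|lebesgue. (\<Sum>n. g n x) $ i $ j * \<phi> x)"
      by (rule sums_integral_times[OF bounded_linear_compose[OF bounded_linear_vec_nth bounded_linear_vec_nth] ig fg
            test_function_measurable[OF \<phi>] B(2,1)])
    moreover have "(LINT x|lebesgue. u n x $ i * partial_deriv j \<phi> x) = - (LINT x|lebesgue. g n x $ i $ j * \<phi> x)" for n
      by (rule weak_pairD[OF wp \<phi>])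
    ultimately show "(LINT x|lebesgue. (\<Sum>n. u n x) $ i * partial_deriv j \<phi> x) = - (LINT x|lebesgue. (\<Sum>n. g n x) $ i $ j * \<phi> x)"
      by (auto intro: sums_unique2 dest: sums_minus)
  qed
qed

section \<open>Hoelder estimates\<close>

text \<open>
  Unlike \<open>holder_norm\<close>, this is a real inequality with an explicit constant, and it omits the
  supremum of the function.
\<close>

definition holder_on :: "real \<Rightarrow> real \<Rightarrow> (real^'m) set \<Rightarrow> (real^'m \<Rightarrow> real^'d) \<Rightarrow> bool" where
  "holder_on A \<alpha> S f \<longleftrightarrow> (\<forall>x\<in>S. \<forall>y\<in>S. norm (f x - f y) \<le> A * norm (x - y) powr \<alpha>)"

lemma holder_onD: "holder_on A \<alpha> S f \<Longrightarrow> x \<in> S \<Longrightarrow> y \<in> S \<Longrightarrow> norm (f x - f y) \<le> A * norm (x - y) powr \<alpha>"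
  by (simp add: holder_on_def)

lemma holder_space_imp_holder_on:
  assumes "f \<in> holder_space \<alpha> S"
  obtains A where "A \<ge> 0" "holder_on A \<alpha> S f"
proof -
  let ?P = "{(x, y). x \<in> S \<and> y \<in> S \<and> x \<noteq> y}"
  let ?q = "\<lambda>(x, y). ennreal (norm (f x - f y) / norm (x - y) powr \<alpha>)"
  have fin: "(SUP z\<in>?P. ?q z) < top"
    using assms by (auto simp: holder_space_def holder_norm_def less_top)
  define A where "A = enn2real (SUP z\<in>?P. ?q z)"
  have A: "A \<ge> 0" by (simp add: A_def)
  have "holder_on A \<alpha> S f" unfolding holder_on_def
  proof (intro ballI)
    fix x y assume xy: "x \<in> S" "y \<in> S"
    show "norm (f x - f y) \<le> A * norm (x - y) powr \<alpha>"
    proof (cases "x = y")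
      case False
      have "?q (x, y) \<le> (SUP z\<in>?P. ?q z)"
        by (rule SUP_upper) (use xy False in auto)
      then have "ennreal (norm (f x - f y) / norm (x - y) powr \<alpha>) \<le> ennreal A"
        using fin by (simp add: A_def)
      then have "norm (f x - f y) / norm (x - y) powr \<alpha> \<le> A"
        using A by (simp add: ennreal_le_iff)
      then show ?thesis using False by (simp add: pos_divide_le_eq)
    qed simp
  qed
  then show ?thesis using that A by blast
qed

lemma holder_norm_le:
  assumes "\<And>x. x \<in> S \<Longrightarrow> norm (f x) \<le> s" and "holder_on A \<alpha> S f"
  shows "holder_norm \<alpha> S f \<le> ennreal s + ennreal A"
  unfolding holder_norm_def
proof (intro add_mono SUP_least)
  show "x \<in> S \<Longrightarrow> ennreal (norm (f x)) \<le> ennreal s" for x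
    using assms(1) ennreal_leI by blast
  fix z assume "z \<in> {(x, y). x \<in> S \<and> y \<in> S \<and> x \<noteq> y}"
  then show "(case z of (x, y) \<Rightarrow> ennreal (norm (f x - f y) / norm (x - y) powr \<alpha>)) \<le> ennreal A"
    using holder_onD[OF assms(2)] by (auto simp: pos_divide_le_eq intro!: ennreal_leI)
qed

lemma holder_on_add:
  assumes "holder_on A \<alpha> S f" "holder_on B \<alpha> S g"
  shows "holder_on (A + B) \<alpha> S (\<lambda>x. f x + g x)" "holder_on (A + B) \<alpha> S (\<lambda>x. f x - g x)"
proof -
  have "norm ((f x + g x) - (f y + g y)) \<le> norm (f x - f y) + norm (g x - g y)"
       "norm ((f x - g x) - (f y - g y)) \<le> norm (f x - f y) + norm (g x - g y)" for x y
    using norm_triangle_ineq[of "f x - f y" "g x - g y"] norm_triangle_ineq4[of "f x - f y" "g x - g y"]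
    by (simp_all add: algebra_simps)
  then show "holder_on (A + B) \<alpha> S (\<lambda>x. f x + g x)" "holder_on (A + B) \<alpha> S (\<lambda>x. f x - g x)"
    using assms unfolding holder_on_def distrib_right by (meson add_mono order_trans)+
qed

lemma affine_map_holder_on:
  fixes S :: "(real^'m) set" and X :: "real^'m^'d"
  assumes "bounded S" "0 < \<alpha>" "\<alpha> < 1"
  obtains A where "A \<ge> 0" "holder_on A \<alpha> S (affine_map X b)"
proof -
  obtain L where L: "L > 0" "\<And>x. norm (X *v x) \<le> norm x * L"
    using bounded_linear.pos_bounded[OF matrix_vector_mul_bounded_linear[of X]] by blast
  obtain R where R: "R > 0" "\<And>x. x \<in> S \<Longrightarrow> norm x \<le> R" using assms(1) bounded_pos[of S] by blast
  have "holder_on (L * (2 * R) powr (1 - \<alpha>)) \<alpha> S (affine_map X b)" unfolding holder_on_def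
  proof (intro ballI)
    fix x y assume xy: "x \<in> S" "y \<in> S"
    have n: "norm (x - y) \<le> 2 * R"
      using R(2)[OF xy(1)] R(2)[OF xy(2)] norm_triangle_ineq4[of x y] by linarith
    have "affine_map X b x - affine_map X b y = X *v (x - y)"
      by (simp add: affine_map_def matrix_vector_mult_diff_distrib)
    then have "norm (affine_map X b x - affine_map X b y) \<le> norm (x - y) * L" using L(2) by simp
    also have "norm (x - y) = norm (x - y) powr (1 - \<alpha>) * norm (x - y) powr \<alpha>"
      by (simp add: powr_add[symmetric])
    also have "\<dots> * L \<le> (2 * R) powr (1 - \<alpha>) * norm (x - y) powr \<alpha> * L"
      using n assms L(1) by (intro mult_right_mono powr_mono2) auto
    finally show "norm (affine_map X b x - affine_map X b y) \<le> L * (2 * R) powr (1 - \<alpha>) * norm (x - y) powr \<alpha>"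
      by (simp add: mult_ac)
  qed
  then show ?thesis using that L(1) by (metis less_imp_le mult_nonneg_nonneg powr_ge_zero)
qed

text \<open>
  A segment from a point of \<open>V\<close> to a point outside meets the boundary, where \<open>f\<close> vanishes. So the
  constant does not change.
\<close>

lemma holder_on_zero_extension:
  fixes f :: "real^'m \<Rightarrow> real^'d"
  assumes h: "holder_on A \<alpha> (closure V) f" and A: "A \<ge> 0" "\<alpha> > 0"
    and z: "\<And>x. x \<in> frontier V \<Longrightarrow> f x = 0"
  shows "holder_on A \<alpha> UNIV (\<lambda>x. if x \<in> V then f x else 0)"
proof -
  have in_out: "norm (f x) \<le> A * norm (x - y) powr \<alpha>" if x: "x \<in> V" and y: "y \<notin> V" for x y
  proof -
    have "closed_segment x y \<inter> frontier V \<noteq> {}"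
      by (rule connected_Int_frontier) (use x y in auto)
    then obtain c where c: "c \<in> closed_segment x y" "c \<in> frontier V" by blast
    have "norm (x - c) \<le> norm (x - y)"
      using segment_bound(1)[OF c(1)] by (simp add: norm_minus_commute)
    then have "norm (x - c) powr \<alpha> \<le> norm (x - y) powr \<alpha>" using A by (intro powr_mono2) auto
    moreover have "norm (f x - f c) \<le> A * norm (x - c) powr \<alpha>"
      using h x c by (intro holder_onD[OF h]) (auto simp: frontier_def closure_def)
    ultimately show ?thesis
      using z[OF c(2)] A by (metis (no_types, lifting) diff_zero mult_left_mono order_trans)
  qed
  show ?thesis unfolding holder_on_def
  proof (intro ballI)
    fix x y :: "real^'m"
    have cl: "x \<in> V \<Longrightarrow> x \<in> closure V" for x using closure_subset by blast
    show "norm ((if x \<in> V then f x else 0) - (if y \<in> V then f y else 0)) \<le> A * norm (x - y) powr \<alpha>"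
      using in_out[of x y] in_out[of y x] holder_onD[OF h, of x y] cl A
      by (cases "x \<in> V"; cases "y \<in> V") (auto simp: norm_minus_commute)
  qed
qed

lemma holder_on_continuous:
  assumes "holder_on A \<alpha> UNIV f" "\<alpha> > 0"
  shows "continuous_on UNIV f"
proof -
  have "isCont f x" for x
  proof -
    have "((\<lambda>y. A * norm (y - x) powr \<alpha>) \<longlongrightarrow> A * 0) (at x)"
    proof (intro tendsto_mult tendsto_const)
      have "((\<lambda>y. norm (y - x) powr \<alpha>) \<longlongrightarrow> 0 powr \<alpha>) (at x)"
        using assms(2)
        by (intro tendsto_powr' tendsto_norm_zero LIM_zero tendsto_ident_at tendsto_const)
           (auto intro!: always_eventually)
      then show "((\<lambda>y. norm (y - x) powr \<alpha>) \<longlongrightarrow> 0) (at x)" by simp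
    qed
    then have "((\<lambda>y. f y - f x) \<longlongrightarrow> 0) (at x)"
      using holder_onD[OF assms(1)] by (intro Lim_null_comparison[of "\<lambda>y. f y - f x"]) (auto intro!: always_eventually)
    then show ?thesis unfolding isCont_def by (rule LIM_zero_cancel)
  qed
  then show ?thesis by (simp add: continuous_at_imp_continuous_on)
qed

section \<open>Extension by zero across the unit sphere\<close>

text \<open>
  Volumes of concentric balls scale with the dimension-th power of the radius; the rest is Bernoulli's
  inequality.
\<close>

lemma unit_shell_measure:
  fixes s :: real
  assumes "0 \<le> s" "s \<le> 1"
  shows "measure lebesgue (ball (0::real^'m) 1 - ball 0 (1 - s)) \<le> measure lebesgue (ball (0::real^'m) 1) * (CARD('m) * s)"
proof -
  let ?V = "measure lebesgue (ball (0::real^'m) 1)"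
  have "measure lebesgue (ball (0::real^'m) 1 - ball 0 (1 - s)) = ?V - measure lebesgue (ball (0::real^'m) (1 - s))"
    using assms by (intro measurable_measure_Diff) auto
  also have "measure lebesgue (ball (0::real^'m) (1 - s)) = (1 - s) ^ CARD('m) * ?V"
    using content_ball_conv_unit_ball[of "1 - s" "0::real^'m"] assms by simp
  also have "?V - (1 - s) ^ CARD('m) * ?V \<le> ?V * (CARD('m) * s)"
  proof -
    have "1 + real CARD('m) * (- s) \<le> (1 + (- s)) ^ CARD('m)"
      using assms by (intro Bernoulli_inequality) auto
    then have "?V * (1 - CARD('m) * s) \<le> ?V * (1 - s) ^ CARD('m)" by (intro mult_left_mono) auto
    then show ?thesis by (simp add: algebra_simps)
  qed
  finally show ?thesis .
qed

lemma holder_on_near_sphere: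
  fixes u :: "real^'m \<Rightarrow> real^'d"
  assumes u: "holder_on A \<alpha> UNIV u" "\<And>x. x \<notin> ball 0 1 \<Longrightarrow> u x = 0" and x: "norm x \<le> 1"
  shows "norm (u x) \<le> A * (1 - norm x) powr \<alpha>"
proof -
  obtain e :: "real^'m" where e: "norm e = 1" "x = norm x *\<^sub>R e"
  proof (cases "x = 0")
    case True
    then show ?thesis using that[of "axis undefined 1"] by (simp add: norm_axis_1)
  next
    case False
    then show ?thesis using that[of "sgn x"] by (simp add: norm_sgn sgn_div_norm)
  qed
  have "x - e = (norm x - 1) *\<^sub>R e" using e(2) by (simp add: scaleR_left_diff_distrib)
  then have "norm (x - e) = 1 - norm x" using e(1) x by simp
  moreover have "u e = 0" using u(2)[of e] e(1) by simp
  ultimately show ?thesis using holder_onD[OF u(1), of x e] by simp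
qed

text \<open>
  Test the weak gradient of \<open>v\<close> on the unit ball with \<open>\<eta>\<^sub>n \<phi>\<close>, where the \<open>\<eta>\<^sub>n\<close> are the cutoffs of the ball.
  In the limit only the term with \<open>\<phi>\<close> times the derivative of \<open>\<eta>\<^sub>n\<close> could produce a boundary contribution. That derivative
  is of size \<open>n\<close> on a shell of measure of order \<open>1/n\<close>, and there \<open>u\<close> is of order \<open>n\<^sup>-\<^sup>\<alpha>\<close> because it vanishes on the
  sphere; so the term tends to zero.
\<close>

lemma zero_extension_weak_pair:
  fixes u :: "real^'m \<Rightarrow> real^'d" and v H
  defines "B \<equiv> ball (0::real^'m) 1"
  assumes W: "W11_gradient B v H"
    and v: "\<And>x. x \<in> B \<Longrightarrow> v x = affine_map X b x + u x"
    and u: "holder_on A \<alpha> UNIV u" "\<And>x. x \<notin> B \<Longrightarrow> u x = 0" and \<alpha>: "\<alpha> > 0" and A: "A \<ge> 0"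
  shows "weak_pair u (\<lambda>x. indicator B x *\<^sub>R (H x - X))"
proof -
  let ?g = "\<lambda>x. indicator B x *\<^sub>R (H x - X)"
  have Bm: "B \<in> lmeasurable" by (simp add: B_def)
  have ucont: "continuous_on UNIV u" by (rule holder_on_continuous[OF u(1) \<alpha>])
  obtain Cu where Cu: "\<And>x. x \<in> cball 0 1 \<Longrightarrow> norm (u x) \<le> Cu"
    using continuous_on_compact_bound[OF compact_cball continuous_on_subset[OF ucont subset_UNIV]] by blast
  have iu: "integrable lebesgue u"
  proof (rule integrableI_bounded_set[of B])
    show "u \<in> borel_measurable lebesgue"
      using borel_measurable_continuous_onI[OF ucont] by (auto intro!: measurable_completion)
    show "emeasure lebesgue B < \<infinity>" using Bm unfolding fmeasurable_def by blast
    show "AE x in lebesgue. x \<in> B \<longrightarrow> norm (u x) \<le> Cu"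
      using Cu by (auto simp: B_def)
  qed (use u(2) Bm in auto)
  have ig: "integrable lebesgue ?g"
  proof -
    have "integrable lebesgue (\<lambda>x. indicator B x *\<^sub>R H x)"
      using W by (simp add: W11_gradient_def set_integrable_def)
    moreover have "integrable lebesgue (\<lambda>x. indicator B x *\<^sub>R X)"
      using Bm by (intro integrable_scaleR_left) (simp add: lmeasurable_iff_integrable)
    ultimately show ?thesis by (simp add: scaleR_diff_right)
  qed
  obtain \<eta> :: "nat \<Rightarrow> real^'m \<Rightarrow> real" and C where cut:
    "\<forall>n. test_function (ball 0 1) (\<eta> n)" "\<forall>n x. 0 \<le> \<eta> n x \<and> \<eta> n x \<le> 1"
    "\<forall>x\<in>ball 0 1. (\<lambda>n. \<eta> n x) \<longlonglongrightarrow> 1"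
    "\<forall>n j. \<forall>x\<in>ball 0 1. \<bar>partial_deriv j (\<eta> n) x\<bar> \<le> C * real n"
    "\<forall>n j x. real n * (1\<^sup>2 - (norm (x - 0))\<^sup>2) \<ge> 2 \<longrightarrow> partial_deriv j (\<eta> n) x = 0"
    by (rule ball_cutoff_exists[OF zero_less_one, of "0::real^'m"]) blast
  have \<eta>: "test_function B (\<eta> n)" "0 \<le> \<eta> n x" "\<eta> n x \<le> 1" for n x
    using cut by (auto simp: B_def)
  show ?thesis unfolding weak_pair_def
  proof (intro conjI iu ig allI impI)
    fix \<phi> :: "real^'m \<Rightarrow> real" and i j assume \<phi>: "test_function UNIV \<phi>"
    obtain M where M: "M > 0" "\<And>x. \<bar>\<phi> x\<bar> \<le> M" by (rule test_function_bounded[OF \<phi>]) blast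
    have iui: "integrable lebesgue (\<lambda>x. u x $ i)" by (rule integrable_component[OF iu])
    have igij: "integrable lebesgue (\<lambda>x. ?g x $ i $ j)" by (rule integrable_component2[OF ig])
    note d\<phi> = test_function_partial_deriv[OF \<phi>, of j]
    \<comment> \<open>the term that would become a boundary integral\<close>
    define mid where "mid n = (LINT x|lebesgue. u x $ i * (partial_deriv j (\<eta> n) x * \<phi> x))" for n
    have imid: "integrable lebesgue (\<lambda>x. u x $ i * (partial_deriv j (\<eta> n) x * \<phi> x))" for n
      by (rule integrable_mult_test_function[OF iui test_function_mult(1)[OF smooth_fun_partial_deriv[OF test_function_smooth[OF \<eta>(1)]] \<phi>]])
    have i1: "integrable lebesgue (\<lambda>x. u x $ i * partial_deriv j \<phi> x * \<eta> n x)" for n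
      by (intro integrable_mult_test_function[OF _ \<eta>(1)] integrable_mult_test_function[OF iui d\<phi>])
    have step: "(LINT x|lebesgue. u x $ i * partial_deriv j \<phi> x * \<eta> n x) + mid n
        = - (LINT x|lebesgue. ?g x $ i $ j * \<phi> x * \<eta> n x)" for n
    proof -
      let ?\<psi> = "\<lambda>x. \<eta> n x * \<phi> x"
      have \<psi>: "test_function B ?\<psi>" by (rule test_function_mult(2)[OF test_function_smooth[OF \<phi>] \<eta>(1)])
      note \<psi>U = test_function_mono[OF \<psi> subset_UNIV]
      have \<psi>0: "?\<psi> x = 0" "partial_deriv j ?\<psi> x = 0" if "x \<notin> B" for x
        using test_function_zero[OF \<psi> that] test_function_partial_zero[OF \<psi> that] by auto
      have d: "partial_deriv j ?\<psi> x = \<eta> n x * partial_deriv j \<phi> x + partial_deriv j (\<eta> n) x * \<phi> x" for x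
        by (rule partial_deriv_mult[OF test_function_smooth[OF \<eta>(1)] test_function_smooth[OF \<phi>]])
      have "(LINT x:B|lebesgue. v x $ i * partial_deriv j ?\<psi> x) = - (LINT x:B|lebesgue. H x $ i $ j * ?\<psi> x)"
        using W \<psi> by (simp add: W11_gradient_def)
      moreover have "(LINT x:B|lebesgue. v x $ i * partial_deriv j ?\<psi> x)
          = (LINT x|lebesgue. affine_map X b x $ i * partial_deriv j ?\<psi> x + u x $ i * partial_deriv j ?\<psi> x)"
        unfolding set_lebesgue_integral_def
      proof (rule Bochner_Integration.integral_cong[OF refl])
        show "indicator B x *\<^sub>R (v x $ i * partial_deriv j ?\<psi> x)
            = affine_map X b x $ i * partial_deriv j ?\<psi> x + u x $ i * partial_deriv j ?\<psi> x" for x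
          by (cases "x \<in> B") (use \<psi>0 v in \<open>auto simp: distrib_right\<close>)
      qed
      moreover have "\<dots> = (LINT x|lebesgue. affine_map X b x $ i * partial_deriv j ?\<psi> x) + (LINT x|lebesgue. u x $ i * partial_deriv j ?\<psi> x)"
        by (intro Bochner_Integration.integral_add affine_map_integration_by_parts(1)[OF \<psi>U]
            integrable_mult_test_function[OF iui test_function_partial_deriv[OF \<psi>U]])
      moreover have "(LINT x:B|lebesgue. H x $ i $ j * ?\<psi> x) = (LINT x|lebesgue. ?g x $ i $ j * ?\<psi> x + X $ i $ j * ?\<psi> x)"
        unfolding set_lebesgue_integral_def
      proof (rule Bochner_Integration.integral_cong[OF refl])
        show "indicator B x *\<^sub>R (H x $ i $ j * ?\<psi> x) = ?g x $ i $ j * ?\<psi> x + X $ i $ j * ?\<psi> x" for x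
          by (cases "x \<in> B") (use \<psi>0(1)[of x] in \<open>auto simp: left_diff_distrib\<close>)
      qed
      moreover have "\<dots> = (LINT x|lebesgue. ?g x $ i $ j * ?\<psi> x) + (LINT x|lebesgue. X $ i $ j * ?\<psi> x)"
        by (intro Bochner_Integration.integral_add integrable_mult_test_function[OF igij \<psi>] integrable_mult_right
             test_function_integrable[OF \<psi>])
      moreover note affine_map_integration_by_parts(2)[OF \<psi>U, of X b i j]
      ultimately have "(LINT x|lebesgue. u x $ i * partial_deriv j ?\<psi> x) = - (LINT x|lebesgue. ?g x $ i $ j * ?\<psi> x)"
        by linarith
      moreover have "(LINT x|lebesgue. u x $ i * partial_deriv j ?\<psi> x)
         = (LINT x|lebesgue. u x $ i * partial_deriv j \<phi> x * \<eta> n x + u x $ i * (partial_deriv j (\<eta> n) x * \<phi> x))"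
        unfolding d by (rule Bochner_Integration.integral_cong) (auto simp: algebra_simps)
      moreover have "\<dots> = (LINT x|lebesgue. u x $ i * partial_deriv j \<phi> x * \<eta> n x) + mid n"
        unfolding mid_def by (rule Bochner_Integration.integral_add[OF i1 imid])
      moreover have "(LINT x|lebesgue. ?g x $ i $ j * ?\<psi> x) = (LINT x|lebesgue. ?g x $ i $ j * \<phi> x * \<eta> n x)"
        by (rule Bochner_Integration.integral_cong) auto
      ultimately show ?thesis by simp
    qed
    have lim: "(\<lambda>n. LINT x|lebesgue. f x * \<eta> n x) \<longlonglongrightarrow> (LINT x|lebesgue. f x)"
      if f: "integrable lebesgue f" "\<And>x. x \<notin> B \<Longrightarrow> f x = 0" for f
    proof -
      have "(LINT x:B|lebesgue. f x) = (LINT x|lebesgue. f x)"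
        unfolding set_lebesgue_integral_def
        by (rule Bochner_Integration.integral_cong) (use f(2) in \<open>auto simp: indicator_def\<close>)
      then show ?thesis
        using cutoff_integral_limit[OF f(1), of 0 1 \<eta>] cut by (simp add: B_def)
    qed
    have l1: "(\<lambda>n. LINT x|lebesgue. u x $ i * partial_deriv j \<phi> x * \<eta> n x) \<longlonglongrightarrow> (LINT x|lebesgue. u x $ i * partial_deriv j \<phi> x)"
      by (rule lim[OF integrable_mult_test_function[OF iui d\<phi>]]) (simp add: u(2))
    have l2: "(\<lambda>n. LINT x|lebesgue. ?g x $ i $ j * \<phi> x * \<eta> n x) \<longlonglongrightarrow> (LINT x|lebesgue. ?g x $ i $ j * \<phi> x)"
      by (rule lim[OF integrable_mult_test_function[OF igij \<phi>]]) simp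
    have "mid \<longlonglongrightarrow> 0"
    proof (rule Lim_null_comparison)
      define c where "c = A * \<bar>C\<bar> * M * (measure lebesgue B * (CARD('m) * 2))"
      show "\<forall>\<^sub>F n in sequentially. norm (mid n) \<le> c * (2 * (1 / real n)) powr \<alpha>"
      proof (rule eventually_sequentiallyI[of 2])
        fix n :: nat assume n: "2 \<le> n"
        define s where "s = 2 * (1 / real n)"
        have s: "0 < s" "s \<le> 1" using n by (auto simp: s_def field_simps)
        let ?T = "B - ball 0 (1 - s)"
        let ?c = "A * s powr \<alpha> * (\<bar>C\<bar> * real n * M)"
        have Tm: "?T \<in> lmeasurable" using Bm by (intro fmeasurable_Diff) auto
        have pt: "norm (u x $ i * (partial_deriv j (\<eta> n) x * \<phi> x)) \<le> ?c * indicator ?T x" for x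
        proof (cases "x \<in> ?T")
          case True
          then have x: "norm x \<le> 1" "1 - norm x \<le> s" by (auto simp: B_def)
          have "\<bar>u x $ i\<bar> \<le> norm (u x)" by (rule component_le_norm_cart)
          also have "\<dots> \<le> A * (1 - norm x) powr \<alpha>"
            by (rule holder_on_near_sphere[OF u(1) _ x(1)]) (use u(2) in \<open>auto simp: B_def\<close>)
          also have "\<dots> \<le> A * s powr \<alpha>" using x A \<alpha> by (intro mult_left_mono powr_mono2) auto
          finally have 1: "\<bar>u x $ i\<bar> \<le> A * s powr \<alpha>" .
          have "\<bar>partial_deriv j (\<eta> n) x\<bar> \<le> C * real n" using cut(4) True by (auto simp: B_def)
          also have "\<dots> \<le> \<bar>C\<bar> * real n" by (intro mult_right_mono) auto
          finally have 2: "\<bar>partial_deriv j (\<eta> n) x\<bar> \<le> \<bar>C\<bar> * real n" .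
          have "\<bar>u x $ i\<bar> * (\<bar>partial_deriv j (\<eta> n) x\<bar> * \<bar>\<phi> x\<bar>) \<le> (A * s powr \<alpha>) * (\<bar>C\<bar> * real n * M)"
            using 1 2 M A by (intro mult_mono) auto
          then show ?thesis using True by (simp add: abs_mult)
        next
          case False
          show ?thesis
          proof (cases "x \<in> B")
            case True
            then have nx: "norm x < 1 - s" using False by (auto simp: B_def)
            have "(norm x)\<^sup>2 \<le> norm x" using nx s by (simp add: power2_eq_square mult_left_le)
            then have "s \<le> 1 - (norm x)\<^sup>2" using nx by linarith
            then have "real n * s \<le> real n * (1 - (norm x)\<^sup>2)" by (intro mult_left_mono) auto
            moreover have "real n * s = 2" using n by (simp add: s_def)
            ultimately have "partial_deriv j (\<eta> n) x = 0" using cut(5) by auto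
            then show ?thesis using False by simp
          next
            case False
            then show ?thesis using u(2) by simp
          qed
        qed
        have "norm (mid n) \<le> (LINT x|lebesgue. norm (u x $ i * (partial_deriv j (\<eta> n) x * \<phi> x)))"
          unfolding mid_def by (rule integral_norm_bound)
        also have "\<dots> \<le> (LINT x|lebesgue. ?c * indicator ?T x)"
          by (intro integral_mono pt integrable_norm imid integrable_mult_right) (use Tm in \<open>simp add: lmeasurable_iff_integrable\<close>)
        also have "\<dots> = ?c * measure lebesgue ?T" using Tm by simp
        also have "\<dots> \<le> ?c * (measure lebesgue B * (CARD('m) * s))"
          unfolding B_def using s A M by (intro mult_left_mono unit_shell_measure) auto
        also have "\<dots> = c * s powr \<alpha>" using n by (simp add: c_def s_def field_simps)
        finally show "norm (mid n) \<le> c * (2 * (1 / real n)) powr \<alpha>" unfolding s_def .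
      qed
      have "(\<lambda>n. 2 * (1 / real n)) \<longlonglongrightarrow> 2 * 0" by (intro tendsto_mult tendsto_const lim_1_over_n)
      then have "(\<lambda>n. (2 * (1 / real n)) powr \<alpha>) \<longlonglongrightarrow> 0 powr \<alpha>"
        using \<alpha> by (intro tendsto_powr' tendsto_const) (auto intro!: always_eventually)
      then have "(\<lambda>n. c * (2 * (1 / real n)) powr \<alpha>) \<longlonglongrightarrow> c * 0 powr \<alpha>"
        by (intro tendsto_mult tendsto_const)
      then show "(\<lambda>n. c * (2 * (1 / real n)) powr \<alpha>) \<longlonglongrightarrow> 0" by simp
    qed
    then have "(\<lambda>n. - (LINT x|lebesgue. ?g x $ i $ j * \<phi> x * \<eta> n x)) \<longlonglongrightarrow> (LINT x|lebesgue. u x $ i * partial_deriv j \<phi> x) + 0"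
      unfolding step[symmetric] by (intro tendsto_add l1)
    then show "(LINT x|lebesgue. u x $ i * partial_deriv j \<phi> x) = - (LINT x|lebesgue. ?g x $ i $ j * \<phi> x)"
      using LIMSEQ_unique[OF _ tendsto_minus[OF l2]] by simp
  qed
qed

section \<open>Weak type estimates\<close>

lemma superlevel_in_sets_lebesgue:
  fixes f :: "'a::euclidean_space \<Rightarrow> 'b::{real_normed_vector, second_countable_topology}"
  assumes [measurable]: "f \<in> borel_measurable lebesgue" "A \<in> sets lebesgue"
  shows "{x\<in>A. norm (f x) > t} \<in> sets lebesgue"
proof -
  have "{x\<in>space lebesgue. x \<in> A \<and> norm (f x) > t} \<in> sets lebesgue" by measurable
  then show ?thesis by (simp only: space_completion space_lborel space_borel UNIV_I simp_thms)
qed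

text \<open>
  The sum of the geometric series with terms \<open>2\<^sup>k\<^sup>+\<^sup>1 (2\<^sup>k)\<^sup>-\<^sup>p\<close>.
\<close>

definition weak_type_const :: "real \<Rightarrow> real" where
  "weak_type_const p = 2 / (1 - 2 powr (1 - p))"

lemma weak_type_const_nonneg: "1 < p \<Longrightarrow> 0 \<le> weak_type_const p"
  using powr_less_mono[of "1 - p" 0 "2::real"] by (simp add: weak_type_const_def)

text \<open>
  Weak \<open>L\<^sup>p\<close> embeds into \<open>L\<^sup>1\<close> on sets of finite measure: \<open>f\<close> is bounded pointwise by \<open>1\<close> plus the sum of
  \<open>2\<^sup>k\<^sup>+\<^sup>1\<close> times the indicator of \<open>{f > 2\<^sup>k}\<close>.
\<close>

lemma nn_integral_le_of_weak_type:
  fixes f :: "'a \<Rightarrow> real"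
  assumes [measurable]: "f \<in> borel_measurable M" "A \<in> sets M" and p: "1 < p"
    and weak: "\<And>t. t > 0 \<Longrightarrow> emeasure M {x\<in>A. f x > t} \<le> ennreal (t powr (- p)) * C"
  shows "(\<integral>\<^sup>+x\<in>A. ennreal (f x) \<partial>M) \<le> emeasure M A + ennreal (weak_type_const p) * C"
proof -
  define T where "T k = {x\<in>A. f x > 2 ^ k}" for k :: nat
  have T[measurable]: "T k \<in> sets M" for k
  proof -
    have "T k = {x\<in>space M. x \<in> A \<and> f x > 2 ^ k}"
      using sets.sets_into_space[OF assms(2)] by (auto simp: T_def)
    then show ?thesis by simp
  qed
  have pt: "ennreal (f x) * indicator A x \<le> indicator A x + (\<Sum>k. ennreal (2 ^ Suc k) * indicator (T k) x)" for x
  proof (cases "x \<in> A \<and> f x > 1")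
    case True
    have "\<exists>n. \<not> 2 ^ n < f x"
    proof -
      obtain n where "f x < 2 ^ n" using real_arch_pow[of 2 "f x"] by auto
      then show ?thesis by (intro exI[of _ n]) auto
    qed
    then obtain n where n: "\<not> 2 ^ n < f x" "\<And>m. m < n \<Longrightarrow> 2 ^ m < f x"
      using exists_least_iff[of "\<lambda>n. \<not> 2 ^ n < f x"] by auto
    have "n \<noteq> 0" using n(1) True by (intro notI) simp
    then obtain k where k: "n = Suc k" using not0_implies_Suc by blast
    have xk: "x \<in> T k" using n(2)[of k] True k by (auto simp: T_def)
    have "ennreal (f x) \<le> ennreal (2 ^ Suc k)" using n(1) k by (intro ennreal_leI) auto
    also have "\<dots> = (\<Sum>i\<in>{k}. ennreal (2 ^ Suc i) * indicator (T i) x)" using xk by simp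
    also have "\<dots> \<le> (\<Sum>k. ennreal (2 ^ Suc k) * indicator (T k) x)"
      by (intro sum_le_suminf summableI) auto
    finally show ?thesis using True by (simp add: add_increasing)
  next
    case False
    then have "ennreal (f x) * indicator A x \<le> indicator A x"
      by (auto simp: indicator_def ennreal_le_1)
    then show ?thesis by (rule order_trans) simp
  qed
  have layer: "(\<integral>\<^sup>+x. ennreal (2 ^ Suc k) * indicator (T k) x \<partial>M) \<le> ennreal (2 * (2 powr (1 - p)) ^ k) * C" for k
  proof -
    have "(\<integral>\<^sup>+x. ennreal (2 ^ Suc k) * indicator (T k) x \<partial>M) = ennreal (2 ^ Suc k) * emeasure M (T k)"
      by (simp add: nn_integral_cmult_indicator)
    also have "\<dots> \<le> ennreal (2 ^ Suc k) * (ennreal ((2 ^ k) powr (- p)) * C)"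
      unfolding T_def by (intro mult_left_mono weak) auto
    also have "\<dots> = ennreal (2 ^ Suc k * (2 ^ k) powr (- p)) * C"
      by (simp add: ennreal_mult mult.assoc)
    also have "2 ^ Suc k * (2 ^ k) powr (- p) = 2 * (2 powr (1 - p)) ^ k"
    proof -
      have "(2::real) ^ k * (2 ^ k) powr (- p) = (2 ^ k) powr (1 - p)"
        by (simp add: powr_diff powr_minus field_simps)
      also have "\<dots> = (2 powr (1 - p)) ^ k"
        by (simp add: powr_realpow[symmetric] powr_powr mult.commute)
      finally show ?thesis by simp
    qed
    finally show ?thesis .
  qed
  have r: "0 \<le> (2::real) powr (1 - p)" "(2::real) powr (1 - p) < 1"
    using powr_less_mono[of "1 - p" 0 "2::real"] p by auto
  have "(\<lambda>k. 2 * (2 powr (1 - p)) ^ k) sums weak_type_const p"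
    using sums_mult[OF geometric_sums[of "2 powr (1 - p)"], of 2] r by (simp add: weak_type_const_def)
  then have geo: "(\<Sum>k. ennreal (2 * (2 powr (1 - p)) ^ k)) = ennreal (weak_type_const p)"
    by (intro suminf_ennreal_eq) auto
  have "(\<integral>\<^sup>+x\<in>A. ennreal (f x) \<partial>M) \<le> (\<integral>\<^sup>+x. indicator A x + (\<Sum>k. ennreal (2 ^ Suc k) * indicator (T k) x) \<partial>M)"
    by (intro nn_integral_mono pt)
  also have "\<dots> = emeasure M A + (\<Sum>k. \<integral>\<^sup>+x. ennreal (2 ^ Suc k) * indicator (T k) x \<partial>M)"
    by (subst nn_integral_add) (auto simp: nn_integral_suminf)
  also have "\<dots> \<le> emeasure M A + (\<Sum>k. ennreal (2 * (2 powr (1 - p)) ^ k) * C)"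
    by (intro add_left_mono suminf_le summableI layer)
  also have "(\<Sum>k. ennreal (2 * (2 powr (1 - p)) ^ k) * C) = ennreal (weak_type_const p) * C"
    by (simp add: geo[symmetric] ennreal_suminf_multc)
  finally show ?thesis .
qed

lemma one_plus_powr_le:
  fixes a p :: real
  assumes "1 \<le> p" "0 \<le> a"
  shows "1 + a powr p \<le> (1 + a) powr p"
proof -
  have e: "b powr p = b * b powr (p - 1)" if "b \<ge> 0" for b :: real
    using that by (cases "b = 0") (auto simp: powr_diff)
  have "1 \<le> (1 + a) powr (p - 1)" using assms by (intro ge_one_powr_ge_zero) auto
  moreover have "a * a powr (p - 1) \<le> a * (1 + a) powr (p - 1)"
    using assms by (intro mult_left_mono powr_mono2) auto
  ultimately show ?thesis
    using e[of a] e[of "1 + a"] assms by (simp add: distrib_right)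
qed

section \<open>One reduction on the unit ball\<close>

lemma open_AE_witness:
  fixes S :: "('a::euclidean_space) set"
  assumes "open S" "S \<noteq> {}" and "AE x in lebesgue. x \<in> S \<longrightarrow> P x"
  obtains x where "x \<in> S" "P x"
proof -
  have "\<exists>x\<in>S. P x"
  proof (rule ccontr)
    assume "\<not> (\<exists>x\<in>S. P x)"
    then have "AE x in lebesgue. x \<notin> S" using assms(3) by (auto elim: AE_mp intro!: AE_I2)
    then have "S \<in> null_sets lebesgue" using assms(1) by (simp add: AE_iff_null_sets)
    then show False
      using open_not_negligible[OF assms(1,2)] by (simp add: negligible_iff_null_sets)
  qed
  then show thesis using that by blast
qed

abbreviation unit_ball :: "(real^'m) set" where "unit_ball \<equiv> ball 0 1"

lemma regular_domain_unit_ball: "regular_domain (unit_ball :: (real^'m) set)"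
  unfolding regular_domain_def
  using negligible_convex_frontier[OF convex_ball, of "0::real^'m" 1]
  by (auto simp: negligible_iff_null_sets connected_ball)

text \<open>
  The data that the iteration uses from a reducing map of the unit ball for the gradient \<open>X\<close>. The
  function \<open>u\<close> is the reducing map minus its linear boundary datum, extended by zero. The
  gradient \<open>H\<close> is a representative that is exactly constant on every piece, not only almost
  everywhere. The families \<open>\<G>\<close> and \<open>\<B>\<close> consist of the pieces whose gradient lies in \<open>K\<close> and of the remaining ones; the
  lower bound at the end concerns the pieces of \<open>\<G>\<close> only, since those are final. The constants of reducibility enter as
  \<open>M\<close> and \<open>c\<close>, already raised to the power \<open>p\<close>.
\<close>

definition cell ::
  "(real^'m^'d) set \<Rightarrow> (real^'m^'d) set \<Rightarrow> real \<Rightarrow> real \<Rightarrow> real \<Rightarrow> real \<Rightarrow> real \<Rightarrow> real^'m^'d \<Rightarrow>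
   real \<Rightarrow> (real^'m \<Rightarrow> real^'d) \<Rightarrow> (real^'m \<Rightarrow> real^'m^'d) \<Rightarrow> (real^'m) set set \<Rightarrow> (real^'m) set set \<Rightarrow> bool" where
  "cell U K \<alpha> p M c \<epsilon> X A u H \<G> \<B> \<longleftrightarrow>
     A \<ge> 0 \<and> holder_on A \<alpha> UNIV u \<and> (\<forall>x. x \<notin> unit_ball \<longrightarrow> u x = 0) \<and>
     weak_pair u (\<lambda>x. indicator unit_ball x *\<^sub>R (H x - X)) \<and> H \<in> borel_measurable lebesgue \<and>
     countable \<G> \<and> countable \<B> \<and> disjoint (\<G> \<union> \<B>) \<and> \<G> \<inter> \<B> = {} \<and>
     (\<forall>S\<in>\<G> \<union> \<B>. regular_domain S \<and> S \<subseteq> unit_ball) \<and> unit_ball - \<Union>(\<G> \<union> \<B>) \<in> null_sets lebesgue \<and>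
     (\<forall>S\<in>\<G>. \<exists>Y\<in>K. \<exists>b. \<forall>x\<in>S. H x = Y \<and> X *v x + u x = Y *v x + b) \<and>
     (\<forall>S\<in>\<B>. \<exists>Y\<in>U. \<exists>b. \<forall>x\<in>S. H x = Y \<and> X *v x + u x = Y *v x + b) \<and>
     (\<forall>t>0. emeasure lebesgue {x\<in>unit_ball. norm (H x) > t}
        \<le> ennreal (t powr (- p)) * (ennreal (M * (1 + norm X) powr p) * emeasure lebesgue (unit_ball :: (real^'m) set))) \<and>
     (\<integral>\<^sup>+x\<in>\<Union>\<B>. ennreal ((1 + norm (H x)) powr p) \<partial>lebesgue) \<le> ennreal \<epsilon> * emeasure lebesgue (unit_ball :: (real^'m) set) \<and>
     (\<forall>t>1. emeasure lebesgue {x\<in>\<Union>\<G>. norm (H x) > t}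
        \<ge> ennreal ((c - \<epsilon>) * t powr (- p)) * emeasure lebesgue (unit_ball :: (real^'m) set))"

lemma cell_gradient_integral:
  fixes X :: "real^'m^'d"
  assumes "cell U K \<alpha> p M c \<epsilon> X A u H \<G> \<B>" and p: "1 < p" and M: "M \<ge> 0"
  shows "(\<integral>\<^sup>+x\<in>unit_ball. ennreal (norm (H x - X)) \<partial>lebesgue)
    \<le> ennreal ((1 + M * weak_type_const p) * (1 + norm X) powr p) * emeasure lebesgue (unit_ball :: (real^'m) set)"
proof -
  let ?V = "emeasure lebesgue (unit_ball :: (real^'m) set)"
  let ?N = "(1 + norm X) powr p"
  have Hm[measurable]: "H \<in> borel_measurable lebesgue" using assms(1) by (simp add: cell_def)
  have Bm[measurable]: "(unit_ball :: (real^'m) set) \<in> sets lebesgue" by simp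
  have 1: "(\<integral>\<^sup>+x\<in>unit_ball. ennreal (norm (H x)) \<partial>lebesgue) \<le> ?V + ennreal (weak_type_const p) * (ennreal (M * ?N) * ?V)"
    by (rule nn_integral_le_of_weak_type[OF _ _ p]) (use assms(1) in \<open>auto simp: cell_def\<close>)
  have 2: "(\<integral>\<^sup>+x\<in>unit_ball. ennreal (norm (H x - X)) \<partial>lebesgue)
      \<le> (\<integral>\<^sup>+x. ennreal (norm (H x)) * indicator unit_ball x + ennreal (norm X) * indicator unit_ball x \<partial>lebesgue)"
  proof (rule nn_integral_mono)
    show "ennreal (norm (H x - X)) * indicator unit_ball x
        \<le> ennreal (norm (H x)) * indicator unit_ball x + ennreal (norm X) * indicator unit_ball x" for x
      using norm_triangle_ineq4[of "H x" X]
      by (auto simp: indicator_def ennreal_plus[symmetric] simp del: ennreal_plus intro!: ennreal_leI)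
  qed
  have 3: "(\<integral>\<^sup>+x. ennreal (norm (H x)) * indicator unit_ball x + ennreal (norm X) * indicator unit_ball x \<partial>lebesgue)
      = (\<integral>\<^sup>+x\<in>unit_ball. ennreal (norm (H x)) \<partial>lebesgue) + ennreal (norm X) * ?V"
    by (subst nn_integral_add) (auto simp: nn_integral_cmult_indicator)
  have "(\<integral>\<^sup>+x\<in>unit_ball. ennreal (norm (H x - X)) \<partial>lebesgue)
      \<le> (?V + ennreal (weak_type_const p) * (ennreal (M * ?N) * ?V)) + ennreal (norm X) * ?V"
    by (rule order_trans[OF 2]) (unfold 3, intro add_right_mono 1)
  also have "\<dots> = ennreal ((1 + norm X) + weak_type_const p * (M * ?N)) * ?V"
    using weak_type_const_nonneg[OF p] M
    by (simp add: ennreal_plus ennreal_mult distrib_right mult.assoc add_ac)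
  also have "\<dots> \<le> ennreal ((1 + M * weak_type_const p) * ?N) * ?V"
  proof (intro mult_right_mono ennreal_leI)
    have "(1 + norm X) powr 1 \<le> (1 + norm X) powr p" using p by (intro powr_mono) auto
    then show "(1 + norm X) + weak_type_const p * (M * ?N) \<le> (1 + M * weak_type_const p) * ?N"
      by (simp add: algebra_simps)
  qed simp
  finally show ?thesis .
qed

text \<open>
  The affine pieces of the reducing map \<open>v\<close> determine \<open>H\<close> everywhere up to a null set, and \<open>H\<close> agrees almost everywhere with
  the given weak gradient. A piece is open and nonempty, so it is not null; therefore a statement
  that holds almost everywhere, such as membership of the gradient in \<open>U\<close> on the error set, holds at
  some point of it and hence for its matrix.
\<close>

lemma cell_of_reducing_map:
  fixes U K :: "(real^'m^'d) set"
  assumes red: "reducing_map U K p M X 0 \<epsilon> \<alpha> p unit_ball v G" and p: "1 < p"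
    and \<alpha>: "0 < \<alpha>" "\<alpha> < 1" and \<epsilon>: "0 < \<epsilon>" and M: "M \<ge> 1"
    and low: "\<And>t. t > 1 \<Longrightarrow> measure lebesgue (super_level unit_ball G t)
                 \<ge> c * measure lebesgue (unit_ball :: (real^'m) set) * t powr (- p)"
  shows "\<exists>A u H \<G> \<B>. cell U K \<alpha> p (M powr p) c \<epsilon> X A u H \<G> \<B>"
proof -
  let ?B = "unit_ball :: (real^'m) set"
  have Bm[measurable]: "?B \<in> sets lebesgue" by simp
  have Bfm: "?B \<in> lmeasurable" by simp
  have pw: "piecewise_affine ?B v" and W: "W11_gradient ?B v G" and hs: "v \<in> holder_space \<alpha> (closure ?B)"
    and bd: "\<And>x. x \<in> frontier ?B \<Longrightarrow> v x = affine_map X 0 x"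
    and sup: "\<And>t. t > 0 \<Longrightarrow> measure lebesgue (super_level ?B G t)
          \<le> M powr p * (1 + norm X powr p) * measure lebesgue ?B * t powr (- p)"
    and err: "AE x in lebesgue. x \<in> error_set K ?B G \<longrightarrow> G x \<in> U"
    and small: "(\<integral>\<^sup>+x\<in>error_set K ?B G. ennreal ((1 + norm (G x)) powr p) \<partial>lebesgue) < ennreal (\<epsilon> * measure lebesgue ?B)"
    using red unfolding reducing_map_def by blast+
  obtain \<F> N where F: "countable \<F>" "disjoint \<F>" "\<And>S. S \<in> \<F> \<Longrightarrow> regular_domain S \<and> S \<subseteq> ?B"
    "N \<in> null_sets lebesgue" "?B = \<Union>\<F> \<union> N" "\<forall>S\<in>\<F>. \<exists>Z b. \<forall>x\<in>S. v x = affine_map Z b x"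
    using pw unfolding piecewise_affine_def by metis
  have "\<forall>S\<in>\<F>. \<exists>Zb. \<forall>x\<in>S. v x = affine_map (fst Zb) (snd Zb) x"
    using F(6) by simp
  then have "\<exists>Xb. \<forall>S\<in>\<F>. \<forall>x\<in>S. v x = affine_map (fst (Xb S)) (snd (Xb S)) x"
    by (rule bchoice)
  then obtain Xb where Xb': "\<forall>S\<in>\<F>. \<forall>x\<in>S. v x = affine_map (fst (Xb S)) (snd (Xb S)) x" ..
  have Xb: "v x = affine_map (fst (Xb S)) (snd (Xb S)) x" if "S \<in> \<F>" "x \<in> S" for S x
    using Xb' that by blast
  define Y where "Y S = fst (Xb S)" for S
  define \<G> where "\<G> = {S\<in>\<F>. Y S \<in> K}"
  define \<B> where "\<B> = {S\<in>\<F>. Y S \<notin> K}"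
  have GB: "\<G> \<union> \<B> = \<F>" "\<G> \<inter> \<B> = {}" by (auto simp: \<G>_def \<B>_def)
  define H where "H x = (if \<exists>S\<in>\<F>. x \<in> S then Y (THE S. S \<in> \<F> \<and> x \<in> S) else X)" for x
  have HS: "H x = Y S" if "S \<in> \<F>" "x \<in> S" for S x
  proof -
    have "(THE S. S \<in> \<F> \<and> x \<in> S) = S"
      using that F(2) by (intro the_equality) (auto simp: disjoint_def)
    then show ?thesis using that by (auto simp: H_def)
  qed
  have Sopen: "open S" "bounded S" "S \<noteq> {}" "S \<subseteq> ?B" if "S \<in> \<F>" for S
    using F(3)[OF that] by (auto simp: regular_domain_def)
  have AE_S: "AE x in lebesgue. x \<in> S \<longrightarrow> G x = Y S" if "S \<in> \<F>" for S
    unfolding Y_def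
    by (rule weak_gradient_of_affine_piece[OF W Sopen(1,2,4)[OF that]]) (rule Xb[OF that])
  \<comment> \<open>\<open>G\<close> is only known almost everywhere on each piece, but there are only countably many pieces\<close>
  have AE_H: "AE x in lebesgue. x \<in> ?B \<longrightarrow> x \<in> \<Union>\<F> \<and> G x = H x"
  proof -
    have "AE x in lebesgue. \<forall>S\<in>\<F>. x \<in> S \<longrightarrow> G x = Y S"
      using AE_S F(1) by (simp add: AE_ball_countable)
    moreover have "AE x in lebesgue. x \<notin> N" using F(4) by (rule AE_not_in)
    ultimately show ?thesis
    proof eventually_elim
      fix x assume "\<forall>S\<in>\<F>. x \<in> S \<longrightarrow> G x = Y S" "x \<notin> N"
      then show "x \<in> ?B \<longrightarrow> x \<in> \<Union>\<F> \<and> G x = H x" using F(5) HS by fastforce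
    qed
  qed
  have Hm[measurable]: "H \<in> borel_measurable lebesgue"
  proof (rule measurable_piecewise_restrict[where C="insert (- \<Union>\<F>) \<F>"])
    have opn: "open (\<Union>\<F>)" using Sopen(1) by (intro open_Union) auto
    show "\<Omega> \<inter> space lebesgue \<in> sets lebesgue" if "\<Omega> \<in> insert (- \<Union>\<F>) \<F>" for \<Omega>
    proof (cases "\<Omega> \<in> \<F>")
      case False
      then have "\<Omega> = - \<Union>\<F>" using that by blast
      moreover have "- \<Union>\<F> \<in> sets lebesgue" using opn by (simp add: Compl_in_sets_lebesgue)
      ultimately show ?thesis by simp
    qed (simp add: Sopen)
    show "H \<in> borel_measurable (restrict_space lebesgue \<Omega>)" if \<Omega>: "\<Omega> \<in> insert (- \<Union>\<F>) \<F>" for \<Omega>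
    proof -
      obtain Z where "\<And>x. x \<in> \<Omega> \<Longrightarrow> H x = Z"
      proof (cases "\<Omega> \<in> \<F>")
        case True
        then show ?thesis using HS that by blast
      next
        case False
        then have "\<Omega> = - \<Union>\<F>" using \<Omega> by blast
        then have "\<And>x. x \<in> \<Omega> \<Longrightarrow> H x = X" by (auto simp: H_def)
        then show ?thesis by (rule that)
      qed
      then show ?thesis
        by (subst measurable_cong[of _ _ "\<lambda>_. Z"]) (auto simp: space_restrict_space)
    qed
  qed (use F(1) in auto)
  obtain A0 where A0: "A0 \<ge> 0" "holder_on A0 \<alpha> (closure ?B) v"
    using hs by (rule holder_space_imp_holder_on)
  obtain A1 where A1: "A1 \<ge> 0" "holder_on A1 \<alpha> (closure ?B) (affine_map X 0)"
    by (rule affine_map_holder_on[of "closure ?B" \<alpha> X 0]) (use \<alpha> in auto)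
  define A where "A = A0 + A1"
  define u where "u x = (if x \<in> ?B then v x - affine_map X 0 x else 0)" for x
  have A: "A \<ge> 0" using A0 A1 by (simp add: A_def)
  have uh: "holder_on A \<alpha> UNIV u"
    unfolding u_def[abs_def] A_def
    by (rule holder_on_zero_extension) (use holder_on_add(2)[OF A0(2) A1(2)] A0 A1 \<alpha> bd in auto)
  have u0: "x \<notin> ?B \<Longrightarrow> u x = 0" for x by (simp add: u_def)
  have "weak_pair u (\<lambda>x. indicator ?B x *\<^sub>R (G x - X))"
    by (rule zero_extension_weak_pair[OF W _ uh u0 \<alpha>(1) A, of X 0]) (simp add: u_def)
  then have wp: "weak_pair u (\<lambda>x. indicator ?B x *\<^sub>R (H x - X))"
  proof -
    assume wpG: "weak_pair u (\<lambda>x. indicator ?B x *\<^sub>R (G x - X))"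
    let ?g = "\<lambda>x. indicator ?B x *\<^sub>R (G x - X)" and ?h = "\<lambda>x. indicator ?B x *\<^sub>R (H x - X)"
    have ig: "integrable lebesgue ?g" using wpG by (simp add: weak_pair_def)
    have hm: "?h \<in> borel_measurable lebesgue" by measurable
    have eq: "AE x in lebesgue. ?g x = ?h x" using AE_H by eventually_elim (auto simp: indicator_def)
    have ih: "integrable lebesgue ?h"
      by (rule integrable_cong_AE_imp[OF ig hm eq])
    show ?thesis unfolding weak_pair_def
    proof (intro conjI allI impI ih)
      show "integrable lebesgue u" using wpG by (simp add: weak_pair_def)
      fix \<phi> :: "real^'m \<Rightarrow> real" and i j assume \<phi>: "test_function UNIV \<phi>"
      have "(LINT x|lebesgue. ?g x $ i $ j * \<phi> x) = (LINT x|lebesgue. ?h x $ i $ j * \<phi> x)"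
      proof (rule integral_cong_AE)
        show "(\<lambda>x. ?g x $ i $ j * \<phi> x) \<in> borel_measurable lebesgue" "(\<lambda>x. ?h x $ i $ j * \<phi> x) \<in> borel_measurable lebesgue"
          using integrable_mult_test_function[OF integrable_component2[OF ig] \<phi>]
            integrable_mult_test_function[OF integrable_component2[OF ih] \<phi>]
          by (simp_all only: borel_measurable_integrable)
        show "AE x in lebesgue. ?g x $ i $ j * \<phi> x = ?h x $ i $ j * \<phi> x"
          using eq by eventually_elim (simp only:)
      qed
      then show "(LINT x|lebesgue. u x $ i * partial_deriv j \<phi> x) = - (LINT x|lebesgue. ?h x $ i $ j * \<phi> x)"
        using weak_pairD[OF wpG \<phi>, of i j] by (simp only:)
    qed
  qed
  have YU: "Y S \<in> U" if "S \<in> \<B>" for S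
  proof -
    have S: "S \<in> \<F>" "Y S \<notin> K" using that by (auto simp: \<B>_def)
    have "AE x in lebesgue. x \<in> S \<longrightarrow> G x = Y S \<and> (x \<in> error_set K ?B G \<longrightarrow> G x \<in> U)"
      using AE_S[OF S(1)] err by eventually_elim auto
    then obtain x where "x \<in> S" "G x = Y S" "x \<in> error_set K ?B G \<longrightarrow> G x \<in> U"
      by (rule open_AE_witness[OF Sopen(1)[OF S(1)] Sopen(3)[OF S(1)]]) blast
    then show ?thesis using S Sopen(4)[OF S(1)] by (auto simp: error_set_def)
  qed
  have aff: "X *v x + u x = Y S *v x + snd (Xb S)" if "S \<in> \<F>" "x \<in> S" for S x
  proof -
    have "x \<in> ?B" using that Sopen(4) by blast
    then show ?thesis using Xb[OF that] by (simp add: u_def affine_map_def Y_def)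
  qed
  have Vfin: "emeasure lebesgue ?B = ennreal (measure lebesgue ?B)"
    using Bfm by (simp add: emeasure_eq_measure2)
  have lev: "super_level ?B G t \<in> lmeasurable" "{x\<in>?B. norm (H x) > t} \<in> lmeasurable"
    "measure lebesgue (super_level ?B G t) = measure lebesgue {x\<in>?B. norm (H x) > t}" if t: "t > 0" for t
  proof -
    have gm[measurable]: "(\<lambda>x. indicator ?B x *\<^sub>R G x) \<in> borel_measurable lebesgue"
      using W by (auto simp: W11_gradient_def set_integrable_def)
    have "super_level ?B G t = {x\<in>?B. norm (indicator ?B x *\<^sub>R G x) > t}"
      by (auto simp: super_level_def)
    then have 1: "super_level ?B G t \<in> sets lebesgue"
      by (simp only: superlevel_in_sets_lebesgue[OF gm Bm])
    have 2: "{x\<in>?B. norm (H x) > t} \<in> sets lebesgue" by (rule superlevel_in_sets_lebesgue[OF Hm Bm])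
    show "super_level ?B G t \<in> lmeasurable"
      by (rule fmeasurableI2[OF Bfm _ 1]) (unfold super_level_def, blast)
    show "{x\<in>?B. norm (H x) > t} \<in> lmeasurable"
      by (rule fmeasurableI2[OF Bfm _ 2]) blast
    show "measure lebesgue (super_level ?B G t) = measure lebesgue {x\<in>?B. norm (H x) > t}"
    proof (rule measure_eq_AE[OF _ 1 2])
      show "AE x in lebesgue. (x \<in> super_level ?B G t) = (x \<in> {x\<in>?B. norm (H x) > t})"
        using AE_H by eventually_elim (auto simp: super_level_def)
    qed
  qed
  have Bint: "(\<integral>\<^sup>+x\<in>\<Union>\<B>. ennreal ((1 + norm (H x)) powr p) \<partial>lebesgue) \<le> ennreal \<epsilon> * emeasure lebesgue ?B"
  proof -
    have "(\<integral>\<^sup>+x\<in>\<Union>\<B>. ennreal ((1 + norm (H x)) powr p) \<partial>lebesgue)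
        \<le> (\<integral>\<^sup>+x\<in>error_set K ?B G. ennreal ((1 + norm (G x)) powr p) \<partial>lebesgue)"
    proof (rule nn_integral_mono_AE)
      show "AE x in lebesgue. ennreal ((1 + norm (H x)) powr p) * indicator (\<Union>\<B>) x
         \<le> ennreal ((1 + norm (G x)) powr p) * indicator (error_set K ?B G) x"
        using AE_H
      proof eventually_elim
        fix x assume x: "x \<in> ?B \<longrightarrow> x \<in> \<Union>\<F> \<and> G x = H x"
        show "ennreal ((1 + norm (H x)) powr p) * indicator (\<Union>\<B>) x
         \<le> ennreal ((1 + norm (G x)) powr p) * indicator (error_set K ?B G) x"
        proof (cases "x \<in> \<Union>\<B>")
          case True
          then obtain S where S: "S \<in> \<F>" "Y S \<notin> K" "x \<in> S" by (auto simp: \<B>_def)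
          then have "x \<in> ?B" using Sopen(4) by blast
          then have "x \<in> error_set K ?B G" "G x = H x" using x S HS by (auto simp: error_set_def)
          then show ?thesis using True by (simp only: indicator_simps)
        qed simp
      qed
    qed
    also have "\<dots> \<le> ennreal (\<epsilon> * measure lebesgue ?B)" using small by (rule less_imp_le)
    finally show ?thesis using \<epsilon> by (simp add: Vfin ennreal_mult)
  qed
  have upper: "emeasure lebesgue {x\<in>?B. norm (H x) > t}
      \<le> ennreal (t powr (- p)) * (ennreal (M powr p * (1 + norm X) powr p) * emeasure lebesgue ?B)" if t: "t > 0" for t
  proof -
    have "measure lebesgue {x\<in>?B. norm (H x) > t} \<le> M powr p * (1 + norm X powr p) * measure lebesgue ?B * t powr (- p)"
      using sup[OF t] lev(3)[OF t] by simp
    also have "\<dots> \<le> M powr p * (1 + norm X) powr p * measure lebesgue ?B * t powr (- p)"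
      using p by (intro mult_right_mono mult_left_mono one_plus_powr_le) auto
    finally have "ennreal (measure lebesgue {x\<in>?B. norm (H x) > t})
        \<le> ennreal (t powr (- p) * (M powr p * (1 + norm X) powr p * measure lebesgue ?B))"
      by (intro ennreal_leI) (simp add: mult_ac)
    then show ?thesis
      using lev(2)[OF t] by (simp add: emeasure_eq_measure2 Vfin ennreal_mult)
  qed
  have lower: "ennreal ((c - \<epsilon>) * t powr (- p)) * emeasure lebesgue ?B \<le> emeasure lebesgue {x\<in>\<Union>\<G>. norm (H x) > t}"
    if t: "t > 1" for t
  proof -
    let ?S = "{x\<in>?B. norm (H x) > t}" and ?G = "{x\<in>\<Union>\<G>. norm (H x) > t}" and ?E = "{x\<in>\<Union>\<B>. norm (H x) > t}"
    have t0: "t > 0" using t by simp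
    have GBo: "open (\<Union>\<G>)" "open (\<Union>\<B>)" using Sopen(1) by (auto intro!: open_Union simp: \<G>_def \<B>_def)
    have GBs: "\<Union>\<G> \<subseteq> ?B" "\<Union>\<B> \<subseteq> ?B" using Sopen(4) unfolding \<G>_def \<B>_def by blast+
    have sub: "?G = \<Union>\<G> \<inter> ?S" "?E = \<Union>\<B> \<inter> ?S" using GBs by blast+
    have GBm: "\<Union>\<G> \<in> sets lebesgue" "\<Union>\<B> \<in> sets lebesgue" using GBo by auto
    have Gm: "?G \<in> lmeasurable" and Em: "?E \<in> lmeasurable"
      unfolding sub
      by (rule fmeasurableI2[OF lev(2)[OF t0] Int_lower2 sets.Int[OF _ fmeasurableD[OF lev(2)[OF t0]]]], fact GBm)+
    have "?S \<subseteq> ?G \<union> ?E \<union> (N \<inter> ?S)" using F(5) GB(1) by blast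
    then have "measure lebesgue ?S \<le> measure lebesgue (?G \<union> ?E \<union> (N \<inter> ?S))"
      using Gm Em lev(2)[OF t0] F(4) by (intro measure_mono_fmeasurable fmeasurable.Un) (auto intro: fmeasurableI2)
    also have "\<dots> = measure lebesgue (?G \<union> ?E)"
      by (intro measure_Un_null_set null_set_Int2[OF F(4)] sets.Un fmeasurableD Gm Em lev(2)[OF t0])
    also have "\<dots> \<le> measure lebesgue ?G + measure lebesgue ?E"
      using Gm Em by (intro measure_Un_le) auto
    finally have m1: "measure lebesgue ?S \<le> measure lebesgue ?G + measure lebesgue ?E" .
    \<comment> \<open>Chebyshev's inequality: the bad pieces contribute little to the superlevel set\<close>
    have "ennreal (t powr p) * emeasure lebesgue ?E = (\<integral>\<^sup>+x. ennreal (t powr p) * indicator ?E x \<partial>lebesgue)"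
      using Em by (simp add: nn_integral_cmult_indicator)
    also have "\<dots> \<le> (\<integral>\<^sup>+x\<in>\<Union>\<B>. ennreal ((1 + norm (H x)) powr p) \<partial>lebesgue)"
      using t p by (intro nn_integral_mono) (auto simp: indicator_def intro!: ennreal_leI powr_mono2)
    also have "\<dots> \<le> ennreal \<epsilon> * emeasure lebesgue ?B" by (rule Bint)
    finally have "ennreal (t powr p * measure lebesgue ?E) \<le> ennreal (\<epsilon> * measure lebesgue ?B)"
      using Em \<epsilon> by (simp add: emeasure_eq_measure2 Vfin ennreal_mult)
    then have "t powr p * measure lebesgue ?E \<le> \<epsilon> * measure lebesgue ?B"
      using \<epsilon> by (simp add: ennreal_le_iff)
    then have m2: "measure lebesgue ?E \<le> \<epsilon> * measure lebesgue ?B * t powr (- p)"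
      using t by (simp add: powr_minus field_simps)
    have "(c - \<epsilon>) * t powr (- p) * measure lebesgue ?B \<le> measure lebesgue ?G"
      using m1 m2 low[OF t] lev(3)[OF t0] by (simp add: algebra_simps)
    then have "ennreal ((c - \<epsilon>) * t powr (- p) * measure lebesgue ?B) \<le> emeasure lebesgue ?G"
      using Gm by (simp add: emeasure_eq_measure2 ennreal_leI)
    then show ?thesis
      by (simp add: Vfin ennreal_mult'')
  qed
  have piece: "\<exists>Z\<in>W. \<exists>b. \<forall>x\<in>S. H x = Z \<and> X *v x + u x = Z *v x + b" if "S \<in> \<F>" "Y S \<in> W" for S W
    by (rule bexI[OF _ that(2)], rule exI[of _ "snd (Xb S)"]) (simp add: HS[OF that(1)] aff[OF that(1)])
  have "cell U K \<alpha> p (M powr p) c \<epsilon> X A u H \<G> \<B>"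
    unfolding cell_def GB(1)
  proof (intro conjI)
    show "countable \<G>" "countable \<B>" using F(1) by (auto simp: \<G>_def \<B>_def)
    show "?B - \<Union>\<F> \<in> null_sets lebesgue"
    proof (rule null_sets_subset[OF F(4)])
      have "open (\<Union>\<F>)" using Sopen(1) by (intro open_Union) auto
      then have "\<Union>\<F> \<in> sets lebesgue" by simp
      with Bm show "?B - \<Union>\<F> \<in> sets lebesgue" by (rule sets.Diff)
      show "?B - \<Union>\<F> \<subseteq> N" using F(5) by blast
    qed
    show "\<forall>S\<in>\<G>. \<exists>Z\<in>K. \<exists>b. \<forall>x\<in>S. H x = Z \<and> X *v x + u x = Z *v x + b"
      using piece by (simp add: \<G>_def)
    show "\<forall>S\<in>\<B>. \<exists>Z\<in>U. \<exists>b. \<forall>x\<in>S. H x = Z \<and> X *v x + u x = Z *v x + b"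
      using piece YU by (simp add: \<B>_def)
    show "\<forall>x. x \<notin> ?B \<longrightarrow> u x = 0" using u0 by blast
    show "\<forall>S\<in>\<F>. regular_domain S \<and> S \<subseteq> ?B" using F(3) by blast
    show "\<forall>t>0. emeasure lebesgue {x\<in>?B. norm (H x) > t}
        \<le> ennreal (t powr (- p)) * (ennreal (M powr p * (1 + norm X) powr p) * emeasure lebesgue ?B)"
      using upper by blast
    show "\<forall>t>1. ennreal ((c - \<epsilon>) * t powr (- p)) * emeasure lebesgue ?B \<le> emeasure lebesgue {x\<in>\<Union>\<G>. norm (H x) > t}"
      using lower by blast
  qed (fact A uh wp Hm F(2) GB(2) Bint)+
  then show ?thesis by blast
qed

section \<open>Affine copies of sets\<close>

lemma mem_affine_image:
  fixes a :: "'a::real_vector"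
  assumes "r \<noteq> 0"
  shows "x \<in> (\<lambda>y. a + r *\<^sub>R y) ` S \<longleftrightarrow> (x - a) /\<^sub>R r \<in> S"
proof
  show "(x - a) /\<^sub>R r \<in> S" if "x \<in> (\<lambda>y. a + r *\<^sub>R y) ` S" using that assms by auto
  show "x \<in> (\<lambda>y. a + r *\<^sub>R y) ` S" if "(x - a) /\<^sub>R r \<in> S"
    using that assms by (intro image_eqI[of _ _ "(x - a) /\<^sub>R r"]) auto
qed

lemma mem_ball_affine:
  fixes a :: "'a::real_normed_vector"
  assumes "r > 0"
  shows "(x - a) /\<^sub>R r \<in> ball 0 1 \<longleftrightarrow> x \<in> ball a r"
proof -
  have "norm ((x - a) /\<^sub>R r) = norm (x - a) / r"
    using assms by (simp only: norm_scaleR) (simp add: divide_inverse mult.commute)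
  then show ?thesis
    using assms by (simp only: mem_ball dist_norm diff_0 norm_minus_cancel) (simp add: norm_minus_commute)
qed

lemma null_sets_affine_image:
  fixes N :: "('a::euclidean_space) set"
  assumes "N \<in> null_sets lebesgue"
  shows "(\<lambda>y. a + r *\<^sub>R y) ` N \<in> null_sets lebesgue"
proof -
  have "(\<lambda>y. a + r *\<^sub>R y) differentiable_on N"
    by (auto simp: differentiable_on_def differentiable_def intro!: exI[of _ "\<lambda>h. r *\<^sub>R h"] derivative_eq_intros)
  then have "negligible ((\<lambda>y. a + r *\<^sub>R y) ` N)"
    using assms by (intro negligible_differentiable_image_negligible) (auto simp: negligible_iff_null_sets)
  then show ?thesis by (simp add: negligible_iff_null_sets)
qed

lemma regular_domain_affine_image:
  fixes S :: "(real^'m) set"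
  assumes "regular_domain S" "r \<noteq> 0"
  shows "regular_domain ((\<lambda>y. a + r *\<^sub>R y) ` S)"
proof -
  let ?T = "\<lambda>y. a + r *\<^sub>R y"
  have S: "open S" "bounded S" "connected S" "S \<noteq> {}" "frontier S \<in> null_sets lebesgue"
    using assms(1) by (auto simp: regular_domain_def)
  have op: "open (?T ` S)" using S(1) assms(2) by (rule open_affinity)
  have comp: "compact (?T ` closure S)"
    using S(2) by (intro compact_continuous_image continuous_intros) (simp add: compact_closure)
  have cl: "closure (?T ` S) \<subseteq> ?T ` closure S"
    using comp closure_subset by (intro closure_minimal image_mono compact_imp_closed)
  have sub: "frontier (?T ` S) \<subseteq> ?T ` frontier S"
    using cl op S(1) by (auto simp: frontier_def interior_open)
  have "frontier (?T ` S) \<in> sets lebesgue" using borel_closed[OF frontier_closed[of "?T ` S"]] by simp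
  then have "frontier (?T ` S) \<in> null_sets lebesgue"
    by (rule null_sets_subset[OF null_sets_affine_image[OF S(5)] _ sub])
  moreover have "bounded (?T ` S)"
    by (rule bounded_subset[OF compact_imp_bounded[OF comp] image_mono[OF closure_subset]])
  moreover have "connected (?T ` S)"
    using S(3) by (intro connected_continuous_image continuous_intros)
  ultimately show ?thesis using op S(4) by (simp add: regular_domain_def)
qed

lemma nn_integral_ball_affine:
  fixes F :: "real^'m \<Rightarrow> ennreal"
  assumes F[measurable]: "F \<in> borel_measurable lebesgue" and r: "r > 0"
  shows "(\<integral>\<^sup>+x\<in>ball a r. F ((x - a) /\<^sub>R r) \<partial>lebesgue) = ennreal (r ^ CARD('m)) * (\<integral>\<^sup>+y\<in>unit_ball. F y \<partial>lebesgue)"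
proof -
  let ?F = "\<lambda>y. F y * indicator unit_ball y"
  have [measurable]: "(unit_ball :: (real^'m) set) \<in> sets lebesgue" by simp
  have Fm[measurable]: "?F \<in> borel_measurable lebesgue" by measurable
  have tr: "(x - a) /\<^sub>R r = - (a /\<^sub>R r) + inverse r *\<^sub>R x" for x by (simp add: scaleR_diff_right)
  have [measurable]: "(\<lambda>x. (x - a) /\<^sub>R r) \<in> lebesgue \<rightarrow>\<^sub>M lebesgue"
    unfolding tr by (rule lebesgue_measurable_affine_scalar) (use r in simp)
  have "(\<integral>\<^sup>+x\<in>ball a r. F ((x - a) /\<^sub>R r) \<partial>lebesgue) = (\<integral>\<^sup>+x. ?F ((x - a) /\<^sub>R r) \<partial>lebesgue)"
    by (rule nn_integral_cong) (simp only: indicator_def mem_ball_affine[OF r])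
  also have "\<dots> = ennreal (r ^ DIM(real^'m)) * (\<integral>\<^sup>+y. ?F ((a + r *\<^sub>R y - a) /\<^sub>R r) \<partial>lebesgue)"
    by (rule nn_integral_lebesgue_affine[OF _ r]) measurable
  finally show ?thesis using r by simp
qed

lemma emeasure_ball_affine:
  fixes a :: "real^'m"
  assumes "r > 0"
  shows "emeasure lebesgue (ball a r) = ennreal (r ^ CARD('m)) * emeasure lebesgue (unit_ball :: (real^'m) set)"
  using nn_integral_ball_affine[of "\<lambda>_. 1" r a] assms by simp

text \<open>
  All estimates of a stage are inequalities between integrals over single balls; this lemma and the
  next add them up.
\<close>

lemma nn_integral_UN_disjoint:
  fixes f :: "'a \<Rightarrow> ennreal"
  assumes [measurable]: "f \<in> borel_measurable M" "\<And>k::nat. B k \<in> sets M" and "disjoint_family B"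
  shows "(\<integral>\<^sup>+x\<in>(\<Union>k. B k). f x \<partial>M) = (\<Sum>k. \<integral>\<^sup>+x\<in>B k. f x \<partial>M)"
proof -
  have "(\<integral>\<^sup>+x\<in>(\<Union>k. B k). f x \<partial>M) = (\<integral>\<^sup>+x. (\<Sum>k. f x * indicator (B k) x) \<partial>M)"
    by (simp add: suminf_indicator[OF assms(3)])
  also have "\<dots> = (\<Sum>k. \<integral>\<^sup>+x\<in>B k. f x \<partial>M)"
    by (rule nn_integral_suminf) measurable
  finally show ?thesis .
qed

lemma nn_integral_UN_disjoint_mono:
  fixes f g :: "'a \<Rightarrow> ennreal"
  assumes "f \<in> borel_measurable M" "g \<in> borel_measurable M" "\<And>k::nat. B k \<in> sets M" "disjoint_family B"
    and "\<And>k. (\<integral>\<^sup>+x\<in>B k. f x \<partial>M) \<le> (\<integral>\<^sup>+x\<in>B k. g x \<partial>M)"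
  shows "(\<integral>\<^sup>+x\<in>(\<Union>k. B k). f x \<partial>M) \<le> (\<integral>\<^sup>+x\<in>(\<Union>k. B k). g x \<partial>M)"
  using assms by (simp add: nn_integral_UN_disjoint suminf_le)

section \<open>One step of the construction\<close>

text \<open>
  The set \<open>V\<close> is an arbitrary open set rather than a family of domains: the next stage cuts it into balls, and
  for that only the behaviour of \<open>w\<close> and \<open>G\<close> near each point matters.
\<close>

definition affine_state ::
  "(real^'m^'d) set \<Rightarrow> (real^'m) set \<Rightarrow> (real^'m \<Rightarrow> real^'d) \<Rightarrow> (real^'m \<Rightarrow> real^'m^'d) \<Rightarrow> bool" where
  "affine_state U V w G \<longleftrightarrow> open V \<and>
     (\<forall>x\<in>V. G x \<in> U \<and> (\<exists>d>0. ball x d \<subseteq> V \<and> (\<exists>b. \<forall>y\<in>ball x d. G y = G x \<and> w y = G x *v y + b)))"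

definition weight :: "real \<Rightarrow> (real^'m \<Rightarrow> real^'m^'d) \<Rightarrow> real^'m \<Rightarrow> ennreal" where
  "weight p G x = ennreal ((1 + norm (G x)) powr p)"

abbreviation energy :: "real \<Rightarrow> (real^'m) set \<Rightarrow> (real^'m \<Rightarrow> real^'m^'d) \<Rightarrow> ennreal" where
  "energy p V G \<equiv> \<integral>\<^sup>+x\<in>V. weight p G x \<partial>lebesgue"

text \<open>
  One stage of the iteration passes from \<open>(V, w, G)\<close> to \<open>(V', w', G')\<close>. The family \<open>\<G>\<close> consists of
  the pieces that become final in this stage.
\<close>

definition reduction_step where
  "reduction_step U K \<alpha> p M L c \<epsilon> \<delta> V w G V' w' G' \<G> \<longleftrightarrow>
     affine_state U V' w' G' \<and> V' \<subseteq> V \<and> G' \<in> borel_measurable lebesgue \<and>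
     weak_pair (\<lambda>x. w' x - w x) (\<lambda>x. G' x - G x) \<and>
     (\<forall>x. x \<notin> V \<longrightarrow> w' x = w x \<and> G' x = G x) \<and>
     holder_on \<delta> \<alpha> UNIV (\<lambda>x. w' x - w x) \<and> (\<forall>x. norm (w' x - w x) \<le> \<delta>) \<and>
     countable \<G> \<and> disjoint \<G> \<and> (\<forall>S\<in>\<G>. regular_domain S \<and> S \<subseteq> V \<and> S \<inter> V' = {}) \<and>
     V - (\<Union>\<G> \<union> V') \<in> null_sets lebesgue \<and>
     (\<forall>S\<in>\<G>. \<exists>Y\<in>K. \<exists>b. \<forall>x\<in>S. G' x = Y \<and> w' x = affine_map Y b x) \<and>
     energy p V' G' \<le> ennreal \<epsilon> * energy p V G \<and>
     (\<forall>t>0. emeasure lebesgue {x\<in>V. norm (G' x) > t}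
        \<le> ennreal (M * t powr (- p)) * energy p V G) \<and>
     (\<integral>\<^sup>+x. norm (G' x - G x) \<partial>lebesgue) \<le> ennreal L * energy p V G \<and>
     (\<forall>t>1. emeasure lebesgue {x\<in>\<Union>\<G>. norm (G' x) > t}
        \<ge> ennreal ((c - \<epsilon>) * t powr (- p)) * emeasure lebesgue V)"

lemma affine_state_small_ball:
  assumes st: "affine_state U V w G" and x: "x \<in> V" and \<alpha>: "\<alpha> < 1" and \<delta>: "\<delta> > 0" and A: "A \<ge> 0"
  shows "\<exists>d>0. \<forall>r. 0 < r \<longrightarrow> r < d \<longrightarrow>
     ball x r \<subseteq> V \<and> (\<exists>b. \<forall>y\<in>ball x r. G y = G x \<and> w y = G x *v y + b) \<and> r \<le> 1 \<and> A * r powr (1 - \<alpha>) \<le> \<delta>"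
proof -
  obtain d b where d: "d > 0" "ball x d \<subseteq> V" "\<forall>y\<in>ball x d. G y = G x \<and> w y = G x *v y + b"
    using st x unfolding affine_state_def by blast
  define e where "e = (\<delta> / (A + 1)) powr (1 / (1 - \<alpha>))"
  have e: "e > 0" using \<delta> A by (simp add: e_def)
  show ?thesis
  proof (intro exI[of _ "min (min d e) 1"] conjI allI impI)
    fix r assume r: "0 < r" "r < min (min d e) 1"
    have sub: "ball x r \<subseteq> ball x d" using r by (intro subset_ball) auto
    then show "ball x r \<subseteq> V" using d(2) by blast
    show "\<exists>b. \<forall>y\<in>ball x r. G y = G x \<and> w y = G x *v y + b" using d(3) sub by blast
    show "r \<le> 1" using r by simp
    have "r powr (1 - \<alpha>) \<le> e powr (1 - \<alpha>)" using r \<alpha> by (intro powr_mono2) auto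
    also have "\<dots> = \<delta> / (A + 1)" using \<alpha> \<delta> A by (simp add: e_def powr_powr)
    finally have "A * r powr (1 - \<alpha>) \<le> A * (\<delta> / (A + 1))" using A by (intro mult_left_mono)
    also have "\<dots> \<le> \<delta>" using A \<delta> by (simp add: field_simps)
    finally show "A * r powr (1 - \<alpha>) \<le> \<delta>" .
  qed (use d e in auto)
qed

lemma holder_on_scale:
  fixes u :: "real^'m \<Rightarrow> real^'d"
  assumes u: "holder_on A \<alpha> UNIV u" and r: "r > 0"
  shows "holder_on (A * r powr (1 - \<alpha>)) \<alpha> UNIV (\<lambda>x. r *\<^sub>R u ((x - a) /\<^sub>R r))"
  unfolding holder_on_def
proof (intro ballI)
  fix x y
  have d: "(x - a) /\<^sub>R r - (y - a) /\<^sub>R r = (x - y) /\<^sub>R r" by (simp add: scaleR_diff_right)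
  have "norm (r *\<^sub>R u ((x - a) /\<^sub>R r) - r *\<^sub>R u ((y - a) /\<^sub>R r)) = r * norm (u ((x - a) /\<^sub>R r) - u ((y - a) /\<^sub>R r))"
    using r by (simp add: scaleR_diff_right[symmetric])
  also have "\<dots> \<le> r * (A * norm ((x - y) /\<^sub>R r) powr \<alpha>)"
    unfolding d[symmetric] using r by (intro mult_left_mono holder_onD[OF u]) auto
  also have "norm ((x - y) /\<^sub>R r) powr \<alpha> = norm (x - y) powr \<alpha> * r powr (- \<alpha>)"
  proof -
    have "norm ((x - y) /\<^sub>R r) = norm (x - y) / r"
      using r by (simp only: norm_scaleR) (simp add: divide_inverse mult.commute)
    moreover have "(norm (x - y) / r) powr \<alpha> = norm (x - y) powr \<alpha> / r powr \<alpha>"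
      using r by (simp add: powr_divide)
    ultimately show ?thesis by (simp only: powr_minus divide_inverse)
  qed
  also have "r * (A * (norm (x - y) powr \<alpha> * r powr (- \<alpha>))) = A * (r * r powr (- \<alpha>)) * norm (x - y) powr \<alpha>"
    by (simp add: mult_ac)
  also have "r * r powr (- \<alpha>) = r powr (1 - \<alpha>)"
    using r by (simp add: powr_diff powr_minus divide_inverse)
  finally show "norm (r *\<^sub>R u ((x - a) /\<^sub>R r) - r *\<^sub>R u ((y - a) /\<^sub>R r)) \<le> A * r powr (1 - \<alpha>) * norm (x - y) powr \<alpha>" .
qed

text \<open>
  If \<open>x\<close> and \<open>y\<close> lie in different balls, then each of the two functions involved vanishes at one of the points; so the
  difference of the sums is a sum of two differences, each of a single function.
\<close>

lemma holder_on_disjoint_sum: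
  fixes u :: "nat \<Rightarrow> real^'m \<Rightarrow> real^'d"
  assumes u: "\<And>k. holder_on (\<delta> / 2) \<alpha> UNIV (u k)" and z: "\<And>k x. x \<notin> B k \<Longrightarrow> u k x = 0" and dj: "disjoint_family B"
    and \<delta>: "\<delta> \<ge> 0"
  shows "holder_on \<delta> \<alpha> UNIV (\<lambda>x. \<Sum>k. u k x)"
proof -
  have single: "(\<Sum>k. u k x) = u k x" if "x \<in> B k" for k x
  proof -
    have "u l x = 0" if "l \<noteq> k" for l
      using dj that \<open>x \<in> B k\<close> by (intro z) (auto simp: disjoint_family_on_def)
    then show ?thesis using suminf_finite[of "{k}" "\<lambda>k. u k x"] by simp
  qed
  have none: "(\<Sum>k. u k x) = 0" if "x \<notin> (\<Union>k. B k)" for x using that z by simp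
  have half: "norm (u k x - u k y) \<le> \<delta> / 2 * norm (x - y) powr \<alpha>" for k x y
    using holder_onD[OF u] by simp
  have pos: "0 \<le> \<delta> / 2 * norm (x - y) powr \<alpha>" for x y :: "real^'m" using \<delta> by simp
  have le: "norm (v - v') \<le> \<delta> * norm (x - y) powr \<alpha>"
    if "v - v' = p + q" "norm p \<le> \<delta> / 2 * norm (x - y) powr \<alpha>" "norm q \<le> \<delta> / 2 * norm (x - y) powr \<alpha>"
    for v v' p q :: "real^'d" and x y :: "real^'m"
    using that norm_triangle_ineq[of p q] by simp
  show ?thesis unfolding holder_on_def
  proof (intro ballI)
    fix x y :: "real^'m"
    consider k l where "x \<in> B k" "y \<in> B l" "k \<noteq> l" | k where "x \<in> B k" "y \<in> B k"
      | k where "x \<in> B k" "y \<notin> (\<Union>k. B k)" | k where "y \<in> B k" "x \<notin> (\<Union>k. B k)"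
      | "x \<notin> (\<Union>k. B k)" "y \<notin> (\<Union>k. B k)" by blast
    then show "norm ((\<Sum>k. u k x) - (\<Sum>k. u k y)) \<le> \<delta> * norm (x - y) powr \<alpha>"
    proof cases
      case (1 k l)
      have "u k y = 0" "u l x = 0" using 1 dj by (auto intro!: z simp: disjoint_family_on_def)
      then show ?thesis
        using 1 by (intro le[of _ _ "u k x - u k y" "u l x - u l y"] half) (simp add: single)
    next
      case (2 k)
      then show ?thesis by (intro le[of _ _ "u k x - u k y" 0] half) (use pos in \<open>auto simp: single\<close>)
    next
      case (3 k)
      have "u k y = 0" using 3 by (intro z) auto
      then show ?thesis using 3 by (intro le[of _ _ "u k x - u k y" 0] half) (use pos in \<open>auto simp: single none\<close>)
    next
      case (4 k)
      have "u k x = 0" using 4 by (intro z) auto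
      then show ?thesis using 4 by (intro le[of _ _ "u k x - u k y" 0] half) (use pos in \<open>auto simp: single none\<close>)
    next
      case 5
      then show ?thesis using \<delta> by (simp add: none)
    qed
  qed
qed

text \<open>
  Fill \<open>V\<close> with balls that are so small that \<open>G\<close> is constant and \<open>w\<close> is affine on each of them, and that
  the scaled cell for this gradient has Hoelder constant at most \<open>\<delta>/2\<close>. Adding the scaled cells
  replaces the gradient on a ball by the rescaled gradient of the cell. Every estimate for the unit ball
  then carries over to each ball with the same constants, with the weight of \<open>G\<close> being constant on the ball, and the
  estimates are summed over the balls.
\<close>

lemma reduction_step_exists:
  fixes U K :: "(real^'m^'d) set" and w :: "real^'m \<Rightarrow> real^'d"
  assumes cells: "\<forall>X\<in>U. \<exists>A u H \<G> \<B>. cell U K \<alpha> p M c \<epsilon> X A u H \<G> \<B>"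
    and p: "1 < p" and M: "M \<ge> 0" and \<alpha>: "0 < \<alpha>" "\<alpha> < 1" and \<epsilon>: "0 < \<epsilon>" and \<delta>: "0 < \<delta>"
    and st: "affine_state U V w G" and Gm[measurable]: "G \<in> borel_measurable lebesgue"
    and fin: "energy p V G < \<infinity>"
  shows "\<exists>V' w' G' \<G>'. reduction_step U K \<alpha> p M (1 + M * weak_type_const p) c \<epsilon> \<delta> V w G V' w' G' \<G>'"
proof -
  let ?L = "1 + M * weak_type_const p"
  let ?ub = "unit_ball :: (real^'m) set"
  have Vo: "open V" using st by (simp add: affine_state_def)
  have Vm[measurable]: "V \<in> sets lebesgue" using Vo by simp
  have GU: "G x \<in> U" if "x \<in> V" for x using st that by (auto simp: affine_state_def)
  obtain A u H \<G> \<B> where cell: "\<And>X. X \<in> U \<Longrightarrow> cell U K \<alpha> p M c \<epsilon> X (A X) (u X) (H X) (\<G> X) (\<B> X)"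
    using cells by metis
  \<comment> \<open>the last two requirements make the scaled cell small, both in the Hoelder seminorm and in the supremum\<close>
  define P where "P x r \<longleftrightarrow> ball x r \<subseteq> V \<and> (\<exists>b. \<forall>y\<in>ball x r. G y = G x \<and> w y = G x *v y + b) \<and>
      r \<le> 1 \<and> A (G x) * r powr (1 - \<alpha>) \<le> \<delta> / 2" for x r
  have small: "\<exists>d>0. \<forall>r. 0 < r \<longrightarrow> r < d \<longrightarrow> P x r" if x: "x \<in> V" for x
    unfolding P_def
    by (rule affine_state_small_ball[OF st x \<alpha>(2)]) (use \<delta> cell[OF GU[OF x]] in \<open>auto simp: cell_def\<close>)
  obtain a r where dj: "disjoint_family (\<lambda>k. ball (a k) (r k))"
    and r0: "\<And>k. r k \<ge> 0" and Pk: "\<And>k. r k > 0 \<Longrightarrow> a k \<in> V \<and> P (a k) (r k)"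
    and Bsub: "(\<Union>k::nat. ball (a k) (r k)) \<subseteq> V" and Bnull: "V - (\<Union>k. ball (a k) (r k)) \<in> null_sets lebesgue"
  proof (rule Vitali_ball_filling[of V P, OF small])
    show "P x r \<Longrightarrow> ball x r \<subseteq> V" for x r by (simp add: P_def)
  qed blast+
  define B where "B k = ball (a k) (r k)" for k
  define X where "X k = G (a k)" for k
  define I where "I k x = (x - a k) /\<^sub>R r k" for k x
  define T where "T k y = a k + r k *\<^sub>R y" for k y
  have dj': "disjoint_family B" using dj by (simp add: B_def[abs_def])
  have B_uniq: "k = l" if "x \<in> B k" "x \<in> B l" for k l x
    using dj' that by (auto simp: disjoint_family_on_def)
  have Bm[measurable]: "B k \<in> sets lebesgue" for k by (simp add: B_def)
  have BV: "B k \<subseteq> V" for k using Bsub by (auto simp: B_def)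
  have BUm[measurable]: "(\<Union>k. B k) \<in> sets lebesgue" by measurable
  have nullB: "V - (\<Union>k. B k) \<in> null_sets lebesgue" using Bnull by (simp add: B_def)
  have rB: "r k > 0" if "x \<in> B k" for k x using that by (auto simp: B_def intro: le_less_trans[OF zero_le_dist])
  have B0: "B k = {}" if "\<not> r k > 0" for k using that by (auto simp: B_def)
  have XU: "X k \<in> U" if "r k > 0" for k using GU Pk[OF that] by (simp add: X_def)
  have GX: "G x = X k" if "x \<in> B k" for k x
    using Pk[OF rB[OF that]] that by (auto simp: P_def B_def X_def)
  have "\<exists>b. \<forall>k. r k > 0 \<longrightarrow> (\<forall>x\<in>B k. w x = X k *v x + b k)"
    using Pk unfolding P_def B_def X_def by (intro choice) blast
  then obtain b where wX': "\<forall>k. r k > 0 \<longrightarrow> (\<forall>x\<in>B k. w x = X k *v x + b k)" ..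
  have wX: "w x = X k *v x + b k" if "x \<in> B k" for k x using wX' rB[OF that] that by blast
  have I_mem: "I k x \<in> ?ub \<longleftrightarrow> x \<in> B k" if "r k > 0" for k x
    unfolding I_def B_def by (rule mem_ball_affine[OF that])
  have T_mem: "x \<in> T k ` S \<longleftrightarrow> I k x \<in> S" if "r k > 0" for k x S
    unfolding I_def T_def using that by (intro mem_affine_image) simp
  note C = cell[OF XU, unfolded cell_def]
  have A0: "A (X k) \<ge> 0" and uh: "holder_on (A (X k)) \<alpha> UNIV (u (X k))"
    and uz: "\<And>x. x \<notin> ?ub \<Longrightarrow> u (X k) x = 0"
    and wp: "weak_pair (u (X k)) (\<lambda>x. indicator ?ub x *\<^sub>R (H (X k) x - X k))"
    and Hm: "H (X k) \<in> borel_measurable lebesgue"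
    and Cc: "countable (\<G> (X k))" "countable (\<B> (X k))" "disjoint (\<G> (X k) \<union> \<B> (X k))" "\<G> (X k) \<inter> \<B> (X k) = {}"
    and Cr: "\<And>S. S \<in> \<G> (X k) \<union> \<B> (X k) \<Longrightarrow> regular_domain S \<and> S \<subseteq> ?ub"
    and Cn: "?ub - \<Union>(\<G> (X k) \<union> \<B> (X k)) \<in> null_sets lebesgue"
    and CG: "\<And>S. S \<in> \<G> (X k) \<Longrightarrow> \<exists>Y\<in>K. \<exists>b. \<forall>x\<in>S. H (X k) x = Y \<and> X k *v x + u (X k) x = Y *v x + b"
    and CB: "\<And>S. S \<in> \<B> (X k) \<Longrightarrow> \<exists>Y\<in>U. \<exists>b. \<forall>x\<in>S. H (X k) x = Y \<and> X k *v x + u (X k) x = Y *v x + b"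
    and Cup: "\<And>t. t > 0 \<Longrightarrow> emeasure lebesgue {x\<in>?ub. norm (H (X k) x) > t}
        \<le> ennreal (t powr (- p)) * (ennreal (M * (1 + norm (X k)) powr p) * emeasure lebesgue ?ub)"
    and Cbad: "(\<integral>\<^sup>+x\<in>\<Union>(\<B> (X k)). ennreal ((1 + norm (H (X k) x)) powr p) \<partial>lebesgue) \<le> ennreal \<epsilon> * emeasure lebesgue ?ub"
    and Clow: "\<And>t. t > 1 \<Longrightarrow> emeasure lebesgue {x\<in>\<Union>(\<G> (X k)). norm (H (X k) x) > t}
        \<ge> ennreal ((c - \<epsilon>) * t powr (- p)) * emeasure lebesgue ?ub"
    if "r k > 0" for k
    using C[OF that] by (simp_all only: simp_thms)
  have Cint: "(\<integral>\<^sup>+x\<in>?ub. ennreal (norm (H (X k) x - X k)) \<partial>lebesgue)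
    \<le> ennreal (?L * (1 + norm (X k)) powr p) * emeasure lebesgue ?ub" if "r k > 0" for k
    by (rule cell_gradient_integral[OF cell[OF XU[OF that]] p M])
  define D where "D k x = (if r k > 0 then r k *\<^sub>R u (X k) (I k x) else 0)" for k x
  define g where "g k x = (if r k > 0 then indicator ?ub (I k x) *\<^sub>R (H (X k) (I k x) - X k) else 0)" for k x
  \<comment> \<open>the balls are disjoint, so at every point at most one summand is nonzero\<close>
  define w' where "w' x = w x + (\<Sum>k. D k x)" for x
  define G' where "G' x = G x + (\<Sum>k. g k x)" for x
  have D0: "D k x = 0" and g0: "g k x = 0" if "x \<notin> B k" for k x
    using that uz[of k "I k x"] I_mem[of k x] by (auto simp: D_def g_def)
  have others: "l \<noteq> k \<Longrightarrow> x \<notin> B l" if "x \<in> B k" for k l x using B_uniq that by blast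
  have Dsum: "(\<Sum>l. D l x) = D k x" and gsum: "(\<Sum>l. g l x) = g k x" if "x \<in> B k" for k x
    using suminf_finite[of "{k}" "\<lambda>l. D l x"] suminf_finite[of "{k}" "\<lambda>l. g l x"] others[OF that]
    by (auto simp: D0 g0)
  have off: "(\<Sum>l. D l x) = 0" "(\<Sum>l. g l x) = 0" if "x \<notin> (\<Union>k. B k)" for x
    using that by (auto simp: D0 g0)
  have w'B: "w' x = X k *v x + b k + r k *\<^sub>R u (X k) (I k x)" if "x \<in> B k" for k x
    unfolding w'_def Dsum[OF that] wX[OF that] D_def[of k] using rB[OF that] by simp
  have G'B: "G' x = H (X k) (I k x)" if "x \<in> B k" for k x
    unfolding G'_def gsum[OF that] GX[OF that] g_def[of k] using rB[OF that] I_mem[of k x] that by simp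
  have Dh: "holder_on (\<delta> / 2) \<alpha> UNIV (D k)" for k
  proof (cases "r k > 0")
    case True
    have "holder_on (A (X k) * r k powr (1 - \<alpha>)) \<alpha> UNIV (\<lambda>x. r k *\<^sub>R u (X k) ((x - a k) /\<^sub>R r k))"
      by (rule holder_on_scale[OF uh[OF True] True])
    moreover have "A (X k) * r k powr (1 - \<alpha>) \<le> \<delta> / 2" using Pk[OF True] by (simp add: P_def X_def)
    moreover have "D k = (\<lambda>x. r k *\<^sub>R u (X k) ((x - a k) /\<^sub>R r k))" using True by (simp add: D_def[abs_def] I_def)
    ultimately show ?thesis unfolding holder_on_def by (metis (no_types, lifting) mult_right_mono order_trans powr_ge_zero)
  qed (use \<delta> in \<open>simp add: D_def[abs_def] holder_on_def\<close>)
  have Dle: "norm (D k x) \<le> \<delta> / 2" for k x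
  proof (cases "x \<in> B k")
    case True
    note rk = rB[OF True]
    have y: "norm (I k x) \<le> 1" using I_mem[OF rk, of x] True by simp
    have "norm (u (X k) (I k x)) \<le> A (X k) * (1 - norm (I k x)) powr \<alpha>"
      by (rule holder_on_near_sphere[OF uh[OF rk] uz[OF rk] y])
    also have "\<dots> \<le> A (X k) * 1"
      using y \<alpha> by (intro mult_left_mono A0[OF rk] powr_le1) auto
    finally have "norm (D k x) \<le> r k * A (X k)" using rk by (simp add: D_def)
    also have "r k * A (X k) \<le> r k powr (1 - \<alpha>) * A (X k)"
    proof (rule mult_right_mono[OF _ A0[OF rk]])
      have "r k \<le> 1" using Pk[OF rk] by (simp add: P_def)
      then have "r k powr 1 \<le> r k powr (1 - \<alpha>)" using rk \<alpha> by (intro powr_mono') auto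
      then show "r k \<le> r k powr (1 - \<alpha>)" using rk by simp
    qed
    also have "\<dots> \<le> \<delta> / 2" using Pk[OF rk] by (simp add: P_def X_def mult.commute)
    finally show ?thesis .
  qed (use \<delta> in \<open>simp add: D0\<close>)
  \<comment> \<open>an estimate for the cells becomes an estimate on \<open>V\<close> by rescaling and summation\<close>
  have wt: "energy p (B k) G = ennreal ((1 + norm (X k)) powr p) * (ennreal (r k ^ CARD('m)) * emeasure lebesgue ?ub)"
    if rk: "r k > 0" for k
  proof -
    have "energy p (B k) G = (\<integral>\<^sup>+x. ennreal ((1 + norm (X k)) powr p) * indicator (B k) x \<partial>lebesgue)"
      by (rule nn_integral_cong) (use GX in \<open>auto simp: weight_def indicator_def\<close>)
    also have "\<dots> = ennreal ((1 + norm (X k)) powr p) * emeasure lebesgue (B k)"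
      by (simp add: nn_integral_cmult_indicator)
    finally show ?thesis unfolding B_def emeasure_ball_affine[OF rk] .
  qed
  have resc: "(\<integral>\<^sup>+x\<in>B k. F (I k x) \<partial>lebesgue) = ennreal (r k ^ CARD('m)) * (\<integral>\<^sup>+y\<in>?ub. F y \<partial>lebesgue)"
    if "F \<in> borel_measurable lebesgue" "r k > 0" for F k
    unfolding B_def I_def by (rule nn_integral_ball_affine[OF that])
  have V_eq: "(\<integral>\<^sup>+x\<in>V. f x \<partial>lebesgue) = (\<integral>\<^sup>+x\<in>(\<Union>k. B k). f x \<partial>lebesgue)" for f
  proof (rule nn_integral_cong_AE)
    show "AE x in lebesgue. f x * indicator V x = f x * indicator (\<Union>k. B k) x"
      using AE_not_in[OF nullB] by eventually_elim (use BV in \<open>auto simp: indicator_def\<close>)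
  qed
  have wm[measurable]: "weight p G \<in> borel_measurable lebesgue" unfolding weight_def[abs_def] by measurable
  have mono: "(\<integral>\<^sup>+x\<in>V. f x \<partial>lebesgue) \<le> C * energy p V G"
    if f[measurable]: "f \<in> borel_measurable lebesgue"
      and F: "\<And>k x. x \<in> B k \<Longrightarrow> f x = F k (I k x)" "\<And>k. r k > 0 \<Longrightarrow> F k \<in> borel_measurable lebesgue"
      and le: "\<And>k. r k > 0 \<Longrightarrow> (\<integral>\<^sup>+y\<in>?ub. F k y \<partial>lebesgue) \<le> C * (ennreal ((1 + norm (X k)) powr p) * emeasure lebesgue ?ub)"
    for f F C
  proof -
    have "(\<integral>\<^sup>+x\<in>B k. f x \<partial>lebesgue) \<le> (\<integral>\<^sup>+x\<in>B k. C * weight p G x \<partial>lebesgue)" for k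
    proof (cases "r k > 0")
      case True
      have "(\<integral>\<^sup>+x\<in>B k. f x \<partial>lebesgue) = (\<integral>\<^sup>+x\<in>B k. F k (I k x) \<partial>lebesgue)"
        by (rule nn_integral_cong) (use F(1) in \<open>auto simp: indicator_def\<close>)
      also have "\<dots> = ennreal (r k ^ CARD('m)) * (\<integral>\<^sup>+y\<in>?ub. F k y \<partial>lebesgue)" by (rule resc[OF F(2)[OF True] True])
      also have "\<dots> \<le> ennreal (r k ^ CARD('m)) * (C * (ennreal ((1 + norm (X k)) powr p) * emeasure lebesgue ?ub))"
        by (intro mult_left_mono le True) simp
      also have "\<dots> = C * energy p (B k) G" unfolding wt[OF True] by (simp only: mult_ac)
      also have "\<dots> = (\<integral>\<^sup>+x\<in>B k. C * weight p G x \<partial>lebesgue)"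
        by (simp add: nn_integral_cmult[symmetric] mult.assoc)
      finally show ?thesis .
    qed (simp add: B0)
    then have "(\<integral>\<^sup>+x\<in>(\<Union>k. B k). f x \<partial>lebesgue) \<le> (\<integral>\<^sup>+x\<in>(\<Union>k. B k). C * weight p G x \<partial>lebesgue)"
      by (intro nn_integral_UN_disjoint_mono dj' Bm) auto
    also have "\<dots> = C * (\<integral>\<^sup>+x\<in>(\<Union>k. B k). weight p G x \<partial>lebesgue)"
      by (simp add: nn_integral_cmult[symmetric] mult.assoc)
    finally show ?thesis by (simp only: V_eq)
  qed
  have wpk: "weak_pair (D k) (g k)" for k
  proof (cases "r k > 0")
    case True
    then show ?thesis
      using weak_pair_scale[OF wp[OF True] True, of "a k"] by (simp add: D_def[abs_def] g_def[abs_def] I_def)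
  qed (simp add: D_def[abs_def] g_def[abs_def] weak_pair_zero)
  have Dm[measurable]: "D k \<in> borel_measurable lebesgue" and gm[measurable]: "g k \<in> borel_measurable lebesgue" for k
    using wpk[of k] by (auto simp: weak_pair_def)
  have Vfin: "emeasure lebesgue V < \<infinity>"
  proof -
    have "emeasure lebesgue V = (\<integral>\<^sup>+x. indicator V x \<partial>lebesgue)" by simp
    also have "\<dots> \<le> energy p V G"
      using p by (intro nn_integral_mono) (auto simp: indicator_def weight_def ennreal_ge_1 intro!: ge_one_powr_ge_zero)
    finally show ?thesis using fin by (rule le_less_trans)
  qed
  have gint: "(\<integral>\<^sup>+x. norm (g k x) \<partial>lebesgue) \<le> ennreal ?L * energy p (B k) G" for k
  proof (cases "r k > 0")
    case True
    have [measurable]: "H (X k) \<in> borel_measurable lebesgue" by (rule Hm[OF True])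
    have "(\<integral>\<^sup>+x. norm (g k x) \<partial>lebesgue) = (\<integral>\<^sup>+x\<in>B k. ennreal (norm (H (X k) (I k x) - X k)) \<partial>lebesgue)"
      by (rule nn_integral_cong) (use True I_mem[OF True] in \<open>auto simp: g_def indicator_def\<close>)
    also have "\<dots> = ennreal (r k ^ CARD('m)) * (\<integral>\<^sup>+y\<in>?ub. ennreal (norm (H (X k) y - X k)) \<partial>lebesgue)"
      by (rule resc[OF _ True]) measurable
    also have "\<dots> \<le> ennreal (r k ^ CARD('m)) * (ennreal (?L * (1 + norm (X k)) powr p) * emeasure lebesgue ?ub)"
      by (intro mult_left_mono Cint True) simp
    also have "\<dots> = ennreal ?L * energy p (B k) G"
      unfolding wt[OF True] using M weak_type_const_nonneg[OF p] by (simp add: ennreal_mult' mult_ac)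
    finally show ?thesis .
  qed (simp add: g_def)
  have gint_sum: "(\<Sum>k. \<integral>\<^sup>+x. norm (g k x) \<partial>lebesgue) \<le> ennreal ?L * energy p V G"
  proof -
    have "(\<Sum>k. \<integral>\<^sup>+x. norm (g k x) \<partial>lebesgue) \<le> (\<Sum>k. ennreal ?L * energy p (B k) G)"
      by (intro suminf_le gint summableI)
    also have "\<dots> = ennreal ?L * energy p V G"
      unfolding V_eq by (simp add: nn_integral_UN_disjoint[OF wm Bm dj'])
    finally show ?thesis .
  qed
  have WP: "weak_pair (\<lambda>x. \<Sum>k. D k x) (\<lambda>x. \<Sum>k. g k x)"
  proof (rule weak_pair_series[OF wpk])
    have "(\<integral>\<^sup>+x. norm (D k x) \<partial>lebesgue) \<le> ennreal (\<delta> / 2) * emeasure lebesgue (B k)" for k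
    proof -
      have "(\<integral>\<^sup>+x. norm (D k x) \<partial>lebesgue) \<le> (\<integral>\<^sup>+x. ennreal (\<delta> / 2) * indicator (B k) x \<partial>lebesgue)"
        by (rule nn_integral_mono) (use Dle D0 in \<open>auto simp: indicator_def intro!: ennreal_leI\<close>)
      then show ?thesis by (simp add: nn_integral_cmult_indicator)
    qed
    then have "(\<Sum>k. \<integral>\<^sup>+x. norm (D k x) \<partial>lebesgue) \<le> (\<Sum>k. ennreal (\<delta> / 2) * emeasure lebesgue (B k))"
      by (intro suminf_le summableI)
    also have "\<dots> = ennreal (\<delta> / 2) * emeasure lebesgue (\<Union>k. B k)"
    proof -
      have "range B \<subseteq> sets lebesgue" using Bm by blast
      then have "(\<Sum>k. emeasure lebesgue (B k)) = emeasure lebesgue (\<Union>k. B k)"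
        by (rule suminf_emeasure[OF _ dj'])
      then show ?thesis by (simp only: ennreal_suminf_cmult)
    qed
    also have "\<dots> \<le> ennreal (\<delta> / 2) * emeasure lebesgue V"
      using BV by (intro mult_left_mono emeasure_mono Vm) auto
    also have "\<dots> < \<infinity>" using Vfin by (simp add: ennreal_mult_less_top)
    finally show "(\<Sum>k. \<integral>\<^sup>+x. norm (D k x) \<partial>lebesgue) < \<infinity>" .
    show "(\<Sum>k. \<integral>\<^sup>+x. norm (g k x) \<partial>lebesgue) < \<infinity>"
      by (rule le_less_trans[OF gint_sum]) (use fin in \<open>simp add: ennreal_mult_less_top\<close>)
  qed
  have gsm: "(\<lambda>x. \<Sum>k. g k x) \<in> borel_measurable lebesgue" using WP by (auto simp: weak_pair_def)
  have G'm[measurable]: "G' \<in> borel_measurable lebesgue"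
    unfolding G'_def[abs_def] using gsm by measurable
  define piece where "piece \<S> = {T k ` S |k S. r k > 0 \<and> S \<in> \<S> (X k)}" for \<S> :: "real^'m^'d \<Rightarrow> (real^'m) set set"
  define V' where "V' = \<Union>(piece \<B>)"
  define \<G>' where "\<G>' = piece \<G>"
  have TB: "T k ` S \<subseteq> B k" if "r k > 0" "S \<in> \<G> (X k) \<union> \<B> (X k)" for k S
    using Cr[OF that] T_mem[OF that(1)] I_mem[OF that(1)] by blast
  have Treg: "regular_domain (T k ` S)" if "r k > 0" "S \<in> \<G> (X k) \<union> \<B> (X k)" for k S
    unfolding T_def[abs_def] using Cr[OF that] that(1) by (intro regular_domain_affine_image) auto
  have affine_piece: "\<exists>Y\<in>W. \<exists>b'. \<forall>x\<in>T k ` S. G' x = Y \<and> w' x = Y *v x + b'"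
    if rk: "r k > 0" and S: "S \<in> \<G> (X k) \<union> \<B> (X k)"
      and Y: "\<exists>Y\<in>W. \<exists>b. \<forall>y\<in>S. H (X k) y = Y \<and> X k *v y + u (X k) y = Y *v y + b" for k S W
  proof -
    obtain Y b' where Y: "Y \<in> W" "\<And>y. y \<in> S \<Longrightarrow> H (X k) y = Y" "\<And>y. y \<in> S \<Longrightarrow> X k *v y + u (X k) y = Y *v y + b'"
      using Y by blast
    show ?thesis
    proof (intro bexI[OF _ Y(1)] exI ballI conjI)
      fix x assume x: "x \<in> T k ` S"
      then have xB: "x \<in> B k" using TB[OF rk S] by blast
      have y: "I k x \<in> S" using x T_mem[OF rk] by blast
      show "G' x = Y" using G'B[OF xB] Y(2)[OF y] by simp
      have xI: "x = a k + r k *\<^sub>R I k x" using rk by (simp add: I_def)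
      have uy: "u (X k) (I k x) = Y *v I k x + b' - X k *v I k x" using Y(3)[OF y] by (simp add: algebra_simps)
      have mv: "Z *v x = Z *v a k + r k *\<^sub>R (Z *v I k x)" for Z :: "real^'m^'d"
        by (subst xI) (simp add: matrix_vector_right_distrib matrix_vector_mult_scaleR)
      show "w' x = Y *v x + (X k *v a k - Y *v a k + b k + r k *\<^sub>R b')"
        unfolding w'B[OF xB] uy mv[of "X k"] mv[of Y] by (simp add: algebra_simps)
    qed
  qed
  have V'_mem: "x \<in> V' \<longleftrightarrow> I k x \<in> \<Union>(\<B> (X k))" and G'_mem: "x \<in> \<Union>\<G>' \<longleftrightarrow> I k x \<in> \<Union>(\<G> (X k))" if xB: "x \<in> B k" for k x
  proof -
    have *: "x \<in> \<Union>(piece \<S>) \<longleftrightarrow> I k x \<in> \<Union>(\<S> (X k))" if sub: "\<And>X. \<S> X \<subseteq> \<G> X \<union> \<B> X" for \<S>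
    proof
      assume "x \<in> \<Union>(piece \<S>)"
      then obtain l S where l: "r l > 0" "S \<in> \<S> (X l)" "x \<in> T l ` S" by (auto simp: piece_def)
      have "S \<in> \<G> (X l) \<union> \<B> (X l)" using l(2) sub by blast
      then have "x \<in> B l" using TB[OF l(1)] l(3) by blast
      then have "l = k" using B_uniq xB by blast
      then show "I k x \<in> \<Union>(\<S> (X k))" using l T_mem[OF l(1)] by blast
    next
      assume "I k x \<in> \<Union>(\<S> (X k))"
      then obtain S where S: "S \<in> \<S> (X k)" "I k x \<in> S" by blast
      then have "x \<in> T k ` S" using T_mem[OF rB[OF xB]] by blast
      then show "x \<in> \<Union>(piece \<S>)" using S(1) rB[OF xB] unfolding piece_def by blast
    qed
    show "x \<in> V' \<longleftrightarrow> I k x \<in> \<Union>(\<B> (X k))" unfolding V'_def by (rule *) blast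
    show "x \<in> \<Union>\<G>' \<longleftrightarrow> I k x \<in> \<Union>(\<G> (X k))" unfolding \<G>'_def by (rule *) blast
  qed
  have subB: "V' \<subseteq> (\<Union>k. B k)" "\<Union>\<G>' \<subseteq> (\<Union>k. B k)"
    using TB unfolding V'_def \<G>'_def piece_def by blast+
  have opn: "open (\<Union>(\<B> (X k)))" "open (\<Union>(\<G> (X k)))" if "r k > 0" for k
    using Cr[OF that] by (auto intro!: open_Union simp: regular_domain_def)
  have opnm: "\<Union>(\<B> (X k)) \<in> sets lebesgue" "\<Union>(\<G> (X k)) \<in> sets lebesgue" if "r k > 0" for k
    using opn[OF that] by simp_all
  have V'o: "open V'" unfolding V'_def
    using Treg by (intro open_Union) (auto simp: piece_def regular_domain_def)
  have G'o: "open (\<Union>\<G>')" unfolding \<G>'_def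
    using Treg by (intro open_Union) (auto simp: piece_def regular_domain_def)
  have V'm[measurable]: "V' \<in> sets lebesgue" and G'sm[measurable]: "\<Union>\<G>' \<in> sets lebesgue" using V'o G'o by simp_all
  have ub_sub: "\<Union>(\<B> (X k)) \<subseteq> ?ub" "\<Union>(\<G> (X k)) \<subseteq> ?ub" if "r k > 0" for k
    using Cr[OF that] by blast+
  show ?thesis
  proof (intro exI)
    show "reduction_step U K \<alpha> p M ?L c \<epsilon> \<delta> V w G V' w' G' \<G>'"
      unfolding reduction_step_def
    proof (intro conjI)
      show "affine_state U V' w' G'"
        unfolding affine_state_def
      proof (intro conjI V'o ballI)
        fix x assume "x \<in> V'"
        then obtain k S where k: "r k > 0" "S \<in> \<B> (X k)" "x \<in> T k ` S" by (auto simp: V'_def piece_def)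
        obtain Y b' where Y: "Y \<in> U" "\<forall>x\<in>T k ` S. G' x = Y \<and> w' x = Y *v x + b'"
          using affine_piece[OF k(1) _ CB[OF k(1,2)]] k(2) by blast
        have Gx: "G' x = Y" using Y(2) k(3) by blast
        show "G' x \<in> U" unfolding Gx by (rule Y(1))
        have "open (T k ` S)" using Treg[OF k(1)] k(2) by (simp add: regular_domain_def)
        then obtain d where d: "d > 0" "ball x d \<subseteq> T k ` S" using k(3) by (rule openE)
        have "T k ` S \<subseteq> V'" using k unfolding V'_def piece_def by blast
        then show "\<exists>d>0. ball x d \<subseteq> V' \<and> (\<exists>b. \<forall>y\<in>ball x d. G' y = G' x \<and> w' y = G' x *v y + b)"
          unfolding Gx using d Y(2) by (intro exI[of _ d] conjI exI[of _ b']) blast+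
      qed
      show "V' \<subseteq> V" using subB(1) BV by blast
      show "G' \<in> borel_measurable lebesgue" by fact
      show "weak_pair (\<lambda>x. w' x - w x) (\<lambda>x. G' x - G x)" using WP by (simp add: w'_def G'_def)
      show "\<forall>x. x \<notin> V \<longrightarrow> w' x = w x \<and> G' x = G x"
      proof (intro allI impI)
        fix x assume "x \<notin> V"
        then have "x \<notin> (\<Union>k. B k)" using BV by blast
        then show "w' x = w x \<and> G' x = G x" using off by (simp add: w'_def G'_def)
      qed
      show "holder_on \<delta> \<alpha> UNIV (\<lambda>x. w' x - w x)"
        using holder_on_disjoint_sum[OF Dh D0 dj'] \<delta> by (simp add: w'_def)
      show "\<forall>x. norm (w' x - w x) \<le> \<delta>"
      proof
        fix x
        have "norm (\<Sum>k. D k x) \<le> \<delta> / 2" using Dsum off(1) Dle \<delta> by (cases "x \<in> (\<Union>k. B k)") auto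
        then show "norm (w' x - w x) \<le> \<delta>" using \<delta> by (simp add: w'_def)
      qed
      show "countable \<G>'"
      proof -
        have "\<G>' = (\<Union>k\<in>{k. r k > 0}. (`) (T k) ` \<G> (X k))" by (auto simp: \<G>'_def piece_def)
        moreover have "countable \<dots>" using Cc(1) by (intro countable_UN countable_image) auto
        ultimately show ?thesis by simp
      qed
      show "disjoint \<G>'" unfolding disjoint_def
      proof (intro ballI impI)
        fix S1 S2 assume "S1 \<in> \<G>'" "S2 \<in> \<G>'" and ne: "S1 \<noteq> S2"
        then obtain k R l R' where k: "r k > 0" "R \<in> \<G> (X k)" "S1 = T k ` R" and l: "r l > 0" "R' \<in> \<G> (X l)" "S2 = T l ` R'"
          unfolding \<G>'_def piece_def by blast
        show "S1 \<inter> S2 = {}"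
        proof (rule ccontr)
          assume "S1 \<inter> S2 \<noteq> {}"
          then obtain x where x: "x \<in> T k ` R" "x \<in> T l ` R'" using k l by blast
          have "x \<in> B k" "x \<in> B l" using x TB[OF k(1)] TB[OF l(1)] k(2) l(2) by blast+
          then have kl: "k = l" by (rule B_uniq)
          have "I k x \<in> R \<inter> R'" using x T_mem[OF k(1)] kl by blast
          then have "R = R'" using Cc(3)[OF k(1)] k(2) l(2) kl unfolding disjoint_def by blast
          then show False using ne k l kl by simp
        qed
      qed
      show "\<forall>S\<in>\<G>'. regular_domain S \<and> S \<subseteq> V \<and> S \<inter> V' = {}"
      proof
        fix S assume "S \<in> \<G>'"
        then obtain k R where k: "r k > 0" "R \<in> \<G> (X k)" "S = T k ` R" unfolding \<G>'_def piece_def by blast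
        have SB: "S \<subseteq> B k" using TB k by blast
        have "x \<notin> V'" if x: "x \<in> S" for x
        proof
          assume "x \<in> V'"
          then have "I k x \<in> \<Union>(\<B> (X k))" using V'_mem[of x k] SB x by blast
          then obtain R' where R': "R' \<in> \<B> (X k)" "I k x \<in> R'" by blast
          have "I k x \<in> R" using x k T_mem[OF k(1)] by blast
          then have "R = R'" using Cc(3)[OF k(1)] k(2) R' unfolding disjoint_def by blast
          then show False using Cc(4)[OF k(1)] k(2) R'(1) by blast
        qed
        then show "regular_domain S \<and> S \<subseteq> V \<and> S \<inter> V' = {}" using Treg k SB BV by blast
      qed
      show "V - (\<Union>\<G>' \<union> V') \<in> null_sets lebesgue"
      proof (rule null_sets_subset)
        let ?N = "(V - (\<Union>k. B k)) \<union> (\<Union>k. if r k > 0 then T k ` (?ub - \<Union>(\<G> (X k) \<union> \<B> (X k))) else {})"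
        show "?N \<in> null_sets lebesgue"
          using Cn unfolding T_def[abs_def]
          by (intro null_sets.Un nullB null_sets_UN) (auto intro!: null_sets_affine_image)
        show "V - (\<Union>\<G>' \<union> V') \<in> sets lebesgue" by measurable
        show "V - (\<Union>\<G>' \<union> V') \<subseteq> ?N"
        proof
          fix x assume x: "x \<in> V - (\<Union>\<G>' \<union> V')"
          show "x \<in> ?N"
          proof (cases "x \<in> (\<Union>k. B k)")
            case True
            then obtain k where k: "x \<in> B k" by blast
            have "I k x \<in> ?ub - \<Union>(\<G> (X k) \<union> \<B> (X k))"
              using x V'_mem[OF k] G'_mem[OF k] I_mem[OF rB[OF k]] k by blast
            then have "x \<in> T k ` (?ub - \<Union>(\<G> (X k) \<union> \<B> (X k)))" using T_mem[OF rB[OF k]] by blast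
            then show ?thesis using rB[OF k] by auto
          qed (use x in blast)
        qed
      qed
      show "\<forall>S\<in>\<G>'. \<exists>Y\<in>K. \<exists>b. \<forall>x\<in>S. G' x = Y \<and> w' x = affine_map Y b x"
      proof
        fix S assume "S \<in> \<G>'"
        then obtain k R where k: "r k > 0" "R \<in> \<G> (X k)" "S = T k ` R" unfolding \<G>'_def piece_def by blast
        show "\<exists>Y\<in>K. \<exists>b. \<forall>x\<in>S. G' x = Y \<and> w' x = affine_map Y b x"
          using affine_piece[OF k(1) _ CG[OF k(1,2)]] k(2) unfolding k(3) affine_map_def by blast
      qed
      show "energy p V' G' \<le> ennreal \<epsilon> * energy p V G"
      proof -
        have "energy p V' G' = (\<integral>\<^sup>+x\<in>V. weight p G' x * indicator V' x \<partial>lebesgue)"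
          by (rule nn_integral_cong) (use subB(1) BV in \<open>auto simp: indicator_def\<close>)
        also have "\<dots> \<le> ennreal \<epsilon> * energy p V G"
        proof (rule mono[where F="\<lambda>k y. ennreal ((1 + norm (H (X k) y)) powr p) * indicator (\<Union>(\<B> (X k))) y"])
          show "(\<lambda>x. weight p G' x * indicator V' x) \<in> borel_measurable lebesgue"
            unfolding weight_def by measurable
          show "weight p G' x * indicator V' x = ennreal ((1 + norm (H (X k) (I k x))) powr p) * indicator (\<Union>(\<B> (X k))) (I k x)"
            if "x \<in> B k" for k x
            by (simp only: weight_def G'B[OF that] indicator_def V'_mem[OF that])
          fix k assume k: "r k > 0"
          have [measurable]: "H (X k) \<in> borel_measurable lebesgue" "\<Union>(\<B> (X k)) \<in> sets lebesgue"
            using Hm[OF k] opnm[OF k] by auto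
          show "(\<lambda>y. ennreal ((1 + norm (H (X k) y)) powr p) * indicator (\<Union>(\<B> (X k))) y) \<in> borel_measurable lebesgue"
            by measurable
          have "(\<integral>\<^sup>+y\<in>?ub. ennreal ((1 + norm (H (X k) y)) powr p) * indicator (\<Union>(\<B> (X k))) y \<partial>lebesgue)
             = (\<integral>\<^sup>+y\<in>\<Union>(\<B> (X k)). ennreal ((1 + norm (H (X k) y)) powr p) \<partial>lebesgue)"
            by (rule nn_integral_cong) (use ub_sub(1)[OF k] in \<open>auto simp: indicator_def\<close>)
          also have "\<dots> \<le> ennreal \<epsilon> * emeasure lebesgue ?ub" by (rule Cbad[OF k])
          also have "\<dots> \<le> ennreal \<epsilon> * (ennreal ((1 + norm (X k)) powr p) * emeasure lebesgue ?ub)"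
          proof -
            have "1 \<le> ennreal ((1 + norm (X k)) powr p)" using p by (auto simp: ennreal_ge_1 intro!: ge_one_powr_ge_zero)
            then have "1 * emeasure lebesgue ?ub \<le> ennreal ((1 + norm (X k)) powr p) * emeasure lebesgue ?ub"
              by (intro mult_right_mono) auto
            then show ?thesis by (intro mult_left_mono) auto
          qed
          finally show "(\<integral>\<^sup>+y\<in>?ub. ennreal ((1 + norm (H (X k) y)) powr p) * indicator (\<Union>(\<B> (X k))) y \<partial>lebesgue)
             \<le> ennreal \<epsilon> * (ennreal ((1 + norm (X k)) powr p) * emeasure lebesgue ?ub)" .
        qed
        finally show ?thesis .
      qed
      show "\<forall>t>0. emeasure lebesgue {x\<in>V. norm (G' x) > t} \<le> ennreal (M * t powr (- p)) * energy p V G"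
      proof (intro allI impI)
        fix t :: real assume t: "t > 0"
        have "emeasure lebesgue {x\<in>V. norm (G' x) > t} = (\<integral>\<^sup>+x. indicator {x\<in>V. norm (G' x) > t} x \<partial>lebesgue)"
          by (rule nn_integral_indicator[OF superlevel_in_sets_lebesgue[OF G'm Vm], symmetric])
        also have "\<dots> = (\<integral>\<^sup>+x\<in>V. indicator {v. norm v > t} (G' x) \<partial>lebesgue)"
          by (rule nn_integral_cong) (auto simp: indicator_def)
        also have "\<dots> \<le> ennreal (M * t powr (- p)) * energy p V G"
        proof (rule mono[where F="\<lambda>k y. indicator {v. norm v > t} (H (X k) y)"])
          show "(\<lambda>x. indicator {v. norm v > t} (G' x) :: ennreal) \<in> borel_measurable lebesgue"
            by (simp add: indicator_def) measurable
          show "(indicator {v. norm v > t} (G' x) :: ennreal) = indicator {v. norm v > t} (H (X k) (I k x))" if "x \<in> B k" for k x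
            by (simp only: G'B[OF that])
          fix k assume k: "r k > 0"
          have [measurable]: "H (X k) \<in> borel_measurable lebesgue" using Hm[OF k] .
          show "(\<lambda>y. indicator {v. norm v > t} (H (X k) y) :: ennreal) \<in> borel_measurable lebesgue"
            by (simp add: indicator_def) measurable
          have ubm[measurable]: "?ub \<in> sets lebesgue" by simp
          have "(\<integral>\<^sup>+y. indicator {y\<in>?ub. norm (H (X k) y) > t} y \<partial>lebesgue) = emeasure lebesgue {y\<in>?ub. norm (H (X k) y) > t}"
            by (rule nn_integral_indicator[OF superlevel_in_sets_lebesgue[OF Hm[OF k] ubm]])
          moreover have "(\<integral>\<^sup>+y\<in>?ub. indicator {v. norm v > t} (H (X k) y) \<partial>lebesgue) = (\<integral>\<^sup>+y. indicator {y\<in>?ub. norm (H (X k) y) > t} y \<partial>lebesgue)"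
            by (rule nn_integral_cong) (auto simp: indicator_def)
          ultimately have "(\<integral>\<^sup>+y\<in>?ub. indicator {v. norm v > t} (H (X k) y) \<partial>lebesgue)
             \<le> ennreal (t powr (- p)) * (ennreal (M * (1 + norm (X k)) powr p) * emeasure lebesgue ?ub)"
            using Cup[OF k t] by (simp only:)
          also have "\<dots> = ennreal (M * t powr (- p)) * (ennreal ((1 + norm (X k)) powr p) * emeasure lebesgue ?ub)"
            using M by (simp add: ennreal_mult mult_ac)
          finally show "(\<integral>\<^sup>+y\<in>?ub. indicator {v. norm v > t} (H (X k) y) \<partial>lebesgue)
             \<le> ennreal (M * t powr (- p)) * (ennreal ((1 + norm (X k)) powr p) * emeasure lebesgue ?ub)" .
        qed
        finally show "emeasure lebesgue {x\<in>V. norm (G' x) > t} \<le> ennreal (M * t powr (- p)) * energy p V G" .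
      qed
      show "(\<integral>\<^sup>+x. norm (G' x - G x) \<partial>lebesgue) \<le> ennreal ?L * energy p V G"
      proof -
        have "ennreal (norm (G' x - G x)) \<le> (\<Sum>k. ennreal (norm (g k x)))" for x
        proof (cases "x \<in> (\<Union>k. B k)")
          case True
          then obtain k where k: "x \<in> B k" by blast
          have "ennreal (norm (G' x - G x)) = (\<Sum>l\<in>{k}. ennreal (norm (g l x)))" by (simp add: G'_def gsum[OF k])
          also have "\<dots> \<le> (\<Sum>l. ennreal (norm (g l x)))" by (intro sum_le_suminf summableI) auto
          finally show ?thesis .
        qed (simp add: G'_def off)
        then have "(\<integral>\<^sup>+x. norm (G' x - G x) \<partial>lebesgue) \<le> (\<integral>\<^sup>+x. (\<Sum>k. ennreal (norm (g k x))) \<partial>lebesgue)"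
          by (rule nn_integral_mono)
        also have "\<dots> = (\<Sum>k. \<integral>\<^sup>+x. norm (g k x) \<partial>lebesgue)" by (rule nn_integral_suminf) measurable
        finally show ?thesis using gint_sum by (rule order_trans)
      qed
      show "\<forall>t>1. ennreal ((c - \<epsilon>) * t powr (- p)) * emeasure lebesgue V \<le> emeasure lebesgue {x\<in>\<Union>\<G>'. norm (G' x) > t}"
      proof (intro allI impI)
        fix t :: real assume t: "t > 1"
        let ?c = "ennreal ((c - \<epsilon>) * t powr (- p))"
        let ?f = "\<lambda>x. indicator {x\<in>\<Union>\<G>'. norm (G' x) > t} x :: ennreal"
        have Gs[measurable]: "{x\<in>\<Union>\<G>'. norm (G' x) > t} \<in> sets lebesgue"
          by (rule superlevel_in_sets_lebesgue[OF G'm G'sm])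
        have ball: "(\<integral>\<^sup>+x\<in>B k. ?c \<partial>lebesgue) \<le> (\<integral>\<^sup>+x\<in>B k. ?f x \<partial>lebesgue)" for k
        proof (cases "r k > 0")
          case k: True
          let ?S = "{y\<in>\<Union>(\<G> (X k)). norm (H (X k) y) > t}"
          have [measurable]: "H (X k) \<in> borel_measurable lebesgue" "\<Union>(\<G> (X k)) \<in> sets lebesgue"
            using Hm[OF k] opnm[OF k] by auto
          have S[measurable]: "?S \<in> sets lebesgue" by (rule superlevel_in_sets_lebesgue[OF Hm[OF k] opnm(2)[OF k]])
          have "(\<integral>\<^sup>+x\<in>B k. ?c \<partial>lebesgue) = ?c * emeasure lebesgue (B k)" by (simp add: nn_integral_cmult_indicator)
          also have "\<dots> = ennreal (r k ^ CARD('m)) * (?c * emeasure lebesgue ?ub)"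
            unfolding B_def emeasure_ball_affine[OF k] by (simp only: mult_ac)
          also have "\<dots> \<le> ennreal (r k ^ CARD('m)) * emeasure lebesgue ?S"
            by (intro mult_left_mono Clow[OF k t]) simp
          also have "emeasure lebesgue ?S = (\<integral>\<^sup>+y. indicator ?S y \<partial>lebesgue)" by (rule nn_integral_indicator[OF S, symmetric])
          also have "(\<integral>\<^sup>+y. indicator ?S y \<partial>lebesgue) = (\<integral>\<^sup>+y\<in>?ub. indicator ?S y \<partial>lebesgue)"
            by (rule nn_integral_cong) (use ub_sub(2)[OF k] in \<open>auto simp: indicator_def\<close>)
          also have "ennreal (r k ^ CARD('m)) * \<dots> = (\<integral>\<^sup>+x\<in>B k. indicator ?S (I k x) \<partial>lebesgue)"
            by (rule resc[OF _ k, symmetric]) measurable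
          also have "\<dots> = (\<integral>\<^sup>+x\<in>B k. ?f x \<partial>lebesgue)"
          proof (rule nn_integral_cong)
            show "indicator ?S (I k x) * indicator (B k) x = ?f x * indicator (B k) x" for x
            proof (cases "x \<in> B k")
              case True
              then show ?thesis using G'_mem[OF True] G'B[OF True] by (simp only: indicator_def mem_Collect_eq)
            qed simp
          qed
          finally show ?thesis .
        qed (simp add: B0)
        have "?c * emeasure lebesgue V = (\<integral>\<^sup>+x\<in>V. ?c \<partial>lebesgue)" by (simp add: nn_integral_cmult_indicator)
        also have "\<dots> \<le> (\<integral>\<^sup>+x\<in>V. ?f x \<partial>lebesgue)"
          unfolding V_eq by (rule nn_integral_UN_disjoint_mono[OF _ _ Bm dj' ball]) measurable
        also have "\<dots> \<le> (\<integral>\<^sup>+x. ?f x \<partial>lebesgue)"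
          by (rule nn_integral_mono) (auto simp: indicator_def)
        also have "\<dots> = emeasure lebesgue {x\<in>\<Union>\<G>'. norm (G' x) > t}" by (rule nn_integral_indicator[OF Gs])
        finally show "?c * emeasure lebesgue V \<le> emeasure lebesgue {x\<in>\<Union>\<G>'. norm (G' x) > t}" .
      qed
    qed
  qed
qed

section \<open>Iterating the step\<close>

lemma holder_on_suminf:
  fixes u :: "nat \<Rightarrow> real^'m \<Rightarrow> real^'d"
  assumes u: "\<And>n. holder_on (e n) \<alpha> S (u n)" and e: "summable e" and su: "\<And>x. summable (\<lambda>n. u n x)"
  shows "holder_on (\<Sum>n. e n) \<alpha> S (\<lambda>x. \<Sum>n. u n x)"
  unfolding holder_on_def
proof (intro ballI)
  fix x y assume xy: "x \<in> S" "y \<in> S"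
  have b: "norm (u n x - u n y) \<le> e n * norm (x - y) powr \<alpha>" for n by (rule holder_onD[OF u xy])
  have s: "summable (\<lambda>n. e n * norm (x - y) powr \<alpha>)" using e by (rule summable_mult2)
  have "(\<Sum>n. u n x) - (\<Sum>n. u n y) = (\<Sum>n. u n x - u n y)" by (rule suminf_diff[OF su su])
  then have "norm ((\<Sum>n. u n x) - (\<Sum>n. u n y)) \<le> (\<Sum>n. e n * norm (x - y) powr \<alpha>)"
    using norm_suminf_le[of "\<lambda>n. u n x - u n y" "\<lambda>n. e n * norm (x - y) powr \<alpha>", OF b s] by simp
  then show "norm ((\<Sum>n. u n x) - (\<Sum>n. u n y)) \<le> (\<Sum>n. e n) * norm (x - y) powr \<alpha>"
    using suminf_mult2[OF e] by simp
qed

lemma W11_gradient_affine_plus_weak_pair: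
  fixes \<Omega> :: "(real^'m) set" and u :: "real^'m \<Rightarrow> real^'d"
  assumes wp: "weak_pair u g" and \<Omega>: "open \<Omega>" "bounded \<Omega>"
  shows "W11_gradient \<Omega> (\<lambda>x. affine_map X b x + u x) (\<lambda>x. X + g x)"
proof -
  have \<Omega>m: "\<Omega> \<in> lmeasurable" using \<Omega> by (simp add: lmeasurable_open)
  then have \<Omega>s: "\<Omega> \<in> sets lebesgue" and \<Omega>f: "emeasure lebesgue \<Omega> < \<infinity>" unfolding fmeasurable_def by blast+
  have iu: "integrable lebesgue u" and ig: "integrable lebesgue g" using wp by (auto simp: weak_pair_def)
  have ac: "continuous_on S (affine_map X b)" for S :: "(real^'m) set"
    unfolding affine_map_def[abs_def] by (intro continuous_intros matrix_vector_mult_linear_continuous_on)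
  have il: "set_integrable lebesgue \<Omega> (affine_map X b)"
  proof -
    have "compact (closure \<Omega>)" using \<Omega>(2) by simp
    then obtain B where B: "\<And>x. x \<in> closure \<Omega> \<Longrightarrow> norm (affine_map X b x) \<le> B"
      using continuous_on_compact_bound[OF _ ac] by blast
    have "affine_map X b \<in> borel_measurable lebesgue"
      using borel_measurable_continuous_onI[OF ac] by (auto intro!: measurable_completion)
    then show ?thesis
      unfolding set_integrable_def using B closure_subset[of \<Omega>] \<Omega>s \<Omega>f
      by (intro integrableI_bounded_set[of \<Omega> _ _ B]) (auto simp: indicator_def)
  qed
  have iX: "set_integrable lebesgue \<Omega> (\<lambda>x. X)"
    unfolding set_integrable_def using \<Omega>m by (intro integrable_scaleR_left) (simp add: lmeasurable_iff_integrable)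
  have sub: "set_integrable lebesgue \<Omega> f" if "integrable lebesgue f" for f :: "real^'m \<Rightarrow> 'z::{banach,second_countable_topology}"
    unfolding set_integrable_def by (rule integrable_mult_indicator[OF \<Omega>s that])
  show ?thesis unfolding W11_gradient_def
  proof (intro conjI allI impI)
    show "set_integrable lebesgue \<Omega> (\<lambda>x. affine_map X b x + u x)" by (rule set_integral_add(1)[OF il sub[OF iu]])
    show "set_integrable lebesgue \<Omega> (\<lambda>x. X + g x)" by (rule set_integral_add(1)[OF iX sub[OF ig]])
    fix \<phi> :: "real^'m \<Rightarrow> real" and i j assume \<phi>: "test_function \<Omega> \<phi>"
    note \<phi>U = test_function_mono[OF \<phi> subset_UNIV]
    have "(LINT x:\<Omega>|lebesgue. (affine_map X b x + u x) $ i * partial_deriv j \<phi> x)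
        = (LINT x|lebesgue. affine_map X b x $ i * partial_deriv j \<phi> x + u x $ i * partial_deriv j \<phi> x)"
      unfolding set_lebesgue_integral_def
    proof (rule Bochner_Integration.integral_cong[OF refl])
      show "indicator \<Omega> x *\<^sub>R ((affine_map X b x + u x) $ i * partial_deriv j \<phi> x)
        = affine_map X b x $ i * partial_deriv j \<phi> x + u x $ i * partial_deriv j \<phi> x" for x
        using test_function_partial_zero[OF \<phi>, of x j] by (cases "x \<in> \<Omega>") (auto simp: distrib_right)
    qed
    also have "\<dots> = (LINT x|lebesgue. affine_map X b x $ i * partial_deriv j \<phi> x) + (LINT x|lebesgue. u x $ i * partial_deriv j \<phi> x)"
      by (intro Bochner_Integration.integral_add affine_map_integration_by_parts(1)[OF \<phi>U]
          integrable_mult_test_function[OF integrable_component[OF iu] test_function_partial_deriv[OF \<phi>]])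
    also have "\<dots> = - ((LINT x|lebesgue. X $ i $ j * \<phi> x) + (LINT x|lebesgue. g x $ i $ j * \<phi> x))"
      unfolding affine_map_integration_by_parts(2)[OF \<phi>U] weak_pairD[OF wp \<phi>U] by simp
    also have "(LINT x|lebesgue. X $ i $ j * \<phi> x) + (LINT x|lebesgue. g x $ i $ j * \<phi> x)
        = (LINT x|lebesgue. X $ i $ j * \<phi> x + g x $ i $ j * \<phi> x)"
      by (intro Bochner_Integration.integral_add[symmetric] integrable_mult_right test_function_integrable[OF \<phi>]
          integrable_mult_test_function[OF integrable_component2[OF ig] \<phi>])
    also have "\<dots> = (LINT x:\<Omega>|lebesgue. (X + g x) $ i $ j * \<phi> x)"
      unfolding set_lebesgue_integral_def
    proof (rule Bochner_Integration.integral_cong[OF refl])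
      show "X $ i $ j * \<phi> x + g x $ i $ j * \<phi> x = indicator \<Omega> x *\<^sub>R ((X + g x) $ i $ j * \<phi> x)" for x
        using test_function_zero[OF \<phi>, of x] by (cases "x \<in> \<Omega>") (auto simp: distrib_right)
    qed
    finally show "(LINT x:\<Omega>|lebesgue. (affine_map X b x + u x) $ i * partial_deriv j \<phi> x)
        = - (LINT x:\<Omega>|lebesgue. (X + g x) $ i $ j * \<phi> x)" .
  qed
qed

lemma reduction_sequence_exists:
  fixes U K :: "(real^'m^'d) set" and \<Omega> :: "(real^'m) set"
  assumes cells: "\<forall>X\<in>U. \<exists>A u H \<G> \<B>. cell U K \<alpha> p M c \<epsilon> X A u H \<G> \<B>"
    and p: "1 < p" and M: "M \<ge> 0" and \<alpha>: "0 < \<alpha>" "\<alpha> < 1" and \<epsilon>: "0 < \<epsilon>" and e: "\<And>n. 0 < e n"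
    and st: "affine_state U \<Omega> w\<^sub>0 G\<^sub>0" and G0: "G\<^sub>0 \<in> borel_measurable lebesgue"
    and fin: "energy p \<Omega> G\<^sub>0 < \<infinity>"
  obtains V w G \<G> where "V 0 = \<Omega>" "w 0 = w\<^sub>0" "G 0 = G\<^sub>0"
    "\<And>n::nat. reduction_step U K \<alpha> p M (1 + M * weak_type_const p) c \<epsilon> (e n)
       (V n) (w n) (G n) (V (Suc n)) (w (Suc n)) (G (Suc n)) (\<G> n)"
proof -
  let ?step = "\<lambda>n (V, w, G) (V', w', G') \<G>. reduction_step U K \<alpha> p M (1 + M * weak_type_const p) c \<epsilon> (e n) V w G V' w' G' \<G>"
  \<comment> \<open>dependent choice yields some sequence, so the invariant has to pin down its first term\<close>
  define inv where "inv = (\<lambda>(n::nat) (V, w, G). affine_state U V w G \<and> G \<in> borel_measurable lebesgue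
      \<and> energy p V G < \<infinity> \<and> (n = 0 \<longrightarrow> (V, w, G) = (\<Omega>, w\<^sub>0, G\<^sub>0)))"
  have "\<exists>f. \<forall>n. inv n (f n) \<and> (\<exists>\<G>. ?step n (f n) (f (Suc n)) \<G>)"
  proof (rule dependent_nat_choice)
    show "\<exists>s. inv 0 s" using st G0 fin by (intro exI[of _ "(\<Omega>, w\<^sub>0, G\<^sub>0)"]) (simp add: inv_def)
    fix s n assume s: "inv n s"
    obtain V w G where s_eq: "s = (V, w, G)" by (cases s)
    have i: "affine_state U V w G" "G \<in> borel_measurable lebesgue" "energy p V G < \<infinity>"
      using s by (auto simp: inv_def s_eq)
    obtain V' w' G' \<G>' where step: "reduction_step U K \<alpha> p M (1 + M * weak_type_const p) c \<epsilon> (e n) V w G V' w' G' \<G>'"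
      using reduction_step_exists[OF cells p M \<alpha> \<epsilon> e i] by blast
    have "energy p V' G' \<le> ennreal \<epsilon> * energy p V G"
      using step by (simp add: reduction_step_def)
    also have "\<dots> < \<infinity>" using i(3) by (simp add: ennreal_mult_less_top)
    finally have "inv (Suc n) (V', w', G')"
      using step by (simp add: inv_def reduction_step_def)
    then show "\<exists>s'. inv (Suc n) s' \<and> (\<exists>\<G>. ?step n s s' \<G>)"
      using step by (intro exI[of _ "(V', w', G')"]) (auto simp: s_eq)
  qed
  then obtain f where f: "\<And>n. inv n (f n)" "\<And>n. \<exists>\<G>. ?step n (f n) (f (Suc n)) \<G>" by blast
  then obtain \<G> where g: "\<And>n. ?step n (f n) (f (Suc n)) (\<G> n)" by metis
  show thesis
  proof (rule that[of "\<lambda>n. fst (f n)" "\<lambda>n. fst (snd (f n))" "\<lambda>n. snd (snd (f n))" \<G>])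
    show "fst (f 0) = \<Omega>" "fst (snd (f 0)) = w\<^sub>0" "snd (snd (f 0)) = G\<^sub>0"
      using f(1)[of 0] by (auto simp: inv_def split: prod.splits)
    show "reduction_step U K \<alpha> p M (1 + M * weak_type_const p) c \<epsilon> (e n) (fst (f n)) (fst (snd (f n))) (snd (snd (f n)))
        (fst (f (Suc n))) (fst (snd (f (Suc n)))) (snd (snd (f (Suc n)))) (\<G> n)" for n
      using g[of n] by (simp add: case_prod_beta)
  qed
qed

text \<open>
  The errors \<open>\<delta>/8 2\<^sup>-\<^sup>n\<close> add up to \<open>\<delta>/4\<close>, once for the supremum and once for the Hoelder constant. The
  untreated sets decrease to a null set because their measure is bounded by the energy. On a piece that is final
  after stage \<open>n\<close> all later corrections vanish, so there the limit is the map of stage \<open>n + 1\<close>.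
\<close>

lemma solution_exists:
  fixes U K :: "(real^'m^'d) set" and \<Omega> :: "(real^'m) set"
  assumes cells: "\<forall>X\<in>U. \<exists>A u H \<G> \<B>. cell U K \<alpha> p M c \<epsilon> X A u H \<G> \<B>"
    and p: "1 < p" and M: "M \<ge> 0" and \<alpha>: "0 < \<alpha>" "\<alpha> < 1" and \<epsilon>: "0 < \<epsilon>" "\<epsilon> \<le> 1 / 2" and \<delta>: "0 < \<delta>"
    and \<Omega>: "regular_domain \<Omega>" and X0: "X\<^sub>0 \<in> U"
  shows "\<exists>w G C. C > 0 \<and> piecewise_affine \<Omega> w \<and> W11_gradient \<Omega> w G \<and>
      w \<in> holder_space \<alpha> (closure \<Omega>) \<and>
      (\<forall>x\<in>frontier \<Omega>. w x = affine_map X\<^sub>0 b x) \<and>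
      (AE x in lebesgue. x \<in> \<Omega> \<longrightarrow> G x \<in> K) \<and>
      holder_norm \<alpha> (closure \<Omega>) (\<lambda>x. w x - affine_map X\<^sub>0 b x) < ennreal \<delta> \<and>
      (\<forall>t>0. measure lebesgue (super_level \<Omega> G t) \<le> C * t powr (- p)) \<and>
      (\<forall>t>1. measure lebesgue (super_level \<Omega> G t) \<ge> (c - \<epsilon>) * measure lebesgue \<Omega> * t powr (- p))"
proof -
  let ?l = "affine_map X\<^sub>0 b"
  let ?L = "1 + M * weak_type_const p"
  have \<Omega>o: "open \<Omega>" and \<Omega>b: "bounded \<Omega>" using \<Omega> by (auto simp: regular_domain_def)
  have \<Omega>m: "\<Omega> \<in> lmeasurable" using \<Omega>o \<Omega>b by (simp add: lmeasurable_open)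
  then have \<Omega>s[measurable]: "\<Omega> \<in> sets lebesgue" and \<Omega>f: "emeasure lebesgue \<Omega> < \<infinity>" unfolding fmeasurable_def by blast+
  define e where "e n = \<delta> / 8 * (1 / 2) ^ n" for n :: nat
  have e0: "0 < e n" for n using \<delta> by (simp add: e_def)
  have esums: "e sums (\<delta> / 4)"
    using sums_mult[OF geometric_sums[of "1 / 2 :: real"], of "\<delta> / 8"] by (simp add: e_def[abs_def])
  have es: "summable e" "(\<Sum>n. e n) = \<delta> / 4" using esums by (auto simp: sums_iff)
  define I0 where "I0 = (1 + norm X\<^sub>0) powr p * measure lebesgue \<Omega>"
  have I0: "energy p \<Omega> (\<lambda>_. X\<^sub>0) = ennreal I0" and I0_nn: "0 \<le> I0"
    using \<Omega>m by (auto simp: weight_def I0_def nn_integral_cmult_indicator emeasure_eq_measure2 ennreal_mult)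
  have st: "affine_state U \<Omega> ?l (\<lambda>_. X\<^sub>0)"
    unfolding affine_state_def
  proof (intro conjI ballI \<Omega>o X0)
    fix x assume "x \<in> \<Omega>"
    then obtain d where "d > 0" "ball x d \<subseteq> \<Omega>" by (rule openE[OF \<Omega>o])
    then show "\<exists>d>0. ball x d \<subseteq> \<Omega> \<and> (\<exists>b'. \<forall>y\<in>ball x d. X\<^sub>0 = X\<^sub>0 \<and> ?l y = X\<^sub>0 *v y + b')"
      by (intro exI[of _ d] conjI exI[of _ b]) (auto simp: affine_map_def)
  qed
  obtain V w G \<G> where init: "V 0 = \<Omega>" "w 0 = ?l" "G 0 = (\<lambda>_. X\<^sub>0)"
    and step: "\<And>n::nat. reduction_step U K \<alpha> p M ?L c \<epsilon> (e n) (V n) (w n) (G n) (V (Suc n)) (w (Suc n)) (G (Suc n)) (\<G> n)"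
    by (rule reduction_sequence_exists[where e=e and \<Omega>=\<Omega> and w\<^sub>0="?l" and G\<^sub>0="\<lambda>_. X\<^sub>0", OF cells p M \<alpha> \<epsilon>(1) e0 st])
       (auto simp: I0)
  note S = step[unfolded reduction_step_def]
  have Vdec: "V (Suc n) \<subseteq> V n" for n using S[of n] by blast
  have Vanti: "V n \<subseteq> V m" if "m \<le> n" for m n using lift_Suc_antimono_le[of V, OF Vdec that] .
  have V\<Omega>: "V n \<subseteq> \<Omega>" for n using Vanti[of 0 n] init by simp
  have Vo: "open (V n)" for n
  proof (cases n)
    case (Suc m)
    then show ?thesis using S[of m] by (simp add: affine_state_def)
  qed (simp add: init \<Omega>o)
  have Vs[measurable]: "V n \<in> sets lebesgue" for n using Vo[of n] by simp
  have Gm[measurable]: "G n \<in> borel_measurable lebesgue" for n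
  proof (cases n)
    case (Suc m)
    then show ?thesis using S[of m] by blast
  qed (simp add: init)
  let ?J = "\<lambda>n. energy p (V n) (G n)"
  have J: "?J n \<le> ennreal (I0 * (1 / 2) ^ n)" for n
  proof (induction n)
    case 0
    then show ?case by (simp add: init I0)
  next
    case (Suc n)
    have "?J (Suc n) \<le> ennreal \<epsilon> * ?J n" using S[of n] by blast
    also have "\<dots> \<le> ennreal (1 / 2) * ennreal (I0 * (1 / 2) ^ n)"
      using \<epsilon> by (intro mult_mono Suc ennreal_leI) auto
    also have "\<dots> = ennreal (1 / 2 * (I0 * (1 / 2) ^ n))" by (rule ennreal_mult[symmetric]) (use I0_nn in auto)
    also have "1 / 2 * (I0 * (1 / 2) ^ n) = I0 * (1 / 2) ^ Suc n" by simp
    finally show ?case .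
  qed
  have geo: "(\<lambda>n. I0 * (1 / 2) ^ n) sums (I0 * 2)"
    using sums_mult[OF geometric_sums[of "1 / 2 :: real"], of I0] by simp
  have Jsum: "(\<Sum>n. ?J n) \<le> ennreal (I0 * 2)"
  proof -
    have "(\<Sum>n. ?J n) \<le> (\<Sum>n. ennreal (I0 * (1 / 2) ^ n))" by (intro suminf_le J summableI)
    also have "\<dots> = ennreal (I0 * 2)" by (rule suminf_ennreal_eq[OF _ geo]) (use I0_nn in simp)
    finally show ?thesis .
  qed
  have JV: "emeasure lebesgue (V n) \<le> ?J n" for n
  proof -
    have "emeasure lebesgue (V n) = (\<integral>\<^sup>+x. indicator (V n) x \<partial>lebesgue)" by simp
    also have "\<dots> \<le> ?J n"
      using p by (intro nn_integral_mono) (auto simp: indicator_def weight_def ennreal_ge_1 intro!: ge_one_powr_ge_zero)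
    finally show ?thesis .
  qed
  define u where "u n x = w (Suc n) x - w n x" for n x
  define g where "g n x = G (Suc n) x - G n x" for n x
  define uu where "uu x = (\<Sum>n. u n x)" for x
  define gg where "gg x = (\<Sum>n. g n x)" for x
  have ule: "norm (u n x) \<le> e n" for n x using S[of n] unfolding u_def by blast
  have zero: "u n x = 0" "g n x = 0" if "x \<notin> V n" for n x
  proof -
    have "w (Suc n) x = w n x \<and> G (Suc n) x = G n x" using S[of n] that by blast
    then show "u n x = 0" "g n x = 0" by (simp_all add: u_def g_def)
  qed
  have usum: "summable (\<lambda>n. norm (u n x))" for x
    by (rule summable_comparison_test'[OF es(1), of 0]) (simp add: ule)
  have uh: "holder_on (e n) \<alpha> UNIV (u n)" for n using S[of n] unfolding u_def[abs_def] by blast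
  have wp: "weak_pair (u n) (g n)" for n using S[of n] unfolding u_def[abs_def] g_def[abs_def] by blast
  have WP: "weak_pair uu gg"
    unfolding uu_def[abs_def] gg_def[abs_def]
  proof (rule weak_pair_series[OF wp])
    have "(\<integral>\<^sup>+x. norm (u n x) \<partial>lebesgue) \<le> ennreal (e n) * emeasure lebesgue \<Omega>" for n
    proof -
      have "(\<integral>\<^sup>+x. norm (u n x) \<partial>lebesgue) \<le> (\<integral>\<^sup>+x. ennreal (e n) * indicator \<Omega> x \<partial>lebesgue)"
        by (rule nn_integral_mono) (use ule zero V\<Omega> in \<open>fastforce simp: indicator_def intro!: ennreal_leI\<close>)
      then show ?thesis by (simp add: nn_integral_cmult_indicator)
    qed
    then have "(\<Sum>n. \<integral>\<^sup>+x. norm (u n x) \<partial>lebesgue) \<le> (\<Sum>n. ennreal (e n) * emeasure lebesgue \<Omega>)"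
      by (intro suminf_le summableI)
    also have "\<dots> = ennreal (\<delta> / 4) * emeasure lebesgue \<Omega>"
      unfolding ennreal_suminf_multc using suminf_ennreal_eq[OF less_imp_le[OF e0] esums] by simp
    also have "\<dots> < \<infinity>" using \<Omega>f by (simp add: ennreal_mult_less_top)
    finally show "(\<Sum>n. \<integral>\<^sup>+x. norm (u n x) \<partial>lebesgue) < \<infinity>" .
    have "(\<integral>\<^sup>+x. norm (g n x) \<partial>lebesgue) \<le> ennreal ?L * ?J n" for n
      using S[of n] unfolding g_def by blast
    then have "(\<Sum>n. \<integral>\<^sup>+x. norm (g n x) \<partial>lebesgue) \<le> (\<Sum>n. ennreal ?L * ?J n)"
      by (intro suminf_le summableI)
    also have "\<dots> = ennreal ?L * (\<Sum>n. ?J n)" by simp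
    also have "\<dots> \<le> ennreal ?L * ennreal (I0 * 2)" by (intro mult_left_mono Jsum) simp
    also have "\<dots> < \<infinity>" by (simp add: ennreal_mult_less_top)
    finally show "(\<Sum>n. \<integral>\<^sup>+x. norm (g n x) \<partial>lebesgue) < \<infinity>" .
  qed
  define W where "W x = ?l x + uu x" for x
  define Gf where "Gf x = X\<^sub>0 + gg x" for x
  have W11g: "W11_gradient \<Omega> W Gf"
    unfolding W_def[abs_def] Gf_def[abs_def] by (rule W11_gradient_affine_plus_weak_pair[OF WP \<Omega>o \<Omega>b])
  have Gc: "countable (\<G> n)" and Gd: "disjoint (\<G> n)" for n using S[of n] by blast+
  have Gr: "regular_domain R" "R \<subseteq> V n" "R \<inter> V (Suc n) = {}" if "R \<in> \<G> n" for n R using S[of n] that by blast+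
  have Gn: "V n - (\<Union>(\<G> n) \<union> V (Suc n)) \<in> null_sets lebesgue" for n using S[of n] by blast
  have Ga: "\<forall>R\<in>\<G> n. \<exists>Y\<in>K. \<exists>b. \<forall>x\<in>R. G (Suc n) x = Y \<and> w (Suc n) x = affine_map Y b x" for n
    using S[of n] by (elim conjE) assumption
  have stable: "W x = w (Suc n) x" "Gf x = G (Suc n) x" if x: "x \<in> R" "R \<in> \<G> n" for x R n
  proof -
    have "x \<notin> V k" if "k \<notin> {..<Suc n}" for k
      using Vanti[of "Suc n" k] that x Gr(3)[OF x(2)] by auto
    then have "uu x = (\<Sum>k<Suc n. u k x)" "gg x = (\<Sum>k<Suc n. g k x)"
      unfolding uu_def gg_def by (intro suminf_finite; simp add: zero)+
    moreover have "(\<Sum>k<Suc n. u k x) = w (Suc n) x - w 0 x" "(\<Sum>k<Suc n. g k x) = G (Suc n) x - G 0 x"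
      unfolding u_def g_def by (rule sum_lessThan_telescope)+
    ultimately show "W x = w (Suc n) x" "Gf x = G (Suc n) x"
      unfolding W_def Gf_def init by simp_all
  qed
  define \<F> where "\<F> = (\<Union>n. \<G> n)"
  have nullV: "(\<Inter>n. V n) \<in> null_sets lebesgue"
  proof -
    have "emeasure lebesgue (\<Inter>n. V n) \<le> ennreal (I0 * (1 / 2) ^ n)" for n
    proof -
      have "emeasure lebesgue (\<Inter>n. V n) \<le> emeasure lebesgue (V n)" by (rule emeasure_mono[OF _ Vs]) blast
      also have "\<dots> \<le> ennreal (I0 * (1 / 2) ^ n)" using JV J by (rule order_trans)
      finally show ?thesis .
    qed
    moreover have "(\<lambda>n. ennreal (I0 * (1 / 2) ^ n)) \<longlonglongrightarrow> ennreal (I0 * 0)"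
      by (intro tendsto_ennrealI tendsto_mult tendsto_const LIMSEQ_power_zero) simp
    ultimately have "emeasure lebesgue (\<Inter>n. V n) \<le> ennreal (I0 * 0)"
      by (intro LIMSEQ_le_const) auto
    moreover have "(\<Inter>n. V n) \<in> sets lebesgue" by measurable
    ultimately show ?thesis by (simp add: null_setsI)
  qed
  have Fo: "open (\<Union>\<F>)" using Gr(1) by (intro open_Union) (auto simp: \<F>_def regular_domain_def)
  have F\<Omega>: "\<Union>\<F> \<subseteq> \<Omega>" using Gr(2) V\<Omega> unfolding \<F>_def by blast
  \<comment> \<open>a point that never becomes final is lost in the null set of some stage or lies in every \<open>V n\<close>\<close>
  have nullF: "\<Omega> - \<Union>\<F> \<in> null_sets lebesgue"
  proof (rule null_sets_subset)
    show "(\<Union>n. V n - (\<Union>(\<G> n) \<union> V (Suc n))) \<union> (\<Inter>n. V n) \<in> null_sets lebesgue"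
      by (intro null_sets.Un null_sets_UN Gn nullV)
    have "\<Union>\<F> \<in> sets lebesgue" using Fo by simp
    then show "\<Omega> - \<Union>\<F> \<in> sets lebesgue" using \<Omega>s by blast
    show "\<Omega> - \<Union>\<F> \<subseteq> (\<Union>n. V n - (\<Union>(\<G> n) \<union> V (Suc n))) \<union> (\<Inter>n. V n)"
    proof
      fix x assume x: "x \<in> \<Omega> - \<Union>\<F>"
      show "x \<in> (\<Union>n. V n - (\<Union>(\<G> n) \<union> V (Suc n))) \<union> (\<Inter>n. V n)"
      proof (rule ccontr)
        assume no: "x \<notin> (\<Union>n. V n - (\<Union>(\<G> n) \<union> V (Suc n))) \<union> (\<Inter>n. V n)"
        have "x \<in> V n" for n
        proof (induction n)
          case 0
          then show ?case using x init by simp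
        next
          case (Suc n)
          have "x \<notin> \<Union>(\<G> n)" using x unfolding \<F>_def by blast
          then show ?case using no Suc by blast
        qed
        then show False using no by blast
      qed
    qed
  qed
  have pw: "piecewise_affine \<Omega> W"
    unfolding piecewise_affine_def
  proof (intro conjI exI)
    show "W11 \<Omega> W" using W11g by (auto simp: W11_def)
    show "countable \<F>" unfolding \<F>_def by (intro countable_UN Gc) simp
    show "disjoint \<F>" unfolding disjoint_def
    proof (intro ballI impI)
      fix R R' assume "R \<in> \<F>" "R' \<in> \<F>" and ne: "R \<noteq> R'"
      then obtain m n where mn: "R \<in> \<G> m" "R' \<in> \<G> n" unfolding \<F>_def by blast
      have lt: "S1 \<inter> S2 = {}" if "S1 \<in> \<G> k" "S2 \<in> \<G> l" "k < l" for S1 S2 k l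
        using Gr(3)[OF that(1)] Gr(2)[OF that(2)] Vanti[of "Suc k" l] that(3) by auto
      consider "m < n" | "n < m" | "m = n" by linarith
      then show "R \<inter> R' = {}"
      proof cases
        case 3
        then show ?thesis using Gd[of m] mn ne unfolding disjoint_def by blast
      qed (use lt mn in blast)+
    qed
    show "\<forall>R\<in>\<F>. regular_domain R \<and> R \<subseteq> \<Omega>" using Gr V\<Omega> unfolding \<F>_def by blast
    show "\<Omega> - \<Union>\<F> \<in> null_sets lebesgue" by fact
    show "\<Omega> = \<Union>\<F> \<union> (\<Omega> - \<Union>\<F>)" using F\<Omega> by blast
    show "\<forall>R\<in>\<F>. \<exists>Y b. \<forall>x\<in>R. W x = affine_map Y b x"
    proof
      fix R assume "R \<in> \<F>"
      then obtain n where n: "R \<in> \<G> n" unfolding \<F>_def by blast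
      then obtain Y b where "\<forall>x\<in>R. G (Suc n) x = Y \<and> w (Suc n) x = affine_map Y b x" using Ga[of n] by blast
      then show "\<exists>Y b. \<forall>x\<in>R. W x = affine_map Y b x" using stable(1)[OF _ n] by auto
    qed
  qed
  have inK: "Gf x \<in> K" if x: "x \<in> \<Union>\<F>" for x
  proof -
    obtain n R where R: "R \<in> \<G> n" "x \<in> R" using x unfolding \<F>_def by blast
    obtain Y b where "Y \<in> K" "\<forall>x\<in>R. G (Suc n) x = Y \<and> w (Suc n) x = affine_map Y b x" using Ga[of n] R(1) by blast
    then show ?thesis using stable(2)[OF R(2,1)] R(2) by simp
  qed
  have AEK: "AE x in lebesgue. x \<in> \<Omega> \<longrightarrow> Gf x \<in> K"
    using AE_not_in[OF nullF] by eventually_elim (use inK in blast)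
  have uuh: "holder_on (\<delta> / 4) \<alpha> UNIV uu"
    unfolding uu_def[abs_def] es(2)[symmetric]
    by (rule holder_on_suminf[OF uh es(1) summable_norm_cancel[OF usum]])
  have uule: "norm (uu x) \<le> \<delta> / 4" for x
    unfolding uu_def es(2)[symmetric] by (rule norm_suminf_le[OF ule es(1)])
  have uu0: "uu x = 0" if "x \<notin> \<Omega>" for x
  proof -
    have "u n x = 0" for n using zero(1) V\<Omega>[of n] that by blast
    then show ?thesis by (simp add: uu_def)
  qed
  have small: "holder_norm \<alpha> (closure \<Omega>) (\<lambda>x. W x - ?l x) < ennreal \<delta>"
  proof -
    have "holder_norm \<alpha> (closure \<Omega>) (\<lambda>x. W x - ?l x) \<le> ennreal (\<delta> / 4) + ennreal (\<delta> / 4)"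
      using uule uuh by (intro holder_norm_le) (auto simp: W_def holder_on_def)
    also have "\<dots> = ennreal (\<delta> / 2)" using \<delta> by (simp add: ennreal_plus[symmetric] del: ennreal_plus)
    also have "\<dots> < ennreal \<delta>" using \<delta> by (simp add: ennreal_less_iff)
    finally show ?thesis .
  qed
  have hs: "W \<in> holder_space \<alpha> (closure \<Omega>)"
  proof -
    obtain A where A: "A \<ge> 0" "holder_on A \<alpha> (closure \<Omega>) ?l"
      by (rule affine_map_holder_on[of "closure \<Omega>" \<alpha> X\<^sub>0 b]) (use \<Omega>b \<alpha> in auto)
    have "holder_on (\<delta> / 4) \<alpha> (closure \<Omega>) uu" using uuh by (simp add: holder_on_def)
    then have h: "holder_on (A + \<delta> / 4) \<alpha> (closure \<Omega>) W"
      unfolding W_def[abs_def] by (rule holder_on_add(1)[OF A(2)])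
    have ac: "continuous_on (closure \<Omega>) ?l"
      unfolding affine_map_def[abs_def] by (intro continuous_intros matrix_vector_mult_linear_continuous_on)
    have "compact (closure \<Omega>)" using \<Omega>b by simp
    then obtain B where B: "\<And>x. x \<in> closure \<Omega> \<Longrightarrow> norm (?l x) \<le> B"
      using continuous_on_compact_bound[OF _ ac] by blast
    have "norm (W x) \<le> B + \<delta> / 4" if "x \<in> closure \<Omega>" for x
      using norm_triangle_ineq[of "?l x" "uu x"] B[OF that] uule[of x] by (simp add: W_def)
    then have "holder_norm \<alpha> (closure \<Omega>) W \<le> ennreal (B + \<delta> / 4) + ennreal (A + \<delta> / 4)"
      by (rule holder_norm_le[OF _ h])
    also have "\<dots> < \<infinity>" by simp
    finally show ?thesis by (simp add: holder_space_def)
  qed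
  have bd: "\<forall>x\<in>frontier \<Omega>. W x = ?l x"
    using uu0 \<Omega>o by (auto simp: W_def frontier_def interior_open)
  define C where "C = M * (I0 * 2) + 1"
  have C: "C > 0" using M I0_nn by (simp add: C_def add_nonneg_pos)
  have upper: "measure lebesgue (super_level \<Omega> Gf t) \<le> C * t powr (- p)" if t: "t > 0" for t
  proof -
    have Es[measurable]: "{x\<in>V n. norm (G (Suc n) x) > t} \<in> sets lebesgue" for n
      by (rule superlevel_in_sets_lebesgue[OF Gm Vs])
    let ?E = "\<Union>n. {x\<in>V n. norm (G (Suc n) x) > t}"
    have sub: "super_level \<Omega> Gf t \<subseteq> (\<Omega> - \<Union>\<F>) \<union> ?E"
    proof
      fix x assume x: "x \<in> super_level \<Omega> Gf t"
      show "x \<in> (\<Omega> - \<Union>\<F>) \<union> ?E"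
      proof (cases "x \<in> \<Union>\<F>")
        case True
        then obtain n R where R: "R \<in> \<G> n" "x \<in> R" unfolding \<F>_def by blast
        then have "x \<in> V n" "norm (G (Suc n) x) > t"
          using Gr(2) x stable(2)[OF R(2,1)] by (auto simp: super_level_def)
        then show ?thesis by blast
      qed (use x in \<open>auto simp: super_level_def\<close>)
    qed
    have Esm: "?E \<in> sets lebesgue" by (intro sets.countable_UN) (use Es in auto)
    have "emeasure lebesgue (super_level \<Omega> Gf t) \<le> emeasure lebesgue ((\<Omega> - \<Union>\<F>) \<union> ?E)"
      using nullF Esm by (intro emeasure_mono sub sets.Un) auto
    also have "\<dots> = emeasure lebesgue (?E \<union> (\<Omega> - \<Union>\<F>))" by (simp only: Un_commute)
    also have "\<dots> = emeasure lebesgue ?E" by (rule emeasure_Un_null_set[OF Esm nullF])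
    also have "\<dots> \<le> (\<Sum>n. emeasure lebesgue {x\<in>V n. norm (G (Suc n) x) > t})"
      by (rule emeasure_subadditive_countably) (use Es in auto)
    also have "\<dots> \<le> (\<Sum>n. ennreal (M * t powr (- p)) * ?J n)"
    proof (intro suminf_le summableI)
      show "emeasure lebesgue {x\<in>V n. norm (G (Suc n) x) > t} \<le> ennreal (M * t powr (- p)) * ?J n" for n
        using S[of n] t by blast
    qed
    also have "\<dots> = ennreal (M * t powr (- p)) * (\<Sum>n. ?J n)" by simp
    also have "\<dots> \<le> ennreal (M * t powr (- p)) * ennreal (I0 * 2)" by (intro mult_left_mono Jsum) simp
    also have "\<dots> = ennreal (M * (I0 * 2) * t powr (- p))"
      using M I0_nn by (simp add: ennreal_mult[symmetric] mult_ac)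
    finally have "measure lebesgue (super_level \<Omega> Gf t) \<le> M * (I0 * 2) * t powr (- p)"
      using M I0_nn unfolding measure_def by (intro enn2real_leI) auto
    also have "\<dots> \<le> C * t powr (- p)" unfolding C_def by (intro mult_right_mono) auto
    finally show ?thesis .
  qed
  have lower: "(c - \<epsilon>) * measure lebesgue \<Omega> * t powr (- p) \<le> measure lebesgue (super_level \<Omega> Gf t)" if t: "t > 1" for t
  proof -
    have "gg \<in> borel_measurable lebesgue" using WP by (auto simp: weak_pair_def)
    then have "Gf \<in> borel_measurable lebesgue" unfolding Gf_def[abs_def] by measurable
    then have ss: "super_level \<Omega> Gf t \<in> sets lebesgue"
      unfolding super_level_def by (rule superlevel_in_sets_lebesgue[OF _ \<Omega>s])
    have sm: "super_level \<Omega> Gf t \<in> lmeasurable"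
      by (rule fmeasurableI2[OF \<Omega>m _ ss]) (unfold super_level_def, blast)
    have "{x\<in>\<Union>(\<G> 0). norm (G (Suc 0) x) > t} \<subseteq> super_level \<Omega> Gf t"
    proof
      fix x assume "x \<in> {x\<in>\<Union>(\<G> 0). norm (G (Suc 0) x) > t}"
      then obtain R where R: "R \<in> \<G> 0" "x \<in> R" "norm (G (Suc 0) x) > t" by blast
      then show "x \<in> super_level \<Omega> Gf t"
        using stable(2)[OF R(2,1)] Gr(2)[OF R(1)] init by (auto simp: super_level_def)
    qed
    then have "emeasure lebesgue {x\<in>\<Union>(\<G> 0). norm (G (Suc 0) x) > t} \<le> emeasure lebesgue (super_level \<Omega> Gf t)"
      by (rule emeasure_mono[OF _ ss])
    moreover have "ennreal ((c - \<epsilon>) * t powr (- p)) * emeasure lebesgue (V 0) \<le> emeasure lebesgue {x\<in>\<Union>(\<G> 0). norm (G (Suc 0) x) > t}"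
      using S[of 0] t by blast
    ultimately have "ennreal ((c - \<epsilon>) * t powr (- p)) * ennreal (measure lebesgue \<Omega>) \<le> ennreal (measure lebesgue (super_level \<Omega> Gf t))"
      unfolding init emeasure_eq_measure2[OF sm] emeasure_eq_measure2[OF \<Omega>m] by (rule order_trans[rotated])
    then have "ennreal ((c - \<epsilon>) * t powr (- p) * measure lebesgue \<Omega>) \<le> ennreal (measure lebesgue (super_level \<Omega> Gf t))"
      by (simp add: ennreal_mult'')
    then have "(c - \<epsilon>) * t powr (- p) * measure lebesgue \<Omega> \<le> measure lebesgue (super_level \<Omega> Gf t)"
      by (simp add: ennreal_le_iff)
    then show ?thesis by (simp add: mult_ac)
  qed
  show ?thesis
    using C pw W11g hs bd AEK small upper lower by (intro exI[of _ W] exI[of _ Gf] exI[of _ C]) blast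
qed

theorem theorem1p2:
  fixes U K :: "(real^'m^'d) set" and p :: real
  assumes "open U" and "1 < p" and "reducible_weak_Lp U K p"
  shows "(\<forall>\<Omega> X\<^sub>0 b \<delta> \<alpha>. regular_domain \<Omega> \<longrightarrow> X\<^sub>0 \<in> U \<longrightarrow> \<delta> > 0 \<longrightarrow> 0 < \<alpha> \<longrightarrow> \<alpha> < 1 \<longrightarrow>
           (\<exists>w G. piecewise_affine \<Omega> w \<and> W11_gradient \<Omega> w G \<and>
              w \<in> holder_space \<alpha> (closure \<Omega>) \<and>
              (\<forall>x\<in>frontier \<Omega>. w x = affine_map X\<^sub>0 b x) \<and>
              (AE x in lebesgue. x \<in> \<Omega> \<longrightarrow> G x \<in> K) \<and>
              holder_norm \<alpha> (closure \<Omega>) (\<lambda>x. w x - affine_map X\<^sub>0 b x) < ennreal \<delta> \<and>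
              (\<exists>C>0. \<forall>t>0. measure lebesgue (super_level \<Omega> G t) \<le> C * t powr (- p)))) \<and>
         (exactly_reducible_weak_Lp U K p \<longrightarrow>
          (\<forall>\<Omega> X\<^sub>0 b \<delta> \<alpha>. regular_domain \<Omega> \<longrightarrow> X\<^sub>0 \<in> U \<longrightarrow> \<delta> > 0 \<longrightarrow> 0 < \<alpha> \<longrightarrow> \<alpha> < 1 \<longrightarrow>
           (\<exists>w G C c. C > 0 \<and> c > 0 \<and> piecewise_affine \<Omega> w \<and> W11_gradient \<Omega> w G \<and>
              w \<in> holder_space \<alpha> (closure \<Omega>) \<and>
              (\<forall>x\<in>frontier \<Omega>. w x = affine_map X\<^sub>0 b x) \<and>
              (AE x in lebesgue. x \<in> \<Omega> \<longrightarrow> G x \<in> K) \<and>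
              holder_norm \<alpha> (closure \<Omega>) (\<lambda>x. w x - affine_map X\<^sub>0 b x) < ennreal \<delta> \<and>
              (\<forall>t>0. measure lebesgue (super_level \<Omega> G t) \<le> C * t powr (- p)) \<and>
              (\<forall>t>1. measure lebesgue (super_level \<Omega> G t) \<ge> c * t powr (- p)))))"
proof (intro conjI impI allI)
  fix \<Omega> :: "(real^'m) set" and X\<^sub>0 :: "real^'m^'d" and b and \<delta> \<alpha> :: real
  assume \<Omega>: "regular_domain \<Omega>" and X0: "X\<^sub>0 \<in> U" and \<delta>: "\<delta> > 0" and \<alpha>: "0 < \<alpha>" "\<alpha> < 1"
  obtain M where M: "M \<ge> 1" and red: "\<forall>X\<in>U. \<forall>b. \<forall>\<epsilon>\<in>{0<..<1}. \<forall>\<alpha>\<in>{0<..<1}. \<forall>q>1. \<forall>\<Omega>. regular_domain \<Omega> \<longrightarrow>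
        (\<exists>w G. reducing_map U K p M X b \<epsilon> \<alpha> q \<Omega> w G)"
    using assms(3) unfolding reducible_weak_Lp_def by (elim exE conjE) (rule that)
  \<comment> \<open>with \<open>c = 0\<close> the lower bound demanded of a cell is trivial\<close>
  have cells: "\<forall>X\<in>U. \<exists>A u H \<G> \<B>. cell U K \<alpha> p (M powr p) 0 (1 / 2) X A u H \<G> \<B>"
  proof
    fix X assume X: "X \<in> U"
    have "\<exists>v G. reducing_map U K p M X 0 (1 / 2) \<alpha> p unit_ball v G"
    proof -
      have "(1 / 2 :: real) \<in> {0<..<1}" "\<alpha> \<in> {0<..<1}" using \<alpha> by auto
      then show ?thesis using red X assms(2) regular_domain_unit_ball by blast
    qed
    then obtain v G where "reducing_map U K p M X 0 (1 / 2) \<alpha> p unit_ball v G" by blast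
    then show "\<exists>A u H \<G> \<B>. cell U K \<alpha> p (M powr p) 0 (1 / 2) X A u H \<G> \<B>"
      by (rule cell_of_reducing_map[OF _ assms(2) \<alpha> _ M]) auto
  qed
  have half: "0 < (1 / 2 :: real)" "(1 / 2 :: real) \<le> 1 / 2" by simp_all
  obtain w G C where sol: "C > 0" "piecewise_affine \<Omega> w" "W11_gradient \<Omega> w G" "w \<in> holder_space \<alpha> (closure \<Omega>)"
      "\<forall>x\<in>frontier \<Omega>. w x = affine_map X\<^sub>0 b x" "AE x in lebesgue. x \<in> \<Omega> \<longrightarrow> G x \<in> K"
      "holder_norm \<alpha> (closure \<Omega>) (\<lambda>x. w x - affine_map X\<^sub>0 b x) < ennreal \<delta>"
      "\<forall>t>0. measure lebesgue (super_level \<Omega> G t) \<le> C * t powr (- p)"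
      "\<forall>t>1. measure lebesgue (super_level \<Omega> G t) \<ge> (0 - 1 / 2) * measure lebesgue \<Omega> * t powr (- p)"
    using solution_exists[OF cells assms(2) powr_ge_zero \<alpha> half \<delta> \<Omega> X0, of b] by (elim exE conjE) (rule that)
  show "\<exists>w G. piecewise_affine \<Omega> w \<and> W11_gradient \<Omega> w G \<and>
              w \<in> holder_space \<alpha> (closure \<Omega>) \<and>
              (\<forall>x\<in>frontier \<Omega>. w x = affine_map X\<^sub>0 b x) \<and>
              (AE x in lebesgue. x \<in> \<Omega> \<longrightarrow> G x \<in> K) \<and>
              holder_norm \<alpha> (closure \<Omega>) (\<lambda>x. w x - affine_map X\<^sub>0 b x) < ennreal \<delta> \<and>
              (\<exists>C>0. \<forall>t>0. measure lebesgue (super_level \<Omega> G t) \<le> C * t powr (- p))"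
    by (intro exI[of _ w] exI[of _ G] exI[of _ C] conjI sol)
next
  fix \<Omega> :: "(real^'m) set" and X\<^sub>0 :: "real^'m^'d" and b and \<delta> \<alpha> :: real
  assume ex: "exactly_reducible_weak_Lp U K p"
    and \<Omega>: "regular_domain \<Omega>" and X0: "X\<^sub>0 \<in> U" and \<delta>: "\<delta> > 0" and \<alpha>: "0 < \<alpha>" "\<alpha> < 1"
  obtain M m where M: "M \<ge> 1" and m: "m > 0" and red: "\<forall>X\<in>U. \<forall>b. \<forall>\<epsilon>\<in>{0<..<1}. \<forall>\<alpha>\<in>{0<..<1}. \<forall>q>1. \<forall>\<Omega>. regular_domain \<Omega> \<longrightarrow>
        (\<exists>w G. reducing_map U K p M X b \<epsilon> \<alpha> q \<Omega> w G \<and>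
           (\<forall>t>1. measure lebesgue (super_level \<Omega> G t) \<ge> m powr p * measure lebesgue \<Omega> * t powr (- p)))"
    using ex unfolding exactly_reducible_weak_Lp_def by (elim exE conjE) (rule that)
  define c where "c = m powr p"
  \<comment> \<open>at least half of \<open>c\<close> remains in the lower bound, and the energy is halved\<close>
  define \<epsilon> where "\<epsilon> = min (1 / 2) (c / 2)"
  have c: "c > 0" using m by (simp add: c_def)
  then have \<epsilon>: "0 < \<epsilon>" "\<epsilon> \<le> 1 / 2" "\<epsilon> < c" by (auto simp: \<epsilon>_def)
  have cells: "\<forall>X\<in>U. \<exists>A u H \<G> \<B>. cell U K \<alpha> p (M powr p) c \<epsilon> X A u H \<G> \<B>"
  proof
    fix X assume X: "X \<in> U"
    have "\<exists>v G. reducing_map U K p M X 0 \<epsilon> \<alpha> p unit_ball v G \<and>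
        (\<forall>t>1. measure lebesgue (super_level unit_ball G t) \<ge> m powr p * measure lebesgue (unit_ball :: (real^'m) set) * t powr (- p))"
    proof -
      have "\<epsilon> \<in> {0<..<1}" "\<alpha> \<in> {0<..<1}" using \<alpha> \<epsilon> by auto
      then show ?thesis using red X assms(2) regular_domain_unit_ball by blast
    qed
    then obtain v G where v: "reducing_map U K p M X 0 \<epsilon> \<alpha> p unit_ball v G"
      "\<forall>t>1. measure lebesgue (super_level unit_ball G t) \<ge> c * measure lebesgue (unit_ball :: (real^'m) set) * t powr (- p)"
      unfolding c_def by blast
    show "\<exists>A u H \<G> \<B>. cell U K \<alpha> p (M powr p) c \<epsilon> X A u H \<G> \<B>"
      by (rule cell_of_reducing_map[OF v(1) assms(2) \<alpha> \<epsilon>(1) M]) (use v(2) in blast)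
  qed
  have pos: "(c - \<epsilon>) * measure lebesgue \<Omega> > 0"
  proof -
    have \<Omega>': "open \<Omega>" "bounded \<Omega>" "\<Omega> \<noteq> {}" using \<Omega> by (auto simp: regular_domain_def)
    have "\<Omega> \<in> lmeasurable" using \<Omega>' by (simp add: lmeasurable_open)
    then have "measure lebesgue \<Omega> \<noteq> 0"
      using open_not_negligible[OF \<Omega>'(1,3)] by (simp add: negligible_iff_measure)
    then show ?thesis using \<epsilon> by (simp add: zero_less_measure_iff)
  qed
  obtain w G C where sol: "C > 0" "piecewise_affine \<Omega> w" "W11_gradient \<Omega> w G" "w \<in> holder_space \<alpha> (closure \<Omega>)"
      "\<forall>x\<in>frontier \<Omega>. w x = affine_map X\<^sub>0 b x" "AE x in lebesgue. x \<in> \<Omega> \<longrightarrow> G x \<in> K"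
      "holder_norm \<alpha> (closure \<Omega>) (\<lambda>x. w x - affine_map X\<^sub>0 b x) < ennreal \<delta>"
      "\<forall>t>0. measure lebesgue (super_level \<Omega> G t) \<le> C * t powr (- p)"
      "\<forall>t>1. measure lebesgue (super_level \<Omega> G t) \<ge> (c - \<epsilon>) * measure lebesgue \<Omega> * t powr (- p)"
    using solution_exists[OF cells assms(2) powr_ge_zero \<alpha> \<epsilon>(1,2) \<delta> \<Omega> X0, of b] by (elim exE conjE) (rule that)
  show "\<exists>w G C c. C > 0 \<and> c > 0 \<and> piecewise_affine \<Omega> w \<and> W11_gradient \<Omega> w G \<and>
              w \<in> holder_space \<alpha> (closure \<Omega>) \<and>
              (\<forall>x\<in>frontier \<Omega>. w x = affine_map X\<^sub>0 b x) \<and>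
              (AE x in lebesgue. x \<in> \<Omega> \<longrightarrow> G x \<in> K) \<and>
              holder_norm \<alpha> (closure \<Omega>) (\<lambda>x. w x - affine_map X\<^sub>0 b x) < ennreal \<delta> \<and>
              (\<forall>t>0. measure lebesgue (super_level \<Omega> G t) \<le> C * t powr (- p)) \<and>
              (\<forall>t>1. measure lebesgue (super_level \<Omega> G t) \<ge> c * t powr (- p))"
    by (intro exI[of _ w] exI[of _ G] exI[of _ C] exI[of _ "(c - \<epsilon>) * measure lebesgue \<Omega>"] conjI sol pos)
qed

end
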